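(* Let $n\ge 0$ and $a,b,c,d\ge 0$ be integers with $a+2b+2c+3d=3n$. Then $$N_{a,b,c,d}=\sum_{\substack{0\le d'\le d\\ \beta\in p_4(b)\\ \gamma\in p_3(c+d')}}(-1)^{d-d'}\binom{d}{d'}\binom{b}{\beta}\binom{c+d'}{\gamma}\;\omega_{(i_1,i_2,i_3)},$$ where $$\begin{aligned} i_1&=1+d-d'+\gamma_2+\gamma_3+\beta_1,\\ i_2&=2+d-d'+\gamma_1+\gamma_3+\beta_2+2\beta_4,\\ i_3&=3+d-d'+\gamma_1+\gamma_2+2\beta_3+\beta_2.\end{aligned}$$
   Context: For integers $h\ge1,m\ge 0$: $p_h(m)=\{\mu=(\mu_1,\dots,\mu_h)\in\mathbb N^h:\sum_i\mu_i=m\}$ (with $0\in\mathbb N$), and $\binom{m}{\mu}=\frac{m!}{\mu_1!\cdots\mu_h!}$. $G(3,n+3)$ is the Grassmannian of $3$-dimensional subspaces of $\mathbb C^{n+3}$, $\sigma_i$ is the $i$-th Chern class of its universal quotient bundle of rank $n$ ($\sigma_0=1$, $\sigma_i=0$ for $i<0$ or $i>n$), and for an increasing sequence $I=(i_1<i_2<i_3)$ of positive integers $\sigma_I=\det(\sigma_{i_s-r})_{1\le r,s\le 3}$. Here $\int_{G(3,n+3)}$ is the degree of the $0$-dimensional part of a cycle class. The number $N_{a,b,c,d}$ is $$N_{a,b,c,d}=\int_{G(3,n+3)}\sigma_1^a\,\sigma_2^b\,\sigma_{(1,3,4)}^c\,\sigma_{(1,3,5)}^d\cap[G(3,n+3)].$$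 It is the number, counted with (intersection) multiplicities, of projectively non-equivalent rational plane curves of degree $n+2$ (i.e. base point free linear series $g^2_{n+2}$ on $\mathbb P^1$) having $a$ flexes, $b$ hyperflexes, $c$ cusps and $d$ tacnodes at $a+b+c+d$ prescribed distinct points of $\mathbb P^1$. Here a point $P$ gives a flex, hyperflex, cusp, tacnode if the ramification sequence of the linear series at $P$ is $(1,2,4)$, $(1,2,5)$, $(1,3,4)$, $(1,3,5)$ respectively; the ramification sequence of $V\subset H^0(\mathbb P^1,\mathcal O(n+2))$, $\dim V=3$, at $P$ is $i_1<i_2<i_3$, where $i_j-1$ are the orders of vanishing at $P$ of nonzero sections in $V$. For $1\le i_1<i_2<i_3\le n+3$, with $w=\sum_{s=1}^{3}(i_s-s)$, $\omega_{(i_1,i_2,i_3)}=\int_{G(3,n+3)}\sigma_1^{3n-w}\sigma_{(i_1,i_2,i_3)}\cap[G(3,n+3)]$ is the degree, in the Plücker embedding, of the corresponding Schubert variety (of codimension $w$). For a triple of distinct integers in $\{1,\dots,n+3\}$ obtained from an increasing triple $I$ by a permutation $\tau$, $\omega_{I^\tau}:=\mathrm{sgn}(\tau)\,\omega_I$; $\omega$ is $0$ if the triple has two equal entries or an entry larger than $n+3$. *)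

theory Defs
  imports
    "HOL-Analysis.Analysis"
    "HOL-Combinatorics.Permutations"
    "Jordan_Normal_Form.Matrix_Kernel"
    "Jordan_Normal_Form.Schur_Decomposition"
begin

no_notation vec_nth (infixl "$" 90)

section \<open>Complex-valued exterior forms at a point\<close>

text \<open>
  The exterior algebra over the complex numbers on generators dx_0, dx_1, dx_2, ...
  A form is given by its coefficients at the monomials
  dx_S = dx_{s_1} dx_{s_2} ... dx_{s_k}, where S = {s_1 < ... < s_k} is a finite set.
  (Infinite sums of monomials are not excluded; they never occur below.)
\<close>

typedef dform = "{f :: nat set \<Rightarrow> complex. \<forall>S. infinite S \<longrightarrow> f S = 0}"
  morphisms coeff Abs_dform
  by (rule exI[of _ "\<lambda>_. 0"]) simp

setup_lifting type_definition_dform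

lemma dform_eqI: "(\<And>S. finite S \<Longrightarrow> coeff \<alpha> S = coeff \<beta> S) \<Longrightarrow> \<alpha> = \<beta>"
  by transfer (metis ext)

text \<open>dx_T dx_U = shuffle_sign T U dx_(T Un U) for disjoint finite T, U.\<close>

definition shuffle_sign :: "nat set \<Rightarrow> nat set \<Rightarrow> complex" where
  "shuffle_sign T U = (- 1) ^ card {(t, u). t \<in> T \<and> u \<in> U \<and> u < t}"

lemma shuffle_sign_empty [simp]: "shuffle_sign {} U = 1" "shuffle_sign T {} = 1"
  by (simp_all add: shuffle_sign_def)

lemma shuffle_sign_Un_left:
  assumes "finite A" "finite B" "finite C" "A \<inter> B = {}"
  shows "shuffle_sign (A \<union> B) C = shuffle_sign A C * shuffle_sign B C"
proof -
  have "{(t, u). t \<in> A \<union> B \<and> u \<in> C \<and> u < t} =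
      {(t, u). t \<in> A \<and> u \<in> C \<and> u < t} \<union> {(t, u). t \<in> B \<and> u \<in> C \<and> u < t}"
    by auto
  moreover have "finite {(t, u). t \<in> A \<and> u \<in> C \<and> u < t}"
    by (rule finite_subset[of _ "A \<times> C"]) (use assms in auto)
  moreover have "finite {(t, u). t \<in> B \<and> u \<in> C \<and> u < t}"
    by (rule finite_subset[of _ "B \<times> C"]) (use assms in auto)
  moreover have "{(t, u). t \<in> A \<and> u \<in> C \<and> u < t} \<inter> {(t, u). t \<in> B \<and> u \<in> C \<and> u < t} = {}"
    using assms by auto
  ultimately show ?thesis
    unfolding shuffle_sign_def by (simp add: card_Un_disjoint power_add)
qed

lemma shuffle_sign_Un_right:
  assumes "finite A" "finite B" "finite C" "B \<inter> C = {}"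
  shows "shuffle_sign A (B \<union> C) = shuffle_sign A B * shuffle_sign A C"
proof -
  have "{(t, u). t \<in> A \<and> u \<in> B \<union> C \<and> u < t} =
      {(t, u). t \<in> A \<and> u \<in> B \<and> u < t} \<union> {(t, u). t \<in> A \<and> u \<in> C \<and> u < t}"
    by auto
  moreover have "finite {(t, u). t \<in> A \<and> u \<in> B \<and> u < t}"
    by (rule finite_subset[of _ "A \<times> B"]) (use assms in auto)
  moreover have "finite {(t, u). t \<in> A \<and> u \<in> C \<and> u < t}"
    by (rule finite_subset[of _ "A \<times> C"]) (use assms in auto)
  moreover have "{(t, u). t \<in> A \<and> u \<in> B \<and> u < t} \<inter> {(t, u). t \<in> A \<and> u \<in> C \<and> u < t} = {}"
    using assms by auto
  ultimately show ?thesis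
    unfolding shuffle_sign_def by (simp add: card_Un_disjoint power_add)
qed

instantiation dform :: "{zero, one, plus, minus, uminus, times}"
begin

lift_definition zero_dform :: dform is "\<lambda>_. 0" by simp

lift_definition one_dform :: dform is "\<lambda>S. if S = {} then 1 else 0" by auto

lift_definition plus_dform :: "dform \<Rightarrow> dform \<Rightarrow> dform" is "\<lambda>f g S. f S + g S" by simp

lift_definition minus_dform :: "dform \<Rightarrow> dform \<Rightarrow> dform" is "\<lambda>f g S. f S - g S" by simp

lift_definition uminus_dform :: "dform \<Rightarrow> dform" is "\<lambda>f S. - f S" by simp

text \<open>The product is the wedge product.\<close>

lift_definition times_dform :: "dform \<Rightarrow> dform \<Rightarrow> dform" is
  "\<lambda>f g S. \<Sum>T\<in>Pow S. shuffle_sign T (S - T) * f T * g (S - T)"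
  by simp

instance ..

end

lemma dform_times_assoc: "(\<alpha> * \<beta>) * \<gamma> = \<alpha> * (\<beta> * (\<gamma> :: dform))"
proof (rule dform_eqI)
  fix S :: "nat set"
  assume S: "finite S"
  let ?a = "coeff \<alpha>" and ?b = "coeff \<beta>" and ?c = "coeff \<gamma>"
  let ?L = "\<lambda>(T, U). shuffle_sign T (S - T) * shuffle_sign U (T - U) * ?a U * ?b (T - U) * ?c (S - T)"
  let ?R = "\<lambda>(U, W). shuffle_sign U (S - U) * shuffle_sign W (S - U - W) * ?a U * ?b W * ?c (S - U - W)"
  have "coeff ((\<alpha> * \<beta>) * \<gamma>) S = (\<Sum>T\<in>Pow S. \<Sum>U\<in>Pow T. ?L (T, U))"
    by (simp add: times_dform.rep_eq sum_distrib_left sum_distrib_right mult_ac)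
  also have "\<dots> = sum ?L (SIGMA T:Pow S. Pow T)"
    using S by (subst sum.Sigma) (auto intro: finite_subset)
  also have "\<dots> = sum ?R (SIGMA U:Pow S. Pow (S - U))"
  proof (rule sum.reindex_bij_witness[of _ "\<lambda>(U, W). (U \<union> W, U)" "\<lambda>(T, U). (U, T - U)"])
    fix p assume "p \<in> (SIGMA T:Pow S. Pow T)"
    then obtain T U where p: "p = (T, U)" and TU: "T \<subseteq> S" "U \<subseteq> T" by auto
    have fin: "finite T" "finite U" "finite (T - U)" "finite (S - T)"
      using S TU by (auto intro: finite_subset)
    have "shuffle_sign T (S - T) = shuffle_sign U (S - T) * shuffle_sign (T - U) (S - T)"
      using shuffle_sign_Un_left[of U "T - U" "S - T"] fin TU
      by (simp add: Un_absorb1)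
    moreover have "shuffle_sign U (S - U) = shuffle_sign U (T - U) * shuffle_sign U (S - T)"
    proof -
      have "S - U = (T - U) \<union> (S - T)" using TU by auto
      then show ?thesis
        using shuffle_sign_Un_right[of U "T - U" "S - T"] fin by auto
    qed
    moreover have "S - U - (T - U) = S - T" using TU by auto
    ultimately show "?R (case p of (T, U) \<Rightarrow> (U, T - U)) = ?L p"
      by (simp add: p)
  qed auto
  also have "\<dots> = (\<Sum>U\<in>Pow S. \<Sum>W\<in>Pow (S - U). ?R (U, W))"
    using S by (subst sum.Sigma) (auto intro: finite_subset)
  also have "\<dots> = coeff (\<alpha> * (\<beta> * \<gamma>)) S"
    by (simp add: times_dform.rep_eq sum_distrib_left sum_distrib_right mult_ac)
  finally show "coeff ((\<alpha> * \<beta>) * \<gamma>) S = coeff (\<alpha> * (\<beta> * \<gamma>)) S" .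
qed

instance dform :: ring_1
proof
  fix \<alpha> \<beta> \<gamma> :: dform
  show "\<alpha> * \<beta> * \<gamma> = \<alpha> * (\<beta> * \<gamma>)" by (rule dform_times_assoc)
  show "1 * \<alpha> = \<alpha>"
  proof (rule dform_eqI)
    fix S :: "nat set" assume S: "finite S"
    have "coeff (1 * \<alpha>) S = (\<Sum>T\<in>Pow S. if T = {} then coeff \<alpha> S else 0)"
      unfolding times_dform.rep_eq one_dform.rep_eq by (rule sum.cong) auto
    also have "\<dots> = coeff \<alpha> S" using S by simp
    finally show "coeff (1 * \<alpha>) S = coeff \<alpha> S" .
  qed
  show "\<alpha> * 1 = \<alpha>"
  proof (rule dform_eqI)
    fix S :: "nat set" assume S: "finite S"
    have "coeff (\<alpha> * 1) S = (\<Sum>T\<in>Pow S. if T = S then coeff \<alpha> S else 0)"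
      unfolding times_dform.rep_eq one_dform.rep_eq by (rule sum.cong) auto
    also have "\<dots> = coeff \<alpha> S" using S by simp
    finally show "coeff (\<alpha> * 1) S = coeff \<alpha> S" .
  qed
  show "(\<alpha> + \<beta>) * \<gamma> = \<alpha> * \<gamma> + \<beta> * \<gamma>"
    by (rule dform_eqI)
      (simp add: times_dform.rep_eq plus_dform.rep_eq algebra_simps sum.distrib)
  show "\<alpha> * (\<beta> + \<gamma>) = \<alpha> * \<beta> + \<alpha> * \<gamma>"
    by (rule dform_eqI)
      (simp add: times_dform.rep_eq plus_dform.rep_eq algebra_simps sum.distrib)
  show "(0::dform) \<noteq> 1"
  proof
    assume "(0::dform) = 1"
    then have "coeff 0 {} = coeff 1 {}" by simp
    then show False by (simp add: zero_dform.rep_eq one_dform.rep_eq)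
  qed
qed (transfer; simp add: fun_eq_iff)+

lift_definition const_form :: "complex \<Rightarrow> dform" is "\<lambda>c S. if S = {} then c else 0"
  by auto

lift_definition dx :: "nat \<Rightarrow> dform" is "\<lambda>k S. if S = {k} then 1 else 0"
  by auto

lift_definition degree_part :: "nat \<Rightarrow> dform \<Rightarrow> dform" is
  "\<lambda>k f S. if card S = k then f S else 0"
  by simp

text \<open>
  Only applied to matrices whose entries are of even degree; these commute, so that the order of
  the factors is irrelevant.
\<close>

definition form_det :: "dform mat \<Rightarrow> dform" where
  "form_det A = (\<Sum>p | p permutes {0..<dim_row A}.
     of_int (sign p) * prod_list (map (\<lambda>i. A $$ (i, p i)) [0..<dim_row A]))"


section \<open>Chern forms of the image of a projection\<close>

text \<open>
  Points of real m-space are functions on the index set {..<m}.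
\<close>

definition partial_deriv :: "nat \<Rightarrow> ((nat \<Rightarrow> real) \<Rightarrow> complex) \<Rightarrow> (nat \<Rightarrow> real) \<Rightarrow> complex" where
  "partial_deriv k f x = vector_derivative (\<lambda>t. f (x(k := t))) (at (x k))"

definition differential :: "nat \<Rightarrow> ((nat \<Rightarrow> real) \<Rightarrow> complex) \<Rightarrow> (nat \<Rightarrow> real) \<Rightarrow> dform" where
  "differential m f x = (\<Sum>k<m. const_form (partial_deriv k f x) * dx k)"

definition matrix_differential ::
    "nat \<Rightarrow> ((nat \<Rightarrow> real) \<Rightarrow> complex mat) \<Rightarrow> (nat \<Rightarrow> real) \<Rightarrow> dform mat" where
  "matrix_differential m P x = mat (dim_row (P x)) (dim_col (P x))
     (\<lambda>(i, j). differential m (\<lambda>y. P y $$ (i, j)) x)"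

text \<open>
  Let P be a smooth family of idempotent N by N matrices. On the vector bundle E with fibres
  E_x = image of P x inside the trivial bundle with fibre C^N, the formula nabla s = P ds defines
  a connection. For a section s = P s one has nabla (nabla s) = P d(P ds) = P dP ds = P dP dP s,
  because P dP P = 0. Hence the curvature of nabla, extended by 0 to the kernel of P, is
  P dP dP P, and by Chern and Weil the total Chern class of E is represented by
  det (1 + (i / 2 pi) P dP dP P).
\<close>

definition curvature ::
    "nat \<Rightarrow> ((nat \<Rightarrow> real) \<Rightarrow> complex mat) \<Rightarrow> (nat \<Rightarrow> real) \<Rightarrow> dform mat" where
  "curvature m P x = map_mat const_form (P x) * matrix_differential m P x
     * matrix_differential m P x * map_mat const_form (P x)"

definition total_chern_form ::
    "nat \<Rightarrow> ((nat \<Rightarrow> real) \<Rightarrow> complex mat) \<Rightarrow> (nat \<Rightarrow> real) \<Rightarrow> dform" where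
  "total_chern_form m P x =
     form_det (1\<^sub>m (dim_row (P x)) + const_form (\<i> / (2 * of_real pi)) \<cdot>\<^sub>m curvature m P x)"

definition chern_form ::
    "nat \<Rightarrow> ((nat \<Rightarrow> real) \<Rightarrow> complex mat) \<Rightarrow> nat \<Rightarrow> (nat \<Rightarrow> real) \<Rightarrow> dform" where
  "chern_form m P k x = degree_part (2 * k) (total_chern_form m P x)"


section \<open>Orthogonal projections\<close>

lemma mat_adjoint_carrier: "A \<in> carrier_mat nr nc \<Longrightarrow> mat_adjoint A \<in> carrier_mat nc nr"
  by (auto simp: mat_adjoint_def)

lemma mat_adjoint_index:
  "i < dim_col A \<Longrightarrow> j < dim_row A \<Longrightarrow> mat_adjoint A $$ (i, j) = conjugate (A $$ (j, i))"
  by (simp add: mat_adjoint_def mat_of_rows_index)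

lemma mat_adjoint_mult:
  fixes A B :: "complex mat"
  assumes A: "A \<in> carrier_mat n k" and B: "B \<in> carrier_mat k m"
  shows "mat_adjoint (A * B) = mat_adjoint B * mat_adjoint A"
proof (rule eq_matI)
  note c = A B mat_adjoint_carrier[OF A] mat_adjoint_carrier[OF B]
    mat_adjoint_carrier[OF mult_carrier_mat[OF A B]]
  show "dim_row (mat_adjoint (A * B)) = dim_row (mat_adjoint B * mat_adjoint A)"
    "dim_col (mat_adjoint (A * B)) = dim_col (mat_adjoint B * mat_adjoint A)"
    using c by auto
  fix i j assume "i < dim_row (mat_adjoint B * mat_adjoint A)" "j < dim_col (mat_adjoint B * mat_adjoint A)"
  then have ij: "i < m" "j < n" using c by auto
  then show "mat_adjoint (A * B) $$ (i, j) = (mat_adjoint B * mat_adjoint A) $$ (i, j)"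
    using c by (simp add: mat_adjoint_index scalar_prod_def mult.commute)
qed

lemma mat_adjoint_adjoint: "mat_adjoint (mat_adjoint A) = (A :: complex mat)"
proof -
  have c: "mat_adjoint A \<in> carrier_mat (dim_col A) (dim_row A)"
    by (rule mat_adjoint_carrier) auto
  show ?thesis
    using c mat_adjoint_carrier[OF c]
    by (intro eq_matI) (auto simp: mat_adjoint_index)
qed

lemma mat_kernel_adjoint_mult:
  fixes A :: "complex mat"
  assumes A: "A \<in> carrier_mat n k"
  shows "mat_kernel (mat_adjoint A * A) = mat_kernel A"
proof
  note A' = mat_adjoint_carrier[OF A]
  show "mat_kernel A \<subseteq> mat_kernel (mat_adjoint A * A)"
    by (rule mat_kernel_mult_subset[OF A A'])
  show "mat_kernel (mat_adjoint A * A) \<subseteq> mat_kernel A"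
  proof
    fix v assume "v \<in> mat_kernel (mat_adjoint A * A)"
    from mat_kernelD[OF mult_carrier_mat[OF A' A] this]
    have v: "v \<in> carrier_vec k" and 0: "(mat_adjoint A * A) *\<^sub>v v = 0\<^sub>v k" by auto
    define w where "w = A *\<^sub>v v"
    have w: "w \<in> carrier_vec n" using A v by (simp add: w_def)
    have "mat_adjoint A *\<^sub>v w = 0\<^sub>v k"
      using 0 by (simp add: w_def assoc_mult_mat_vec[OF A' A v])
    then have "\<And>j. j < k \<Longrightarrow> (\<Sum>i<n. cnj (A $$ (i, j)) * w $ i) = 0"
    proof -
      fix j assume e: "mat_adjoint A *\<^sub>v w = 0\<^sub>v k" and j: "j < k"
      have "(\<Sum>i<n. cnj (A $$ (i, j)) * w $ i) = (mat_adjoint A *\<^sub>v w) $ j"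
        using A A' w j by (simp add: scalar_prod_def mat_adjoint_index atLeast0LessThan)
      then show "(\<Sum>i<n. cnj (A $$ (i, j)) * w $ i) = 0" using e j by simp
    qed
    note z = this
    have wi: "w $ i = (\<Sum>j<k. A $$ (i, j) * v $ j)" if "i < n" for i
      using A v that by (simp add: w_def scalar_prod_def atLeast0LessThan)
    have "(\<Sum>i<n. cnj (w $ i) * w $ i) = (\<Sum>i<n. \<Sum>j<k. cnj (v $ j) * (cnj (A $$ (i, j)) * w $ i))"
      by (rule sum.cong) (simp_all add: wi sum_distrib_right sum_distrib_left mult_ac)
    also have "\<dots> = (\<Sum>j<k. cnj (v $ j) * (\<Sum>i<n. cnj (A $$ (i, j)) * w $ i))"
      by (subst sum.swap) (simp add: sum_distrib_left)
    also have "\<dots> = 0" using z by simp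
    finally have "complex_of_real (\<Sum>i<n. (cmod (w $ i))\<^sup>2) = 0"
      by (simp add: complex_norm_square mult.commute del: of_real_power)
    then have "(\<Sum>i<n. (cmod (w $ i))\<^sup>2) = 0" using of_real_eq_0_iff by blast
    then have "\<forall>i<n. w $ i = 0" by (subst (asm) sum_nonneg_eq_0_iff) auto
    then have "w = 0\<^sub>v n" using w by (intro eq_vecI) auto
    then show "v \<in> mat_kernel A" using A v by (intro mat_kernelI) (auto simp: w_def)
  qed
qed

lemma inverse_if_kernel_trivial:
  fixes M :: "complex mat"
  assumes M: "M \<in> carrier_mat k k" and ker: "mat_kernel M = {0\<^sub>v k}"
  obtains B where "B \<in> carrier_mat k k" "B * M = 1\<^sub>m k" "M * B = 1\<^sub>m k"
proof -
  have "det M \<noteq> 0"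
    using ker det_0_iff_vec_prod_zero[OF M] mat_kernel[OF M] by auto
  from det_non_zero_imp_unit[OF M this, of undefined]
  show ?thesis by (auto simp: Units_def ring_mat_simps intro: that)
qed

lemma orthogonal_projection_unique:
  assumes P: "P \<in> carrier_mat N N" "P * P = P" "mat_adjoint P = P"
    and Q: "Q \<in> carrier_mat N N" "Q * Q = Q" "mat_adjoint Q = Q"
    and ker: "mat_kernel P = mat_kernel Q"
  shows "P = (Q :: complex mat)"
proof -
  have aux: "Y * X = Y" if X: "X \<in> carrier_mat N N" "X * X = X"
    and Y: "Y \<in> carrier_mat N N" and ker: "mat_kernel X = mat_kernel Y" for X Y :: "complex mat"
  proof -
    have "Y *\<^sub>v (v - X *\<^sub>v v) = 0\<^sub>v N" if v: "v \<in> carrier_vec N" for v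
    proof -
      have "X *\<^sub>v (v - X *\<^sub>v v) = X *\<^sub>v v - X *\<^sub>v (X *\<^sub>v v)"
        using X v by (simp add: mult_minus_distrib_mat_vec)
      also have "X *\<^sub>v (X *\<^sub>v v) = X *\<^sub>v v"
        using X v by (metis assoc_mult_mat_vec)
      finally have "v - X *\<^sub>v v \<in> mat_kernel X"
        using X v by (intro mat_kernelI[OF X(1)]) auto
      then show ?thesis using ker mat_kernelD[OF Y] by auto
    qed
    then have eq: "Y *\<^sub>v v = (Y * X) *\<^sub>v v" if v: "v \<in> carrier_vec N" for v
    proof -
      have "Y *\<^sub>v v - Y *\<^sub>v (X *\<^sub>v v) = 0\<^sub>v N"
        using \<open>\<And>v. v \<in> carrier_vec N \<Longrightarrow> Y *\<^sub>v (v - X *\<^sub>v v) = 0\<^sub>v N\<close>[OF v] X Y v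
        by (simp add: mult_minus_distrib_mat_vec)
      then have "Y *\<^sub>v v = Y *\<^sub>v (X *\<^sub>v v)"
      proof -
        have c: "Y *\<^sub>v v \<in> carrier_vec N" "Y *\<^sub>v (X *\<^sub>v v) \<in> carrier_vec N" using X Y v by auto
        show ?thesis
        proof (rule eq_vecI)
          fix i assume i: "i < dim_vec (Y *\<^sub>v (X *\<^sub>v v))"
          then have "i < N" using Y by simp
          then have "(Y *\<^sub>v v - Y *\<^sub>v (X *\<^sub>v v)) $ i = 0"
            using \<open>Y *\<^sub>v v - Y *\<^sub>v (X *\<^sub>v v) = 0\<^sub>v N\<close> by simp
          then have "(Y *\<^sub>v v) $ i - (Y *\<^sub>v (X *\<^sub>v v)) $ i = 0" using i c by (subst (asm) index_minus_vec) auto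
          then show "(Y *\<^sub>v v) $ i = (Y *\<^sub>v (X *\<^sub>v v)) $ i" by simp
        qed (use c in auto)
      qed
      then show ?thesis using X Y v by (simp add: assoc_mult_mat_vec[of _ N N _ N])
    qed
    show "Y * X = Y"
    proof (rule mat_col_eqI)
      fix i assume "i < dim_col Y"
      then have i: "i < N" using Y by auto
      have "col Z i = Z *\<^sub>v unit_vec N i" if "Z \<in> carrier_mat N N" for Z :: "complex mat"
        using that i by (intro eq_vecI) (auto simp: scalar_prod_right_unit)
      from this[OF mult_carrier_mat[OF Y X(1)]] this[OF Y]
      have "col (Y * X) i = (Y * X) *\<^sub>v unit_vec N i" "col Y i = Y *\<^sub>v unit_vec N i" .
      then show "col (Y * X) i = col Y i" using eq[of "unit_vec N i"] by simp
    qed (use X Y in auto)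
  qed
  have "Q = Q * P" using aux[OF P(1,2) Q(1) ker] by simp
  then have "mat_adjoint Q = mat_adjoint (Q * P)" by simp
  also have "\<dots> = P * Q" using mat_adjoint_mult[OF Q(1) P(1)] P Q by simp
  also have "\<dots> = P" using aux[OF Q(1,2) P(1)] ker by simp
  finally show ?thesis using Q by simp
qed

lemma mat_adjoint_minus:
  fixes A B :: "complex mat"
  assumes A: "A \<in> carrier_mat n k" and B: "B \<in> carrier_mat n k"
  shows "mat_adjoint (A - B) = mat_adjoint A - mat_adjoint B"
proof (rule eq_matI)
  note c = A B mat_adjoint_carrier[OF A] mat_adjoint_carrier[OF B]
    mat_adjoint_carrier[OF minus_carrier_mat[OF B], of A]
  show "dim_row (mat_adjoint (A - B)) = dim_row (mat_adjoint A - mat_adjoint B)"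
    "dim_col (mat_adjoint (A - B)) = dim_col (mat_adjoint A - mat_adjoint B)"
    using c by auto
  fix i j assume "i < dim_row (mat_adjoint A - mat_adjoint B)" "j < dim_col (mat_adjoint A - mat_adjoint B)"
  then have ij: "i < k" "j < n" using c by auto
  then show "mat_adjoint (A - B) $$ (i, j) = (mat_adjoint A - mat_adjoint B) $$ (i, j)"
    using c by (simp add: mat_adjoint_index)
qed

lemma mat_adjoint_one: "mat_adjoint (1\<^sub>m n :: complex mat) = 1\<^sub>m n"
proof -
  have "mat_adjoint (1\<^sub>m n :: complex mat) \<in> carrier_mat n n"
    by (rule mat_adjoint_carrier) auto
  then show ?thesis by (intro eq_matI) (auto simp: mat_adjoint_index)
qed

lemma orthogonal_projection:
  fixes A B :: "complex mat"
  assumes A: "A \<in> carrier_mat N k" and B: "B \<in> carrier_mat k k"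
    and BM: "B * (mat_adjoint A * A) = 1\<^sub>m k"
  defines "P \<equiv> 1\<^sub>m N - A * (B * mat_adjoint A)"
  shows "P \<in> carrier_mat N N" "P * P = P" "mat_adjoint P = P"
    "mat_kernel P = (\<lambda>u. A *\<^sub>v u) ` carrier_vec k"
proof -
  define H where "H = mat_adjoint A"
  have H: "H \<in> carrier_mat k N" unfolding H_def by (rule mat_adjoint_carrier[OF A])
  define R where "R = A * (B * H)"
  have R: "R \<in> carrier_mat N N" using A B H by (simp add: R_def)
  have P_R: "P = 1\<^sub>m N - R" by (simp add: P_def R_def H_def)
  show P: "P \<in> carrier_mat N N" unfolding P_R by (rule minus_carrier_mat[OF R])
  have HA: "H * A \<in> carrier_mat k k" using A H by simp
  have BM': "B * (H * A) = 1\<^sub>m k" using BM by (simp add: H_def)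
  have adjM: "mat_adjoint (H * A) = H * A"
    using mat_adjoint_mult[OF H A] by (simp add: H_def mat_adjoint_adjoint)
  have B': "mat_adjoint B \<in> carrier_mat k k" by (rule mat_adjoint_carrier[OF B])
  have "(H * A) * mat_adjoint B = 1\<^sub>m k"
    using arg_cong[OF BM', of mat_adjoint] mat_adjoint_mult[OF B HA]
    by (simp only: adjM mat_adjoint_one)
  then have "B * ((H * A) * mat_adjoint B) = B" using B by simp
  then have "(B * (H * A)) * mat_adjoint B = B"
    by (simp only: assoc_mult_mat[OF B HA B'])
  then have adjB: "mat_adjoint B = B" using B' by (simp add: BM')
  have BH: "B * H \<in> carrier_mat k N" using B H by simp
  have BHA: "(B * H) * A = 1\<^sub>m k" using BM' assoc_mult_mat[OF B H A] by simp
  have RA: "R * A = A"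
    unfolding R_def assoc_mult_mat[OF A BH A] BHA using A by simp
  have RR: "R * R = R"
    using assoc_mult_mat[OF R A BH] RA by (simp only: R_def[symmetric])
  have "mat_adjoint R = mat_adjoint (B * H) * H"
    unfolding R_def using mat_adjoint_mult[OF A BH] by (simp only: H_def)
  also have "mat_adjoint (B * H) = A * B"
    using mat_adjoint_mult[OF B H] adjB by (simp add: H_def mat_adjoint_adjoint)
  finally have adjR: "mat_adjoint R = R"
    unfolding R_def using assoc_mult_mat[OF A B H] by simp
  show "mat_adjoint P = P"
    using mat_adjoint_minus[OF one_carrier_mat R] by (simp add: P_R mat_adjoint_one adjR)
  have "R * P = R - R * R"
    unfolding P_R using mult_minus_distrib_mat[OF R one_carrier_mat R] R by simp
  then have RP: "R * P = 0\<^sub>m N N" using R by (simp add: RR)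
  have "P * P = P - R * P"
    using minus_mult_distrib_mat[OF one_carrier_mat R P] P by (simp add: P_R[symmetric])
  then show "P * P = P" using P by (auto simp: RP intro!: eq_matI)
  have Pv: "P *\<^sub>v v = v - R *\<^sub>v v" if "v \<in> carrier_vec N" for v
    unfolding P_R using minus_mult_distrib_mat_vec[OF one_carrier_mat R that] that by simp
  show "mat_kernel P = (\<lambda>u. A *\<^sub>v u) ` carrier_vec k"
  proof (intro equalityI subsetI)
    fix v assume "v \<in> mat_kernel P"
    from mat_kernelD[OF P this] have v: "v \<in> carrier_vec N" and "P *\<^sub>v v = 0\<^sub>v N" by auto
    then have 0: "v - R *\<^sub>v v = 0\<^sub>v N" using Pv by simp
    have Rv: "R *\<^sub>v v \<in> carrier_vec N" using R v by simp
    have "v = R *\<^sub>v v"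
    proof (rule eq_vecI)
      fix i assume i: "i < dim_vec (R *\<^sub>v v)"
      then have "(v - R *\<^sub>v v) $ i = 0" using 0 Rv by (metis carrier_vecD index_zero_vec(1))
      then have "v $ i - (R *\<^sub>v v) $ i = 0" using i by (subst (asm) index_minus_vec) auto
      then show "v $ i = (R *\<^sub>v v) $ i" by simp
    qed (use v R in auto)
    also have "\<dots> = A *\<^sub>v ((B * H) *\<^sub>v v)"
      unfolding R_def by (rule assoc_mult_mat_vec[OF A BH v])
    finally show "v \<in> (\<lambda>u. A *\<^sub>v u) ` carrier_vec k" using BH v by auto
  next
    fix v assume "v \<in> (\<lambda>u. A *\<^sub>v u) ` carrier_vec k"
    then obtain u where u: "u \<in> carrier_vec k" and v: "v = A *\<^sub>v u" by auto
    have vc: "v \<in> carrier_vec N" using A u v by simp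
    have "R *\<^sub>v v = v" using assoc_mult_mat_vec[OF R A u] RA v by simp
    then show "v \<in> mat_kernel P" using vc Pv[OF vc] by (intro mat_kernelI[OF P vc]) auto
  qed
qed


section \<open>The Grassmannian G(3, n + 3) and its universal quotient bundle\<close>

definition grassmannian :: "nat \<Rightarrow> nat \<Rightarrow> complex vec set set" where
  "grassmannian k N = {(\<lambda>u. A *\<^sub>v u) ` carrier_vec k | A.
     A \<in> carrier_mat N k \<and> mat_kernel A = {0\<^sub>v k}}"

text \<open>
  The big cell of G(3, n + 3), with complex coordinates z_ij (i < n, j < 3), consists of the
  graphs of the linear maps z : C^3 -> C^n. The real and imaginary parts of z_ij are the real
  coordinates number 2 (3 i + j) and 2 (3 i + j) + 1; this order of the 6 n real coordinates is
  compatible with the complex orientation.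
\<close>

definition graph_matrix :: "nat \<Rightarrow> (nat \<Rightarrow> real) \<Rightarrow> complex mat" where
  "graph_matrix n x = mat (n + 3) 3 (\<lambda>(i, j).
     if i < 3 then (if i = j then 1 else 0)
     else Complex (x (2 * (3 * (i - 3) + j))) (x (2 * (3 * (i - 3) + j) + 1)))"

definition graph_space :: "nat \<Rightarrow> (nat \<Rightarrow> real) \<Rightarrow> complex vec set" where
  "graph_space n x = (\<lambda>u. graph_matrix n x *\<^sub>v u) ` carrier_vec 3"

lemma graph_matrix_carrier: "graph_matrix n x \<in> carrier_mat (n + 3) 3"
  by (simp add: graph_matrix_def)

lemma graph_matrix_mult_index:
  assumes u: "u \<in> carrier_vec 3" and i: "i < 3"
  shows "(graph_matrix n x *\<^sub>v u) $ i = u $ i"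
proof -
  have "(graph_matrix n x *\<^sub>v u) $ i = (\<Sum>j<3. (if i = j then 1 else 0) * u $ j)"
    using u i by (simp add: graph_matrix_def scalar_prod_def atLeast0LessThan)
  also have "\<dots> = (\<Sum>j<3. if j = i then u $ j else 0)" by (rule sum.cong) auto
  also have "\<dots> = u $ i" using i by simp
  finally show ?thesis .
qed

lemma graph_space_grassmannian: "graph_space n x \<in> grassmannian 3 (n + 3)"
proof -
  have "mat_kernel (graph_matrix n x) = {0\<^sub>v 3}"
  proof (intro equalityI subsetI)
    fix u assume "u \<in> mat_kernel (graph_matrix n x)"
    from mat_kernelD[OF graph_matrix_carrier this]
    have u: "u \<in> carrier_vec 3" and 0: "graph_matrix n x *\<^sub>v u = 0\<^sub>v (n + 3)" by auto
    have "u = 0\<^sub>v 3"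
    proof (rule eq_vecI)
      fix i assume "i < dim_vec (0\<^sub>v 3 :: complex vec)"
      then have i: "i < 3" by simp
      then show "u $ i = 0\<^sub>v 3 $ i" using graph_matrix_mult_index[OF u i, of n x] 0 by simp
    qed (use u in auto)
    then show "u \<in> {0\<^sub>v 3}" by simp
  next
    fix u :: "complex vec" assume "u \<in> {0\<^sub>v 3}"
    then show "u \<in> mat_kernel (graph_matrix n x)"
      using graph_matrix_carrier[of n x]
      by (intro mat_kernelI[OF graph_matrix_carrier]) (auto intro!: eq_vecI)
  qed
  then show ?thesis
    using graph_matrix_carrier unfolding grassmannian_def graph_space_def by blast
qed

text \<open>
  The image of the chart is the set of all W meeting 0 x C^n trivially, that is, the complement
  of a hyperplane section in the Pluecker embedding.
\<close>

lemma graph_space_range: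
  "range (graph_space n) = {W \<in> grassmannian 3 (n + 3).
     \<forall>w\<in>W. (\<forall>i<3. w $ i = 0) \<longrightarrow> w = 0\<^sub>v (n + 3)}"
proof (intro equalityI subsetI)
  fix W assume "W \<in> range (graph_space n)"
  then obtain x where W: "W = graph_space n x" by auto
  have "w = 0\<^sub>v (n + 3)" if "w \<in> W" and z: "\<forall>i<3. w $ i = 0" for w
  proof -
    obtain u where u: "u \<in> carrier_vec 3" and w: "w = graph_matrix n x *\<^sub>v u"
      using \<open>w \<in> W\<close> W by (auto simp: graph_space_def)
    have "u = 0\<^sub>v 3"
      using u z graph_matrix_mult_index[OF u, of _ n x] w by (intro eq_vecI) auto
    then show ?thesis using w graph_matrix_carrier[of n x] by (auto intro!: eq_vecI)
  qed
  then show "W \<in> {W \<in> grassmannian 3 (n + 3). \<forall>w\<in>W. (\<forall>i<3. w $ i = 0) \<longrightarrow> w = 0\<^sub>v (n + 3)}"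
    using graph_space_grassmannian W by auto
next
  fix W assume "W \<in> {W \<in> grassmannian 3 (n + 3). \<forall>w\<in>W. (\<forall>i<3. w $ i = 0) \<longrightarrow> w = 0\<^sub>v (n + 3)}"
  then obtain A where A: "A \<in> carrier_mat (n + 3) 3" "mat_kernel A = {0\<^sub>v 3}"
    and W: "W = (\<lambda>u. A *\<^sub>v u) ` carrier_vec 3"
    and triv: "\<And>w. w \<in> W \<Longrightarrow> (\<forall>i<3. w $ i = 0) \<Longrightarrow> w = 0\<^sub>v (n + 3)"
    by (auto simp: grassmannian_def)
  define T where "T = mat 3 3 (\<lambda>(i, j). A $$ (i, j))"
  have T: "T \<in> carrier_mat 3 3" by (simp add: T_def)
  have Tu: "(T *\<^sub>v u) $ i = (A *\<^sub>v u) $ i" if "u \<in> carrier_vec 3" "i < 3" for u i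
    using that A by (simp add: T_def scalar_prod_def)
  have "mat_kernel T = {0\<^sub>v 3}"
  proof (intro equalityI subsetI)
    fix u assume "u \<in> mat_kernel T"
    from mat_kernelD[OF T this] have u: "u \<in> carrier_vec 3" and 0: "T *\<^sub>v u = 0\<^sub>v 3" by auto
    have "A *\<^sub>v u = 0\<^sub>v (n + 3)"
      using Tu[OF u] 0 u W by (intro triv) auto
    then have "u \<in> mat_kernel A" using u by (intro mat_kernelI[OF A(1)])
    then show "u \<in> {0\<^sub>v 3}" using A by simp
  next
    fix u :: "complex vec" assume "u \<in> {0\<^sub>v 3}"
    then show "u \<in> mat_kernel T" using T by (intro mat_kernelI[OF T]) (auto intro!: eq_vecI)
  qed
  from inverse_if_kernel_trivial[OF T this] obtain B
    where B: "B \<in> carrier_mat 3 3" "B * T = 1\<^sub>m 3" "T * B = 1\<^sub>m 3" by blast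
  define G where "G = A * B"
  have G: "G \<in> carrier_mat (n + 3) 3" using A B by (simp add: G_def)
  define x where "x k = (let z = G $$ (3 + k div 2 div 3, k div 2 mod 3)
     in if even k then Re z else Im z)" for k
  have "graph_matrix n x = G"
  proof (rule eq_matI)
    fix i j assume "i < dim_row G" "j < dim_col G"
    then have ij: "i < n + 3" "j < 3" using G by auto
    show "graph_matrix n x $$ (i, j) = G $$ (i, j)"
    proof (cases "i < 3")
      case True
      have "G $$ (i, j) = (T * B) $$ (i, j)"
        using True ij A(1) B(1) by (simp add: G_def T_def scalar_prod_def)
      also have "\<dots> = (if i = j then 1 else 0)" using B(3) True ij by simp
      finally show ?thesis using True ij by (simp add: graph_matrix_def)
    next
      case False
      then show ?thesis using ij by (simp add: graph_matrix_def x_def Let_def complex_eq_iff)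
    qed
  qed (use G in \<open>auto simp: graph_matrix_def\<close>)
  moreover have "W = (\<lambda>u. G *\<^sub>v u) ` carrier_vec 3"
  proof (intro equalityI subsetI)
    fix w assume "w \<in> W"
    then obtain u where u: "u \<in> carrier_vec 3" and w: "w = A *\<^sub>v u" using W by auto
    have "B *\<^sub>v (T *\<^sub>v u) = u"
      using assoc_mult_mat_vec[OF B(1) T u] B(2) u by simp
    then have "A *\<^sub>v u = G *\<^sub>v (T *\<^sub>v u)" using A(1) B(1) T u by (simp add: G_def)
    then show "w \<in> (\<lambda>u. G *\<^sub>v u) ` carrier_vec 3" using w u T by auto
  next
    fix w assume "w \<in> (\<lambda>u. G *\<^sub>v u) ` carrier_vec 3"
    then obtain u where u: "u \<in> carrier_vec 3" and "w = G *\<^sub>v u" by auto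
    then have "w = A *\<^sub>v (B *\<^sub>v u)" using A B by (simp add: G_def)
    then show "w \<in> W" using W B u by auto
  qed
  ultimately have "W = graph_space n x" by (simp add: graph_space_def)
  then show "W \<in> range (graph_space n)" by auto
qed

text \<open>
  The fibre of the universal quotient bundle at W is C^N / W. The orthogonal projection
  of C^N with kernel W identifies it with the orthogonal complement of W, and thereby
  identifies the universal quotient bundle with the image of this family of projections.
\<close>

definition quotient_projection :: "nat \<Rightarrow> complex vec set \<Rightarrow> complex mat" where
  "quotient_projection N W = (THE P. P \<in> carrier_mat N N \<and> P * P = P \<and> mat_adjoint P = P
     \<and> mat_kernel P = W)"

text \<open>
  The following two facts justify the definite description: the projection exists and is unique,
  and if the columns of A form a basis of W then it equals 1 - A (A* A)^(-1) A*.
\<close>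

lemma quotient_projection_grassmannian:
  assumes "W \<in> grassmannian k N"
  shows "\<exists>!P. P \<in> carrier_mat N N \<and> P * P = P \<and> mat_adjoint P = P \<and> mat_kernel P = W"
proof -
  obtain A where A: "A \<in> carrier_mat N k" "mat_kernel A = {0\<^sub>v k}"
    and W: "W = (\<lambda>u. A *\<^sub>v u) ` carrier_vec k"
    using assms by (auto simp: grassmannian_def)
  have "mat_adjoint A * A \<in> carrier_mat k k"
    using A mat_adjoint_carrier[OF A(1)] by simp
  moreover have "mat_kernel (mat_adjoint A * A) = {0\<^sub>v k}"
    using mat_kernel_adjoint_mult[OF A(1)] A(2) by simp
  ultimately obtain B where B: "B \<in> carrier_mat k k" "B * (mat_adjoint A * A) = 1\<^sub>m k"
    by (rule inverse_if_kernel_trivial)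
  show ?thesis
    using orthogonal_projection[OF A(1) B] W
    by (intro ex1I) (auto intro: orthogonal_projection_unique)
qed

lemma quotient_projection_eq:
  assumes A: "A \<in> carrier_mat N k" and B: "B \<in> carrier_mat k k"
    and BM: "B * (mat_adjoint A * A) = 1\<^sub>m k"
  shows "quotient_projection N ((\<lambda>u. A *\<^sub>v u) ` carrier_vec k) = 1\<^sub>m N - A * (B * mat_adjoint A)"
  unfolding quotient_projection_def
  by (rule the_equality)
    (use orthogonal_projection[OF A B BM] in \<open>auto intro: orthogonal_projection_unique\<close>)

definition sigma :: "nat \<Rightarrow> int \<Rightarrow> (nat \<Rightarrow> real) \<Rightarrow> dform" where
  "sigma n i x = (if 0 \<le> i \<and> i \<le> int n
     then chern_form (6 * n) (\<lambda>y. quotient_projection (n + 3) (graph_space n y)) (nat i) x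
     else 0)"

text \<open>
  The list I = [i_1, i_2, i_3] is indexed from 0.
\<close>

definition schubert_sigma :: "nat \<Rightarrow> nat list \<Rightarrow> (nat \<Rightarrow> real) \<Rightarrow> dform" where
  "schubert_sigma n I x = form_det (mat 3 3 (\<lambda>(s, r). sigma n (int (I ! s) - int (r + 1)) x))"

text \<open>
  The degree of the 0-dimensional part of a cycle class capped with [G(3, n + 3)] is the integral
  over G(3, n + 3) of the component of degree 6 n of a representing form. The complement of the
  big cell is a proper closed subvariety and hence does not contribute.
\<close>

definition grassmannian_integral :: "nat \<Rightarrow> ((nat \<Rightarrow> real) \<Rightarrow> dform) \<Rightarrow> complex" where
  "grassmannian_integral n \<omega> =
     (\<integral>x. coeff (\<omega> x) {..<6 * n} \<partial>(Pi\<^sub>M {..<6 * n} (\<lambda>_. lborel)))"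


section \<open>The numbers in the theorem\<close>

definition curve_number :: "nat \<Rightarrow> nat \<Rightarrow> nat \<Rightarrow> nat \<Rightarrow> nat \<Rightarrow> complex" where
  "curve_number n a b c d = grassmannian_integral n
     (\<lambda>x. sigma n 1 x ^ a * sigma n 2 x ^ b
        * schubert_sigma n [1, 3, 4] x ^ c * schubert_sigma n [1, 3, 5] x ^ d)"

definition schubert_degree :: "nat \<Rightarrow> nat list \<Rightarrow> complex" where
  "schubert_degree n I = grassmannian_integral n
     (\<lambda>x. sigma n 1 x ^ (3 * n - (\<Sum>s<3. I ! s - (s + 1))) * schubert_sigma n I x)"

text \<open>
  The sign of the product of differences is the sign of the permutation sorting (i, j, k); it is
  0 if two entries coincide.
\<close>

definition omega :: "nat \<Rightarrow> nat \<Rightarrow> nat \<Rightarrow> nat \<Rightarrow> complex" where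
  "omega n i j k = (if {i, j, k} \<subseteq> {1..n + 3}
     then of_int (sgn ((int j - int i) * (int k - int i) * (int k - int j)))
        * schubert_degree n (sort [i, j, k])
     else 0)"

definition weak_compositions :: "nat \<Rightarrow> nat \<Rightarrow> nat list set" where
  "weak_compositions h m = {mu. length mu = h \<and> sum_list mu = m}"

definition multinomial :: "nat \<Rightarrow> nat list \<Rightarrow> nat" where
  "multinomial m mu = fact m div prod_list (map fact mu)"

end

theory Submission
  imports Defs "HOL-Computational_Algebra.Formal_Power_Series"
begin

text \<open>
  Over the big cell let G be the graph matrix, S its adjoint and P the orthogonal projection. Then
  P G = 0 and S P = 0, and the curvature P dP dP P equals X Y with X = P dG B and Y = dS P, where
  B = (S G)^(-1). For matrices X, Y of one-forms the traces of (X Y)^k and (Y X)^k are opposite, so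
  det (1 + X Y) det (1 + Y X) = 1; since Y X is a 3 by 3 matrix, the forms sigma_i satisfy a linear
  recurrence of order 3, that is, they are the complete symmetric functions of three Chern roots.

  The matrix Y X also shows that every sigma_i at every point of the cell is the image of one universal
  form under an endomorphism of the exterior algebra that substitutes one-forms for the generators.
  Such an endomorphism multiplies the top coefficient by a scalar depending only on the point.
  Hence all integrals in question are one and the same integral times universal top coefficients, and
  the theorem becomes an identity between universal forms, for which no integrability is needed.

  That identity follows from the expansion of the symmetric functions
  h_2 = x_1 h_1 + x_2 x_3 + x_2^2 + x_3^2, e_2, and e_1 e_2 - e_3: a symmetric polynomial in the
  shifts of the three indices acts on the Jacobi-Trudi determinants by multiplication with the
  corresponding symmetric function.
\<close>

section \<open>The determinant of 1 + tA as a power series\<close>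

text \<open>Traces enter because the block-matrix proof of det (1 + XY) = det (1 + YX) presupposes
  commuting entries, while one-forms anticommute. The same sign turns the equality into inversion,
  as in the Whitney formula c(S) c(Q) = 1 for the tautological sub- and quotient bundle. The 3 by 3
  matrix also makes the top-coefficient argument possible. X and Y have 6 (n + 3) entries, but the
  identity block of G makes three columns of dS vanish. As P X = X, the product Y X equals dS X and
  involves 3 n entries of dS and 3 n entries of X: as many one-forms as there are real coordinates.
  Substituting 6 n one-forms for 6 n generators scales the top coefficient by a determinant; with
  more generators there would be no such scalar. The decomposition of h_2 is unsymmetric on purpose:
  x_1 h_1 keeps h_1 as a factor, which merges with the power of sigma_1 in omega. This gives four
  summands, hence p_4, and a + 2b + 2c + 3d = 3n makes the power of sigma_1 the one prescribed by
  the dimension.\<close>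

lemma fps_deriv_prod:
  fixes f :: "'i \<Rightarrow> 'a :: comm_ring_1 fps"
  assumes "finite I"
  shows "fps_deriv (\<Prod>i\<in>I. f i) = (\<Sum>i\<in>I. fps_deriv (f i) * (\<Prod>j\<in>I - {i}. f j))"
  using assms
proof (induction I rule: finite_induct)
  case (insert x F)
  have "(\<Prod>j\<in>insert x F - {i}. f j) = f x * (\<Prod>j\<in>F - {i}. f j)" if "i \<in> F" for i
  proof -
    have "insert x F - {i} = insert x (F - {i})" using insert that by auto
    then show ?thesis using insert by simp
  qed
  then have "(\<Sum>i\<in>F. fps_deriv (f i) * (\<Prod>j\<in>insert x F - {i}. f j)) =
      f x * (\<Sum>i\<in>F. fps_deriv (f i) * (\<Prod>j\<in>F - {i}. f j))"
    by (simp add: sum_distrib_left mult_ac cong: sum.cong)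
  then show ?case using insert by (simp add: mult_ac)
qed simp

text \<open>Jacobi's formula. The product rule gives one determinant \<open>D i\<close> per row,
  with row i differentiated; expanding it along that row meets only cofactors of M, because deleting
  row i removes the change.\<close>

lemma fps_deriv_det:
  fixes M :: "'a :: comm_ring_1 fps mat"
  assumes M: "M \<in> carrier_mat n n"
  shows "fps_deriv (det M) = (\<Sum>i<n. \<Sum>j<n. fps_deriv (M $$ (i, j)) * cofactor M i j)"
proof -
  define D where "D i = mat n n (\<lambda>(r, s). if r = i then fps_deriv (M $$ (r, s)) else M $$ (r, s))" for i
  have D: "D i \<in> carrier_mat n n" for i by (simp add: D_def)
  have perm: "of_int (sign p) * fps_deriv (\<Prod>i = 0..<n. M $$ (i, p i)) =
      (\<Sum>i<n. of_int (sign p) * (\<Prod>k = 0..<n. D i $$ (k, p k)))" if p: "p permutes {0..<n}" for p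
  proof -
    have lt: "p k < n" if "k < n" for k using p that by (metis atLeastLessThan_iff permutes_in_image zero_le)
    have "(\<Prod>k = 0..<n. D i $$ (k, p k)) =
        fps_deriv (M $$ (i, p i)) * (\<Prod>k\<in>{0..<n} - {i}. M $$ (k, p k))" if "i < n" for i
    proof -
      have "(\<Prod>k = 0..<n. D i $$ (k, p k)) = D i $$ (i, p i) * (\<Prod>k\<in>{0..<n} - {i}. D i $$ (k, p k))"
        by (rule prod.remove) (use that in auto)
      also have "(\<Prod>k\<in>{0..<n} - {i}. D i $$ (k, p k)) = (\<Prod>k\<in>{0..<n} - {i}. M $$ (k, p k))"
        by (rule prod.cong) (auto simp: D_def lt)
      finally show ?thesis using that lt by (simp add: D_def)
    qed
    then have "(\<Sum>i<n. of_int (sign p) * (\<Prod>k = 0..<n. D i $$ (k, p k))) =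
        (\<Sum>i<n. of_int (sign p) * (fps_deriv (M $$ (i, p i)) * (\<Prod>k\<in>{0..<n} - {i}. M $$ (k, p k))))"
      by (intro sum.cong) auto
    then show ?thesis
      unfolding fps_deriv_prod[OF finite_atLeastLessThan] sum_distrib_left by (simp add: atLeast0LessThan)
  qed
  have "fps_deriv (det M) = (\<Sum>p | p permutes {0..<n}. of_int (sign p) * fps_deriv (\<Prod>i = 0..<n. M $$ (i, p i)))"
    using M by (simp add: det_def fps_deriv_sum sign_def cong: sum.cong)
  also have "\<dots> = (\<Sum>i<n. det (D i))"
  proof -
    have "det (D i) = (\<Sum>p | p permutes {0..<n}. of_int (sign p) * (\<Prod>k = 0..<n. D i $$ (k, p k)))" for i
      using D[of i] unfolding det_def by simp
    moreover have "(\<Sum>p | p permutes {0..<n}. of_int (sign p) * fps_deriv (\<Prod>i = 0..<n. M $$ (i, p i))) =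
        (\<Sum>p | p permutes {0..<n}. \<Sum>i<n. of_int (sign p) * (\<Prod>k = 0..<n. D i $$ (k, p k)))"
      by (rule sum.cong) (use perm in auto)
    ultimately show ?thesis by (simp only: sum.swap[of _ "{..<n}"])
  qed
  also have "\<dots> = (\<Sum>i<n. \<Sum>j<n. D i $$ (i, j) * cofactor (D i) i j)"
    by (rule sum.cong) (use laplace_expansion_row[OF D] in auto)
  also have "\<dots> = (\<Sum>i<n. \<Sum>j<n. fps_deriv (M $$ (i, j)) * cofactor M i j)"
  proof (intro sum.cong refl)
    fix i j assume "i \<in> {..<n}" "j \<in> {..<n}"
    moreover have "mat_delete (D i) i j = mat_delete M i j"
      using M D by (auto simp: mat_delete_def D_def intro!: eq_matI)
    ultimately show "D i $$ (i, j) * cofactor (D i) i j = fps_deriv (M $$ (i, j)) * cofactor M i j"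
      by (simp add: cofactor_def D_def)
  qed
  finally show ?thesis .
qed

definition mtrace :: "'a :: comm_monoid_add mat \<Rightarrow> 'a" where
  "mtrace A = (\<Sum>i<dim_row A. A $$ (i, i))"

definition one_plus_X :: "'a :: comm_ring_1 mat \<Rightarrow> 'a fps mat" where
  "one_plus_X A = 1\<^sub>m (dim_row A) + fps_X \<cdot>\<^sub>m map_mat fps_const A"

lemma one_plus_X_carrier [simp]: "A \<in> carrier_mat n n \<Longrightarrow> one_plus_X A \<in> carrier_mat n n"
  by (simp add: one_plus_X_def)

text \<open>The logarithmic derivative of det (1 + tA) is the trace of A (1 + tA)^(-1), and the
  inverse is a geometric series in t. Division by the determinant is avoided by reading the adjugate
  as the determinant times this inverse.\<close>

lemma fps_deriv_det_one_plus_X: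
  fixes A :: "'a :: comm_ring_1 mat"
  assumes A: "A \<in> carrier_mat n n"
  shows "fps_deriv (det (one_plus_X A)) =
    det (one_plus_X A) * Abs_fps (\<lambda>k. (- 1) ^ k * mtrace (A ^\<^sub>m Suc k))"
proof -
  define M where "M = one_plus_X A"
  \<comment> \<open>The geometric series, that is, the sum of (-t)^k A^k, stored entrywise.\<close>
  define R where "R = mat n n (\<lambda>(i, j). Abs_fps (\<lambda>k. (- 1) ^ k * (A ^\<^sub>m k) $$ (i, j)))"
  have M: "M \<in> carrier_mat n n" using A by (simp add: M_def)
  have R: "R \<in> carrier_mat n n" by (simp add: R_def)
  have Ak: "A ^\<^sub>m k \<in> carrier_mat n n" for k using A by simp
  have pow: "(\<Sum>l<n. A $$ (i, l) * (A ^\<^sub>m k) $$ (l, j)) = (A ^\<^sub>m Suc k) $$ (i, j)"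
    if "i < n" "j < n" for i j k
  proof -
    have "A * A ^\<^sub>m k = A ^\<^sub>m Suc k" using A
    proof (induction k)
      case (Suc k)
      have "A * A ^\<^sub>m Suc k = (A * A ^\<^sub>m k) * A"
        using A Ak[of k] by (simp add: assoc_mult_mat[of _ n n _ n _ n])
      then show ?case using Suc by simp
    qed simp
    then have "(A ^\<^sub>m Suc k) $$ (i, j) = (A * A ^\<^sub>m k) $$ (i, j)" by simp
    also have "\<dots> = (\<Sum>l<n. A $$ (i, l) * (A ^\<^sub>m k) $$ (l, j))"
      using A Ak[of k] that by (simp add: scalar_prod_def atLeast0LessThan del: pow_mat.simps)
    finally show ?thesis by simp
  qed
  have MR: "M * R = 1\<^sub>m n"
  proof (rule eq_matI)
    fix i j assume "i < dim_row (1\<^sub>m n :: 'a fps mat)" "j < dim_col (1\<^sub>m n :: 'a fps mat)"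
    then have ij: "i < n" "j < n" by auto
    have "(M * R) $$ (i, j) = (\<Sum>l<n. ((if i = l then 1 else 0) + fps_X * fps_const (A $$ (i, l))) * R $$ (l, j))"
      using A R ij by (simp add: M_def one_plus_X_def scalar_prod_def atLeast0LessThan eq_commute[of i])
    also have "\<dots> = (\<Sum>l<n. if l = i then R $$ (l, j) else 0) + fps_X * (\<Sum>l<n. fps_const (A $$ (i, l)) * R $$ (l, j))"
    proof -
      have "((if i = l then 1 else 0) + fps_X * fps_const (A $$ (i, l))) * R $$ (l, j) =
          (if l = i then R $$ (l, j) else 0) + fps_X * (fps_const (A $$ (i, l)) * R $$ (l, j))" for l
        by (auto simp: distrib_right mult.assoc)
      then show ?thesis by (simp only: sum.distrib sum_distrib_left)
    qed
    also have "(\<Sum>l<n. if l = i then R $$ (l, j) else 0) = R $$ (i, j)" using ij by simp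
    also have "R $$ (i, j) + fps_X * (\<Sum>l<n. fps_const (A $$ (i, l)) * R $$ (l, j)) = 1\<^sub>m n $$ (i, j)"
    proof (rule fps_ext)
      fix k
      show "fps_nth (R $$ (i, j) + fps_X * (\<Sum>l<n. fps_const (A $$ (i, l)) * R $$ (l, j))) k
          = fps_nth (1\<^sub>m n $$ (i, j)) k"
      proof (cases k)
        case 0
        then show ?thesis using ij A by (simp add: R_def)
      next
        case (Suc m)
        have "fps_nth (fps_X * (\<Sum>l<n. fps_const (A $$ (i, l)) * R $$ (l, j))) k =
            (\<Sum>l<n. A $$ (i, l) * ((- 1) ^ m * (A ^\<^sub>m m) $$ (l, j)))"
          using ij Suc by (simp add: R_def fps_sum_nth)
        also have "\<dots> = (- 1) ^ m * (\<Sum>l<n. A $$ (i, l) * (A ^\<^sub>m m) $$ (l, j))"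
          by (simp add: sum_distrib_left mult_ac)
        also have "\<dots> = (- 1) ^ m * (A ^\<^sub>m k) $$ (i, j)" using pow ij Suc by simp
        finally show ?thesis using ij Suc by (simp add: R_def)
      qed
    qed
    finally show "(M * R) $$ (i, j) = 1\<^sub>m n $$ (i, j)" .
  qed (use M R in auto)
  have adj: "adj_mat M = det M \<cdot>\<^sub>m R"
  proof -
    have "adj_mat M = adj_mat M * (M * R)" using adj_mat[OF M] MR by simp
    also have "\<dots> = (adj_mat M * M) * R" using adj_mat(1)[OF M] M R by simp
    also have "\<dots> = det M \<cdot>\<^sub>m (1\<^sub>m n * R)"
      unfolding adj_mat(3)[OF M] using R by (intro mult_smult_assoc_mat[of _ n n _ n]) auto
    also have "\<dots> = det M \<cdot>\<^sub>m R" using R by simp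
    finally show ?thesis .
  qed
  have "fps_deriv (det M) = (\<Sum>i<n. \<Sum>j<n. fps_deriv (M $$ (i, j)) * cofactor M i j)"
    by (rule fps_deriv_det[OF M])
  also have "\<dots> = (\<Sum>i<n. \<Sum>j<n. fps_const (A $$ (i, j)) * (det M * R $$ (j, i)))"
  proof (intro sum.cong refl)
    fix i j assume ij: "i \<in> {..<n}" "j \<in> {..<n}"
    have "cofactor M i j = adj_mat M $$ (j, i)" using ij M by (simp add: adj_mat_def)
    then have "cofactor M i j = det M * R $$ (j, i)" using ij R by (simp add: adj)
    moreover have "fps_deriv (M $$ (i, j)) = fps_const (A $$ (i, j))"
      using ij A by (simp add: M_def one_plus_X_def)
    ultimately show "fps_deriv (M $$ (i, j)) * cofactor M i j = fps_const (A $$ (i, j)) * (det M * R $$ (j, i))"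
      by simp
  qed
  also have "\<dots> = det M * (\<Sum>i<n. \<Sum>j<n. fps_const (A $$ (i, j)) * R $$ (j, i))"
    by (simp add: sum_distrib_left mult_ac)
  also have "(\<Sum>i<n. \<Sum>j<n. fps_const (A $$ (i, j)) * R $$ (j, i)) =
      Abs_fps (\<lambda>k. (- 1) ^ k * mtrace (A ^\<^sub>m Suc k))"
  proof (rule fps_ext)
    fix k
    have "fps_nth (\<Sum>i<n. \<Sum>j<n. fps_const (A $$ (i, j)) * R $$ (j, i)) k =
        (\<Sum>i<n. \<Sum>j<n. A $$ (i, j) * ((- 1) ^ k * (A ^\<^sub>m k) $$ (j, i)))"
      by (simp add: fps_sum_nth R_def)
    also have "\<dots> = (- 1) ^ k * (\<Sum>i<n. \<Sum>j<n. A $$ (i, j) * (A ^\<^sub>m k) $$ (j, i))"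
      by (simp add: sum_distrib_left mult_ac)
    also have "(\<Sum>i<n. \<Sum>j<n. A $$ (i, j) * (A ^\<^sub>m k) $$ (j, i)) = mtrace (A ^\<^sub>m Suc k)"
      using carrier_matD(1)[OF Ak[of "Suc k"]] unfolding mtrace_def
      by (simp only:) (auto intro!: sum.cong simp: pow simp del: pow_mat.simps)
    finally show "fps_nth (\<Sum>i<n. \<Sum>j<n. fps_const (A $$ (i, j)) * R $$ (j, i)) k =
        fps_nth (Abs_fps (\<lambda>k. (- 1) ^ k * mtrace (A ^\<^sub>m Suc k))) k" by simp
  qed
  finally show ?thesis by (simp add: M_def)
qed

lemma fps_nth_0_hom: "comm_ring_hom (\<lambda>f :: 'a :: comm_ring_1 fps. fps_nth f 0)"
  by unfold_locales auto

text \<open>Taking the constant term is a ring homomorphism and sends 1 + tA to 1.\<close>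

lemma fps_nth_0_det_one_plus_X:
  assumes A: "A \<in> carrier_mat n n"
  shows "fps_nth (det (one_plus_X A)) 0 = 1"
proof -
  have "fps_nth (det (one_plus_X A)) 0 = det (map_mat (\<lambda>f. fps_nth f 0) (one_plus_X A))"
    by (rule comm_ring_hom.hom_det[OF fps_nth_0_hom, symmetric])
  also have "map_mat (\<lambda>f. fps_nth f 0) (one_plus_X A) = 1\<^sub>m n"
    using A by (intro eq_matI) (auto simp: one_plus_X_def)
  finally show ?thesis by simp
qed

text \<open>Opposite traces make the two logarithmic derivatives cancel, so the product has
  derivative 0. Absence of torsion then kills every coefficient of positive degree, and the constant
  term is 1.\<close>

lemma det_one_plus_X_mult_eq_1:
  fixes A B :: "'a :: comm_ring_1 mat"
  assumes A: "A \<in> carrier_mat m m" and B: "B \<in> carrier_mat n n"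
    and tr: "\<And>k. mtrace (A ^\<^sub>m Suc k) = - mtrace (B ^\<^sub>m Suc k)"
    and torsion_free: "\<And>k (x :: 'a). of_nat (Suc k) * x = 0 \<Longrightarrow> x = 0"
  shows "det (one_plus_X A) * det (one_plus_X B) = 1"
proof (rule fps_ext)
  let ?P = "det (one_plus_X A)" and ?Q = "det (one_plus_X B)"
  let ?T = "Abs_fps (\<lambda>k. (- 1) ^ k * mtrace (B ^\<^sub>m Suc k))"
  have "Abs_fps (\<lambda>k. (- 1) ^ k * mtrace (A ^\<^sub>m Suc k)) = - ?T"
    by (rule fps_ext) (simp add: tr del: pow_mat.simps)
  then have "fps_deriv (?P * ?Q) = ?P * (?Q * ?T) + (?P * - ?T) * ?Q"
    using fps_deriv_det_one_plus_X[OF A] fps_deriv_det_one_plus_X[OF B] by simp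
  then have z: "fps_deriv (?P * ?Q) = 0" by (simp add: mult_ac)
  fix k show "fps_nth (?P * ?Q) k = fps_nth 1 k"
  proof (cases k)
    case 0
    then show ?thesis by (simp add: fps_nth_0_det_one_plus_X[OF A] fps_nth_0_det_one_plus_X[OF B])
  next
    case (Suc l)
    have "of_nat (Suc l) * fps_nth (?P * ?Q) (Suc l) = 0"
      using arg_cong[OF z, of "\<lambda>f. fps_nth f l"] by (simp only: fps_deriv_nth fps_zero_nth Suc_eq_plus1)
    then show ?thesis using torsion_free Suc by simp
  qed
qed

section \<open>Graded commutativity and the ring of even forms\<close>

lemma dform_coeff_sum: "coeff (sum f I) S = (\<Sum>i\<in>I. coeff (f i) S)"
  by (induction I rule: infinite_finite_induct) (auto simp: zero_dform.rep_eq plus_dform.rep_eq)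

text \<open>Every pair in T x U is an inversion for exactly one of the two orders, so the two
  inversion counts add up to |T| |U|.\<close>

lemma shuffle_sign_swap:
  assumes "finite T" "finite U" "T \<inter> U = {}"
  shows "shuffle_sign U T = (- 1) ^ (card T * card U) * shuffle_sign T U"
proof -
  let ?A = "{(t, u). t \<in> T \<and> u \<in> U \<and> u < t}" and ?B = "{(t, u). t \<in> T \<and> u \<in> U \<and> t < u}"
  have fin: "finite ?A" "finite ?B"
    by (rule finite_subset[of _ "T \<times> U"]; use assms in auto)+
  have AB: "?A \<union> ?B = T \<times> U"
    using assms(3) by (auto intro: linorder_neqE_nat)
  have "card T * card U = card (?A \<union> ?B)" unfolding AB by (rule card_cartesian_product[symmetric])
  also have "\<dots> = card ?A + card ?B" using fin by (intro card_Un_disjoint) auto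
  finally have c: "card T * card U = card ?A + card ?B" .
  have "bij_betw prod.swap ?B {(t, u). t \<in> U \<and> u \<in> T \<and> u < t}"
    by (rule bij_betwI[of _ _ _ prod.swap]) auto
  then have "card {(t, u). t \<in> U \<and> u \<in> T \<and> u < t} = card ?B"
    by (rule bij_betw_same_card[symmetric])
  moreover have "(- 1) ^ card ?B = (- 1) ^ (card ?A + card ?B) * ((- 1) ^ card ?A :: complex)"
    by (cases "even (card ?A)") (simp_all add: power_add)
  ultimately show ?thesis unfolding shuffle_sign_def c by (simp only:)
qed

text \<open>The sign \<epsilon> is kept abstract so that one computation serves both commuting even
  forms (\<epsilon> = 1) and anticommuting odd forms (\<epsilon> = -1).\<close>

lemma coeff_times_swap:
  assumes "\<And>T U. coeff \<alpha> T \<noteq> 0 \<Longrightarrow> coeff \<beta> U \<noteq> 0 \<Longrightarrow> (- 1) ^ (card T * card U) = \<epsilon>"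
  shows "coeff (\<beta> * \<alpha>) S = \<epsilon> * coeff (\<alpha> * \<beta>) S"
proof (cases "finite S")
  case True
  have "coeff (\<beta> * \<alpha>) S = (\<Sum>T\<in>Pow S. shuffle_sign (S - T) T * coeff \<beta> (S - T) * coeff \<alpha> T)"
    unfolding times_dform.rep_eq
    by (rule sum.reindex_bij_witness[of _ "\<lambda>T. S - T" "\<lambda>T. S - T"]) (auto simp: double_diff)
  also have "\<dots> = (\<Sum>T\<in>Pow S. \<epsilon> * (shuffle_sign T (S - T) * coeff \<alpha> T * coeff \<beta> (S - T)))"
  proof (rule sum.cong)
    fix T assume "T \<in> Pow S"
    then have "finite T" "finite (S - T)" using True by (auto intro: finite_subset)
    then have "shuffle_sign (S - T) T = (- 1) ^ (card T * card (S - T)) * shuffle_sign T (S - T)"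
      by (intro shuffle_sign_swap) auto
    then show "shuffle_sign (S - T) T * coeff \<beta> (S - T) * coeff \<alpha> T =
        \<epsilon> * (shuffle_sign T (S - T) * coeff \<alpha> T * coeff \<beta> (S - T))"
      using assms[of T "S - T"] by (cases "coeff \<alpha> T = 0 \<or> coeff \<beta> (S - T) = 0") auto
  qed simp
  finally show ?thesis by (simp add: times_dform.rep_eq sum_distrib_left)
qed (use coeff in auto)

definition homogeneous :: "nat \<Rightarrow> dform \<Rightarrow> bool" where
  "homogeneous k \<alpha> \<longleftrightarrow> (\<forall>S. coeff \<alpha> S \<noteq> 0 \<longrightarrow> card S = k)"

lemma homogeneous_0 [simp]: "homogeneous k 0"
  by (simp add: homogeneous_def zero_dform.rep_eq)

lemma homogeneous_1 [simp]: "homogeneous 0 1"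
  by (simp add: homogeneous_def one_dform.rep_eq)

lemma homogeneous_const_form [simp]: "homogeneous 0 (const_form c)"
  by (simp add: homogeneous_def const_form.rep_eq)

lemma homogeneous_dx [simp]: "homogeneous 1 (dx k)"
  by (simp add: homogeneous_def dx.rep_eq)

lemma homogeneous_add [intro]: "homogeneous k \<alpha> \<Longrightarrow> homogeneous k \<beta> \<Longrightarrow> homogeneous k (\<alpha> + \<beta>)"
  unfolding homogeneous_def plus_dform.rep_eq by (metis add.right_neutral)

lemma homogeneous_sum [intro]: "(\<And>i. i \<in> I \<Longrightarrow> homogeneous k (f i)) \<Longrightarrow> homogeneous k (sum f I)"
  by (induction I rule: infinite_finite_induct) auto

lemma homogeneous_times:
  assumes "homogeneous i \<alpha>" "homogeneous j \<beta>"
  shows "homogeneous (i + j) (\<alpha> * \<beta>)"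
  unfolding homogeneous_def
proof (intro allI impI)
  fix S assume nz: "coeff (\<alpha> * \<beta>) S \<noteq> 0"
  then have "finite S" using coeff by auto
  from nz obtain T where T: "T \<subseteq> S" "coeff \<alpha> T \<noteq> 0" "coeff \<beta> (S - T) \<noteq> 0"
    unfolding times_dform.rep_eq by (metis (no_types, lifting) PowD mult_zero_left mult_zero_right sum.neutral)
  have "finite T" using \<open>finite S\<close> T by (auto intro: finite_subset)
  then have "card S = card T + card (S - T)"
    using T card_Diff_subset[of T S] card_mono[OF \<open>finite S\<close>] by (simp add: card_mono \<open>finite S\<close>)
  then show "card S = i + j" using assms T by (simp add: homogeneous_def)
qed

text \<open>\<open>True\<close> stands for even degree, so parities combine under the product by
  \<open>=\<close> on Booleans. The zero form has both parities, which keeps each class closed under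
  sums.\<close>

definition parity_form :: "bool \<Rightarrow> dform \<Rightarrow> bool" where
  "parity_form e \<alpha> \<longleftrightarrow> (\<forall>S. coeff \<alpha> S \<noteq> 0 \<longrightarrow> even (card S) = e)"

lemma homogeneous_parity: "homogeneous k \<alpha> \<Longrightarrow> parity_form (even k) \<alpha>"
  by (auto simp: homogeneous_def parity_form_def)

lemma parity_form_0 [simp]: "parity_form e 0"
  by (simp add: parity_form_def zero_dform.rep_eq)

lemma parity_form_1 [simp]: "parity_form True 1"
  by (simp add: parity_form_def one_dform.rep_eq)

lemma parity_form_add [intro]: "parity_form k \<alpha> \<Longrightarrow> parity_form k \<beta> \<Longrightarrow> parity_form k (\<alpha> + \<beta>)"
  unfolding parity_form_def plus_dform.rep_eq by (metis add.right_neutral)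

lemma parity_form_uminus [intro]: "parity_form k \<alpha> \<Longrightarrow> parity_form k (- \<alpha>)"
  by (simp add: parity_form_def uminus_dform.rep_eq)

lemma parity_form_sum [intro]: "(\<And>i. i \<in> I \<Longrightarrow> parity_form k (f i)) \<Longrightarrow> parity_form k (sum f I)"
  by (induction I rule: infinite_finite_induct) auto

lemma parity_form_times:
  assumes "parity_form i \<alpha>" "parity_form j \<beta>"
  shows "parity_form (i = j) (\<alpha> * \<beta>)"
  unfolding parity_form_def
proof (intro allI impI)
  fix S assume nz: "coeff (\<alpha> * \<beta>) S \<noteq> 0"
  then have "finite S" using coeff by auto
  from nz obtain T where T: "T \<subseteq> S" "coeff \<alpha> T \<noteq> 0" "coeff \<beta> (S - T) \<noteq> 0"
    unfolding times_dform.rep_eq by (metis (no_types, lifting) PowD mult_zero_left mult_zero_right sum.neutral)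
  have "finite T" using \<open>finite S\<close> T by (auto intro: finite_subset)
  then have "card S = card T + card (S - T)"
    using T card_Diff_subset[of T S] card_mono[OF \<open>finite S\<close>] by (simp add: card_mono \<open>finite S\<close>)
  moreover have "even (card T) = i" "even (card (S - T)) = j"
    using assms T by (auto simp: parity_form_def)
  ultimately show "even (card S) = (i = j)" by auto
qed

lemma odd_forms_anticommute:
  assumes "parity_form False \<alpha>" "parity_form False \<beta>"
  shows "\<beta> * \<alpha> = - (\<alpha> * \<beta>)"
proof (rule dform_eqI)
  fix S
  have "coeff (\<beta> * \<alpha>) S = - 1 * coeff (\<alpha> * \<beta>) S"
    by (rule coeff_times_swap) (use assms in \<open>auto simp: parity_form_def\<close>)
  then show "coeff (\<beta> * \<alpha>) S = coeff (- (\<alpha> * \<beta>)) S" by (simp add: uminus_dform.rep_eq)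
qed

lemma homogeneous_1_anticommute:
  assumes "homogeneous 1 \<alpha>" "homogeneous 1 \<beta>"
  shows "\<beta> * \<alpha> = - (\<alpha> * \<beta>)"
  using assms[THEN homogeneous_parity] by (intro odd_forms_anticommute) simp_all

lemma even_form_commute:
  assumes "parity_form True \<alpha>"
  shows "\<beta> * \<alpha> = \<alpha> * \<beta>"
proof (rule dform_eqI)
  fix S
  have "coeff (\<beta> * \<alpha>) S = 1 * coeff (\<alpha> * \<beta>) S"
    by (rule coeff_times_swap) (use assms in \<open>auto simp: parity_form_def\<close>)
  then show "coeff (\<beta> * \<alpha>) S = coeff (\<alpha> * \<beta>) S" by simp
qed

lemma const_form_commute: "\<beta> * const_form c = const_form c * \<beta>"
  by (rule even_form_commute) (use homogeneous_parity[OF homogeneous_const_form] in simp)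

lemma coeff_const_form_times: "coeff (const_form c * \<beta>) S = c * coeff \<beta> S"
proof (cases "finite S")
  case True
  have "coeff (const_form c * \<beta>) S = (\<Sum>T\<in>Pow S. if T = {} then c * coeff \<beta> S else 0)"
    unfolding times_dform.rep_eq const_form.rep_eq by (rule sum.cong) auto
  then show ?thesis using True by simp
qed (use coeff in auto)

lemma const_form_0 [simp]: "const_form 0 = 0"
  by (rule dform_eqI) (simp add: const_form.rep_eq zero_dform.rep_eq)

lemma const_form_1 [simp]: "const_form 1 = 1"
  by (rule dform_eqI) (simp add: const_form.rep_eq one_dform.rep_eq)

lemma const_form_add: "const_form (a + b) = const_form a + const_form b"
  by (rule dform_eqI) (simp add: const_form.rep_eq plus_dform.rep_eq)

lemma const_form_mult: "const_form (a * b) = const_form a * const_form b"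
  by (rule dform_eqI) (simp add: coeff_const_form_times const_form.rep_eq)

lemma const_form_hom: "semiring_hom const_form"
  by unfold_locales (auto simp: const_form_add const_form_mult)

lemma const_form_sum: "const_form (sum f I) = (\<Sum>i\<in>I. const_form (f i))"
  by (induction I rule: infinite_finite_induct) (auto simp: const_form_add)

text \<open>Even forms commute, so they form a commutative ring to which \<open>det\<close>,
  cofactors and power series apply. General forms live in a noncommutative ring, where
  \<open>form_det\<close> has to fix an order of the factors.\<close>

typedef eform = "{\<alpha>. parity_form True \<alpha>}" morphisms form Abs_eform
  by (rule exI[of _ 0]) simp

setup_lifting type_definition_eform

instantiation eform :: comm_ring_1
begin
lift_definition zero_eform :: eform is 0 by simp
lift_definition one_eform :: eform is 1 by simp
lift_definition plus_eform :: "eform \<Rightarrow> eform \<Rightarrow> eform" is "(+)" by (rule parity_form_add)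
lift_definition uminus_eform :: "eform \<Rightarrow> eform" is uminus by (rule parity_form_uminus)
lift_definition minus_eform :: "eform \<Rightarrow> eform \<Rightarrow> eform" is "(-)"
  using parity_form_add[OF _ parity_form_uminus] by fastforce
lift_definition times_eform :: "eform \<Rightarrow> eform \<Rightarrow> eform" is "(*)"
  using parity_form_times[of True _ True] by simp
instance
proof
  fix a b c :: eform
  show "a * b * c = a * (b * c)" by transfer (simp add: mult.assoc)
  show "a * b = b * a" by transfer (rule even_form_commute)
  show "1 * a = a" by transfer simp
  show "(a + b) * c = a * c + b * c" by transfer (simp add: distrib_right)
  show "(0 :: eform) \<noteq> 1" by transfer simp
qed (transfer; simp)+
end

interpretation form: ring_hom form
  by unfold_locales (transfer; simp)+

declare form.hom_add [simp] form.hom_mult [simp] form.hom_uminus [simp] form.hom_sum [simp]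

section \<open>Swapping the factors in the determinant of 1 + XY\<close>

text \<open>Only monomials of even degree occur in both factors, so a convolution over half-degrees
  misses nothing.\<close>

lemma degree_part_even_times:
  assumes "parity_form True \<alpha>" "parity_form True \<beta>"
  shows "degree_part (2 * k) (\<alpha> * \<beta>) = (\<Sum>i\<le>k. degree_part (2 * i) \<alpha> * degree_part (2 * (k - i)) \<beta>)"
proof (rule dform_eqI)
  fix S :: "nat set" assume S: "finite S"
  let ?t = "\<lambda>T. shuffle_sign T (S - T) * coeff \<alpha> T * coeff \<beta> (S - T)"
  have "(\<Sum>i\<le>k. if card T = 2 * i \<and> card (S - T) = 2 * (k - i) then ?t T else 0) =
      (if card S = 2 * k then ?t T else 0)" if T: "T \<in> Pow S" for T
  proof (cases "coeff \<alpha> T = 0 \<or> coeff \<beta> (S - T) = 0")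
    case False
    then obtain p q where pq: "card T = 2 * p" "card (S - T) = 2 * q"
      using assms unfolding parity_form_def by (metis evenE)
    have "finite T" using T S by (auto intro: finite_subset)
    then have "card S = 2 * p + 2 * q"
      using T pq card_Diff_subset[of T S] card_mono[OF S, of T] by auto
    then have "(card T = 2 * i \<and> card (S - T) = 2 * (k - i)) = (i = p \<and> card S = 2 * k)" if "i \<le> k" for i
      using pq that by auto
    then have "(\<Sum>i\<le>k. if card T = 2 * i \<and> card (S - T) = 2 * (k - i) then ?t T else 0) =
        (\<Sum>i\<le>k. if i = p then (if card S = 2 * k then ?t T else 0) else 0)"
      by (intro sum.cong) auto
    then show ?thesis using \<open>card S = 2 * p + 2 * q\<close> by auto
  qed auto
  then have "coeff (degree_part (2 * k) (\<alpha> * \<beta>)) S =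
      (\<Sum>T\<in>Pow S. \<Sum>i\<le>k. if card T = 2 * i \<and> card (S - T) = 2 * (k - i) then ?t T else 0)"
    by (simp add: degree_part.rep_eq times_dform.rep_eq)
  also have "\<dots> = (\<Sum>i\<le>k. \<Sum>T\<in>Pow S. if card T = 2 * i \<and> card (S - T) = 2 * (k - i) then ?t T else 0)"
    by (rule sum.swap)
  also have "\<dots> = coeff (\<Sum>i\<le>k. degree_part (2 * i) \<alpha> * degree_part (2 * (k - i)) \<beta>) S"
    unfolding dform_coeff_sum times_dform.rep_eq degree_part.rep_eq by (intro sum.cong) auto
  finally show "coeff (degree_part (2 * k) (\<alpha> * \<beta>)) S =
      coeff (\<Sum>i\<le>k. degree_part (2 * i) \<alpha> * degree_part (2 * (k - i)) \<beta>) S" .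
qed

lemma homogeneous_degree_part: "homogeneous k \<alpha> \<Longrightarrow> degree_part l \<alpha> = (if l = k then \<alpha> else 0)"
  by (rule dform_eqI) (auto simp: homogeneous_def degree_part.rep_eq zero_dform.rep_eq)

section \<open>Even forms graded by half their degree\<close>

lift_definition half_degree_part :: "nat \<Rightarrow> eform \<Rightarrow> eform" is "\<lambda>k. degree_part (2 * k)"
  by (simp add: parity_form_def degree_part.rep_eq)

definition grading :: "eform \<Rightarrow> eform fps" where
  "grading \<alpha> = Abs_fps (\<lambda>k. half_degree_part k \<alpha>)"

lemma half_degree_part_times:
  "half_degree_part k (\<alpha> * \<beta>) = (\<Sum>i\<le>k. half_degree_part i \<alpha> * half_degree_part (k - i) \<beta>)"
  unfolding form_inject[symmetric] form.hom_sum
  by (simp add: half_degree_part.rep_eq times_eform.rep_eq degree_part_even_times form[simplified])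

lemma degree_part_1: "degree_part (2 * k) 1 = (if k = 0 then 1 else 0)"
  by (rule dform_eqI) (auto simp: degree_part.rep_eq one_dform.rep_eq zero_dform.rep_eq)

lemma degree_part_add: "degree_part k (\<alpha> + \<beta>) = degree_part k \<alpha> + degree_part k \<beta>"
  by (rule dform_eqI) (simp add: degree_part.rep_eq plus_dform.rep_eq)

lemma half_degree_part_1: "half_degree_part k 1 = (if k = 0 then 1 else 0)"
  by transfer (simp add: degree_part_1)

lemma half_degree_part_add:
  "half_degree_part k (a + b) = half_degree_part k a + half_degree_part k b"
  by transfer (rule degree_part_add)

lemma grading_hom: "comm_ring_hom grading"
proof
  show "grading 1 = 1"
    by (rule fps_ext) (simp add: grading_def half_degree_part_1)
  fix a b
  show add: "grading (a + b) = grading a + grading b" for a b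
    by (rule fps_ext) (simp add: grading_def half_degree_part_add)
  show "grading 0 = 0" using add[of 0 0] by simp
  show "grading (a * b) = grading a * grading b"
    by (rule fps_ext) (simp add: grading_def fps_mult_nth half_degree_part_times atLeast0AtMost)
qed

text \<open>An even form is determined by its parts of even degree; this lets an identity of power
  series descend to the forms themselves.\<close>

lemma inj_grading: "inj grading"
proof (rule injI)
  fix a b assume "grading a = grading b"
  then have h: "half_degree_part k a = half_degree_part k b" for k
    unfolding grading_def by (metis fps_nth_Abs_fps)
  have "coeff (form a) S = coeff (form b) S" for S
  proof (cases "even (card S)")
    case True
    then obtain k where "card S = 2 * k" by (elim evenE)
    then show ?thesis
      using arg_cong[OF h[of k], of "\<lambda>\<alpha>. coeff (form \<alpha>) S"]
      by (simp add: half_degree_part.rep_eq degree_part.rep_eq)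
  next
    case False
    then show ?thesis using form[of a] form[of b] by (metis mem_Collect_eq parity_form_def)
  qed
  then show "a = b" by (metis dform_eqI form_inject)
qed

lemma form_prod_list: "form (prod_list xs) = prod_list (map form xs)"
  by (induction xs) auto

text \<open>On even entries the ordered products in \<open>form_det\<close> are products in a
  commutative ring; this transfers results on \<open>det\<close> back to forms.\<close>

lemma form_det_map_form:
  assumes "A \<in> carrier_mat n n"
  shows "form_det (map_mat form A) = form (det A)"
proof -
  have dim: "dim_row A = n" "dim_col A = n" "dim_row (map_mat form A) = n" using assms by auto
  have "of_int (sign p) * prod_list (map (\<lambda>i. map_mat form A $$ (i, p i)) [0..<n]) =
      form (of_int (sign p) * (\<Prod>i = 0..<n. A $$ (i, p i)))"
    if p: "p permutes {0..<n}" for p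
  proof -
    have "map (\<lambda>i. map_mat form A $$ (i, p i)) [0..<n] = map form (map (\<lambda>i. A $$ (i, p i)) [0..<n])"
      using assms permutes_in_image[OF p] by auto
    moreover have "(\<Prod>i = 0..<n. A $$ (i, p i)) = prod_list (map (\<lambda>i. A $$ (i, p i)) [0..<n])"
      by (simp add: prod.distinct_set_conv_list flip: set_upt)
    ultimately show ?thesis by (simp only: form.hom_mult form.hom_of_int form_prod_list)
  qed
  then show ?thesis
    unfolding form_det_def det_def dim form.hom_sum if_P[OF refl] by (intro sum.cong) auto
qed

definition parity_mat :: "bool \<Rightarrow> dform mat \<Rightarrow> bool" where
  "parity_mat e M \<longleftrightarrow> (\<forall>i < dim_row M. \<forall>j < dim_col M. parity_form e (M $$ (i, j)))"

lemma parity_mat_times: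
  assumes "parity_mat d A" "parity_mat e B" "A \<in> carrier_mat l m" "B \<in> carrier_mat m n"
  shows "parity_mat (d = e) (A * B)"
  using assms unfolding parity_mat_def
  by (auto simp: scalar_prod_def intro!: parity_form_sum parity_form_times)

lemma parity_mat_pow:
  assumes "parity_mat True A" "A \<in> carrier_mat n n"
  shows "parity_mat True (A ^\<^sub>m k)"
proof (induction k)
  case 0
  then show ?case by (auto simp: parity_mat_def)
next
  case (Suc k)
  then show ?case using assms parity_mat_times[of True "A ^\<^sub>m k" True A n n n] by simp
qed

text \<open>Cyclicity of the trace, with a sign from exchanging two odd entries in each
  summand.\<close>

lemma mtrace_odd_swap:
  assumes "X \<in> carrier_mat m n" "Z \<in> carrier_mat n m" "parity_mat False X" "parity_mat False Z"
  shows "mtrace (X * Z) = - mtrace (Z * X)"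
proof -
  have "mtrace (X * Z) = (\<Sum>i<m. \<Sum>j<n. X $$ (i, j) * Z $$ (j, i))"
    using assms by (simp add: mtrace_def scalar_prod_def atLeast0LessThan)
  also have "\<dots> = (\<Sum>i<m. \<Sum>j<n. - (Z $$ (j, i) * X $$ (i, j)))"
    using assms by (intro sum.cong refl odd_forms_anticommute) (auto simp: parity_mat_def)
  also have "\<dots> = - (\<Sum>j<n. \<Sum>i<m. Z $$ (j, i) * X $$ (i, j))"
    by (subst sum.swap) (simp add: sum_negf)
  also have "\<dots> = - mtrace (Z * X)"
    using assms by (simp add: mtrace_def scalar_prod_def atLeast0LessThan)
  finally show ?thesis .
qed

text \<open>Isolates one leading X. The remaining factor is odd when X and Y are, so moving X to the
  other end under the trace costs a single sign for every k.\<close>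

lemma mult_pow_mat_swap:
  fixes X Y :: "'a :: ring_1 mat"
  assumes X: "X \<in> carrier_mat m n" and Y: "Y \<in> carrier_mat n m"
  shows "(X * Y) ^\<^sub>m Suc k = X * ((Y * X) ^\<^sub>m k * Y)"
proof (induction k)
  case 0
  then show ?case using X Y by simp
next
  case (Suc k)
  have YX: "(Y * X) ^\<^sub>m k \<in> carrier_mat n n" using X Y by (intro pow_carrier_mat) auto
  have "(X * Y) ^\<^sub>m Suc (Suc k) = X * ((Y * X) ^\<^sub>m k * Y) * (X * Y)" using Suc by simp
  also have "\<dots> = X * ((Y * X) ^\<^sub>m k * Y * (X * Y))" using X Y YX by (intro assoc_mult_mat) auto
  also have "(Y * X) ^\<^sub>m k * Y * (X * Y) = (Y * X) ^\<^sub>m k * (Y * (X * Y))"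
    using X Y YX by (intro assoc_mult_mat) auto
  also have "Y * (X * Y) = Y * X * Y" using X Y by (intro assoc_mult_mat[symmetric]) auto
  also have "(Y * X) ^\<^sub>m k * (Y * X * Y) = (Y * X) ^\<^sub>m k * (Y * X) * Y"
    using X Y YX by (intro assoc_mult_mat[symmetric]) auto
  also have "\<dots> = (Y * X) ^\<^sub>m Suc k * Y" by simp
  finally show ?case .
qed

lemma form_of_nat: "form (of_nat n) = const_form (of_nat n)"
proof (induction n)
  case (Suc n)
  then show ?case by (simp only: of_nat_Suc form.hom_add form.hom_one const_form_add const_form_1)
qed (simp only: of_nat_0 form.hom_zero const_form_0)

lemma eform_torsion_free:
  fixes x :: eform
  assumes "of_nat (Suc k) * x = 0"
  shows "x = 0"
proof -
  have "const_form (of_nat (Suc k)) * form x = 0"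
    using assms by (metis form.hom_mult form.hom_zero form_of_nat)
  then have "coeff (const_form (of_nat (Suc k)) * form x) S = 0" for S
    by (simp only: zero_dform.rep_eq)
  then have "coeff (form x) S = 0" for S
    unfolding coeff_const_form_times by (metis mult_eq_0_iff of_nat_eq_0_iff nat.distinct(1))
  then have "form x = form 0"
    by (intro dform_eqI) (simp only: zero_dform.rep_eq form.hom_zero)
  then show ?thesis by (simp only: form_inject)
qed

text \<open>
  The grading introduces the parameter t: it sends det (1 + A) to det (1 + tA), which is determined
  by its logarithmic derivative in t.
\<close>

lemma det_map_grading:
  assumes A: "A \<in> carrier_mat n n"
    and hom: "\<And>i j. i < n \<Longrightarrow> j < n \<Longrightarrow> homogeneous 2 (form (A $$ (i, j)))"
  shows "grading (det (1\<^sub>m n + A)) = det (one_plus_X A)"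
proof -
  interpret grading: comm_ring_hom grading by (rule grading_hom)
  have "grading (A $$ (i, j)) = fps_X * fps_const (A $$ (i, j))" if "i < n" "j < n" for i j
  proof (rule fps_ext)
    fix k
    have "half_degree_part k (A $$ (i, j)) = (if k = 1 then A $$ (i, j) else 0)"
      using homogeneous_degree_part[OF hom[OF that], of "2 * k"]
      by (intro form_inject[THEN iffD1]) (auto simp: half_degree_part.rep_eq)
    then show "fps_nth (grading (A $$ (i, j))) k = fps_nth (fps_X * fps_const (A $$ (i, j))) k"
      by (simp add: grading_def)
  qed
  note graded = this
  have "map_mat grading (1\<^sub>m n + A) = one_plus_X A"
  proof (rule eq_matI)
    fix i j assume "i < dim_row (one_plus_X A)" "j < dim_col (one_plus_X A)"
    then have ij: "i < n" "j < n" using A by (simp_all add: one_plus_X_def)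
    have "map_mat grading (1\<^sub>m n + A) $$ (i, j) = grading (1\<^sub>m n $$ (i, j)) + grading (A $$ (i, j))"
      using ij A by (simp add: grading.hom_add)
    then show "map_mat grading (1\<^sub>m n + A) $$ (i, j) = one_plus_X A $$ (i, j)"
      using ij A by (simp add: one_plus_X_def graded)
  qed (use A in \<open>simp_all add: one_plus_X_def\<close>)
  moreover have "grading (det (1\<^sub>m n + A)) = det (map_mat grading (1\<^sub>m n + A))"
    by (rule grading.hom_det[symmetric])
  ultimately show ?thesis by (simp only:)
qed

lemma homogeneous_mat_mult_entry:
  assumes X: "X \<in> carrier_mat m n" and Y: "Y \<in> carrier_mat n m"
    and X1: "\<And>i j. i < m \<Longrightarrow> j < n \<Longrightarrow> homogeneous 1 (X $$ (i, j))"
    and Y1: "\<And>i j. i < n \<Longrightarrow> j < m \<Longrightarrow> homogeneous 1 (Y $$ (i, j))"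
    and ij: "i < m" "j < m"
  shows "homogeneous 2 ((X * Y) $$ (i, j))"
  using ij X Y homogeneous_times[OF X1 Y1]
  by (auto simp: scalar_prod_def numeral_2_eq_2 intro!: homogeneous_sum)

text \<open>The odd counterpart of det (1 + XY) = det (1 + YX): exchanging odd factors negates the
  traces of all powers, and negated traces invert the determinant.\<close>

lemma form_det_odd_swap:
  assumes X: "X \<in> carrier_mat m n" and Y: "Y \<in> carrier_mat n m"
    and X1: "\<And>i j. i < m \<Longrightarrow> j < n \<Longrightarrow> homogeneous 1 (X $$ (i, j))"
    and Y1: "\<And>i j. i < n \<Longrightarrow> j < m \<Longrightarrow> homogeneous 1 (Y $$ (i, j))"
  shows "form_det (1\<^sub>m m + X * Y) * form_det (1\<^sub>m n + Y * X) = 1"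
proof -
  define A where "A = map_mat Abs_eform (X * Y)"
  define B where "B = map_mat Abs_eform (Y * X)"
  have A: "A \<in> carrier_mat m m" and B: "B \<in> carrier_mat n n" using X Y by (auto simp: A_def B_def)
  have hX: "homogeneous 2 ((X * Y) $$ (i, j))" if "i < m" "j < m" for i j
    by (rule homogeneous_mat_mult_entry[OF X Y X1 Y1 that])
  have hY: "homogeneous 2 ((Y * X) $$ (i, j))" if "i < n" "j < n" for i j
    by (rule homogeneous_mat_mult_entry[OF Y X Y1 X1 that])
  have fA: "form (A $$ (i, j)) = (X * Y) $$ (i, j)" if "i < m" "j < m" for i j
    using that X Y homogeneous_parity[OF hX[OF that]] by (simp add: A_def Abs_eform_inverse)
  have fB: "form (B $$ (i, j)) = (Y * X) $$ (i, j)" if "i < n" "j < n" for i j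
    using that X Y homogeneous_parity[OF hY[OF that]] by (simp add: B_def Abs_eform_inverse)
  have mA: "map_mat form A = X * Y" using A X Y fA by (intro eq_matI) auto
  have mB: "map_mat form B = Y * X" using B X Y fB by (intro eq_matI) auto
  have pX: "parity_mat False X" and pY: "parity_mat False Y"
    using X Y X1 Y1 homogeneous_parity[of 1] by (auto simp: parity_mat_def)
  have pYX: "parity_mat True (Y * X)" using parity_mat_times[OF pY pX Y X] by simp
  have fm: "form (mtrace C) = mtrace (map_mat form C)" if "C \<in> carrier_mat l l" for C l
    using that by (simp add: mtrace_def form.hom_sum)
  have trA: "form (mtrace (A ^\<^sub>m l)) = mtrace ((X * Y) ^\<^sub>m l)" for l
    using fm[OF pow_carrier_mat[OF A, of l]] unfolding form.mat_hom_pow[OF A, of l] mA .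
  have trB: "form (mtrace (B ^\<^sub>m l)) = mtrace ((Y * X) ^\<^sub>m l)" for l
    using fm[OF pow_carrier_mat[OF B, of l]] unfolding form.mat_hom_pow[OF B, of l] mB .
  have tr: "mtrace (A ^\<^sub>m Suc k) = - mtrace (B ^\<^sub>m Suc k)" for k
  proof -
    \<comment> \<open>The odd factor left when one X is split off from (XY)^(k+1).\<close>
    define Z where "Z = (Y * X) ^\<^sub>m k * Y"
    have YX: "(Y * X) ^\<^sub>m k \<in> carrier_mat n n" using X Y by (intro pow_carrier_mat) auto
    have Z: "Z \<in> carrier_mat n m" using YX Y by (auto simp: Z_def)
    have pZ: "parity_mat False Z"
      using parity_mat_times[OF parity_mat_pow[OF pYX mult_carrier_mat[OF Y X]] pY YX Y] by (simp add: Z_def)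
    have "form (mtrace (A ^\<^sub>m Suc k)) = mtrace ((X * Y) ^\<^sub>m Suc k)"
      unfolding trA ..
    also have "\<dots> = mtrace (X * Z)" unfolding Z_def mult_pow_mat_swap[OF X Y, of k] ..
    also have "\<dots> = - mtrace (Z * X)" by (rule mtrace_odd_swap[OF X Z pX pZ])
    also have "Z * X = (Y * X) ^\<^sub>m Suc k"
    proof -
      have "(Y * X) ^\<^sub>m k * Y * X = (Y * X) ^\<^sub>m k * (Y * X)" using X Y YX by (intro assoc_mult_mat) auto
      then show ?thesis by (simp add: Z_def)
    qed
    also have "mtrace ((Y * X) ^\<^sub>m Suc k) = form (mtrace (B ^\<^sub>m Suc k))"
      unfolding trB ..
    finally show ?thesis by (simp add: form_inject[symmetric] form.hom_uminus)
  qed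
  interpret grading: comm_ring_hom grading by (rule grading_hom)
  have "grading (det (1\<^sub>m m + A)) = det (one_plus_X A)"
    by (rule det_map_grading[OF A]) (simp only: fA hX)
  moreover have "grading (det (1\<^sub>m n + B)) = det (one_plus_X B)"
    by (rule det_map_grading[OF B]) (simp only: fB hY)
  ultimately have "grading (det (1\<^sub>m m + A) * det (1\<^sub>m n + B)) = det (one_plus_X A) * det (one_plus_X B)"
    by (simp only: grading.hom_mult)
  also have "\<dots> = 1" by (rule det_one_plus_X_mult_eq_1[OF A B tr eform_torsion_free])
  finally have "grading (det (1\<^sub>m m + A) * det (1\<^sub>m n + B)) = grading 1" by simp
  then have "det (1\<^sub>m m + A) * det (1\<^sub>m n + B) = 1" by (rule injD[OF inj_grading])
  then have "form (det (1\<^sub>m m + A)) * form (det (1\<^sub>m n + B)) = 1"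
    by (simp flip: form.hom_mult)
  moreover have "map_mat form (1\<^sub>m m + A) = 1\<^sub>m m + X * Y"
    using A X Y fA by (intro eq_matI) auto
  moreover have "map_mat form (1\<^sub>m n + B) = 1\<^sub>m n + Y * X"
    using B X Y fB by (intro eq_matI) auto
  ultimately show ?thesis
    using form_det_map_form[of "1\<^sub>m m + A" m] form_det_map_form[of "1\<^sub>m n + B" n] A B by simp
qed

section \<open>Pulling back along a linear substitution of one-forms\<close>

text \<open>The image of the monomial dx_S when each dx_s is replaced by \<open>v s\<close>; the
  increasing order matches the convention for dx_S.\<close>

definition ordered_prod :: "(nat \<Rightarrow> dform) \<Rightarrow> nat set \<Rightarrow> dform" where
  "ordered_prod v S = prod_list (map v (sorted_list_of_set S))"

lemma ordered_prod_empty [simp]: "ordered_prod v {} = 1"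
  by (simp add: ordered_prod_def)

lemma ordered_prod_insert_min:
  assumes "finite A" "\<And>a. a \<in> A \<Longrightarrow> b < a"
  shows "ordered_prod v (insert b A) = v b * ordered_prod v A"
proof -
  have "b \<notin> A" using assms(2) by blast
  then have "sorted_list_of_set (insert b A) = insort b (sorted_list_of_set A)"
    using assms(1) by simp
  also have "\<dots> = b # sorted_list_of_set A"
    using assms by (intro insort_is_Cons) (auto intro: less_imp_le)
  finally have "sorted_list_of_set (insert b A) = b # sorted_list_of_set A" .
  then show ?thesis by (simp add: ordered_prod_def)
qed

lemma shuffle_sign_singletons: "shuffle_sign {t} {b} = (if b < t then - 1 else 1)"
proof -
  have "{(x, u). x \<in> {t} \<and> u \<in> {b} \<and> u < x} = (if b < t then {(t, b)} else {})" by auto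
  then show ?thesis by (simp add: shuffle_sign_def)
qed

lemma shuffle_sign_insert_right:
  "finite A \<Longrightarrow> b \<notin> A \<Longrightarrow> shuffle_sign {t} (insert b A) = shuffle_sign {t} {b} * shuffle_sign {t} A"
  using shuffle_sign_Un_right[of "{t}" "{b}" A] by simp

lemma shuffle_sign_insert_left:
  "finite A \<Longrightarrow> finite U \<Longrightarrow> b \<notin> A \<Longrightarrow> shuffle_sign (insert b A) U = shuffle_sign {b} U * shuffle_sign A U"
  using shuffle_sign_Un_left[of "{b}" A U] by simp

lemma shuffle_sign_less:
  assumes "\<And>a. a \<in> A \<Longrightarrow> b < a"
  shows "shuffle_sign {b} A = 1"
proof -
  have "{(x, u). x \<in> {b} \<and> u \<in> A \<and> u < x} = {}" using assms by fastforce
  then show ?thesis by (simp only: shuffle_sign_def card.empty power_0)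
qed

lemma homogeneous_1_square:
  assumes "homogeneous 1 \<alpha>"
  shows "\<alpha> * \<alpha> = 0"
proof (rule dform_eqI)
  fix S
  have "\<alpha> * \<alpha> = - (\<alpha> * \<alpha>)" by (rule homogeneous_1_anticommute[OF assms assms])
  then have "coeff (\<alpha> * \<alpha>) S = - coeff (\<alpha> * \<alpha>) S" by (metis uminus_dform.rep_eq)
  then show "coeff (\<alpha> * \<alpha>) S = coeff 0 S" by (simp add: zero_dform.rep_eq)
qed

context
  fixes v :: "nat \<Rightarrow> dform"
  assumes v: "\<And>s. homogeneous 1 (v s)"
begin

lemma homogeneous_ordered_prod: "finite S \<Longrightarrow> homogeneous (card S) (ordered_prod v S)"
proof (induction S rule: finite_linorder_min_induct)
  case (insert b A)
  then have "b \<notin> A" by auto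
  then show ?case
    using insert homogeneous_times[OF v[of b] insert(3)] by (simp add: ordered_prod_insert_min)
qed simp

text \<open>The one-form \<open>v t\<close> is moved to the right past the smaller factors. Each
  passage contributes -1, which is what \<open>shuffle_sign\<close> counts, and meeting itself gives
  0.\<close>

lemma times_ordered_prod:
  assumes "finite U"
  shows "v t * ordered_prod v U =
    (if t \<in> U then 0 else const_form (shuffle_sign {t} U) * ordered_prod v (insert t U))"
  using assms
proof (induction U rule: finite_linorder_min_induct)
  case empty
  then show ?case using ordered_prod_insert_min[of "{}" t v] by simp
next
  case (insert b A)
  have bA: "b \<notin> A" using insert by auto
  have split: "ordered_prod v (insert b A) = v b * ordered_prod v A"
    using insert by (intro ordered_prod_insert_min) auto
  consider "t < b" | "t = b" | "b < t" by linarith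
  then show ?case
  proof cases
    case 1
    then have less: "t < a" if "a \<in> insert b A" for a using insert that by fastforce
    then have "t \<notin> insert b A" by blast
    then show ?thesis
      using ordered_prod_insert_min[of "insert b A" t v] less insert(1) shuffle_sign_less[of "insert b A" t]
      by simp
  next
    case 2
    have "v b * (v b * ordered_prod v A) = 0"
      using homogeneous_1_square[OF v, of b] by (simp flip: mult.assoc)
    then show ?thesis using 2 split by simp
  next
    case 3
    have "v t * ordered_prod v (insert b A) = v t * v b * ordered_prod v A"
      by (simp add: split mult.assoc)
    also have "v t * v b = - (v b * v t)" by (rule homogeneous_1_anticommute[OF v v])
    also have "- (v b * v t) * ordered_prod v A = - (v b * (v t * ordered_prod v A))"
      by (simp add: mult.assoc)
    finally have eq: "v t * ordered_prod v (insert b A) = - (v b * (v t * ordered_prod v A))" .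
    show ?thesis
    proof (cases "t \<in> A")
      case True
      then show ?thesis using eq insert(3) by simp
    next
      case False
      have "ordered_prod v (insert b (insert t A)) = v b * ordered_prod v (insert t A)"
        using insert 3 by (intro ordered_prod_insert_min) auto
      moreover have "v b * (const_form c * \<beta>) = const_form c * (v b * \<beta>)" for c \<beta>
        by (metis const_form_commute mult.assoc)
      moreover have "const_form (shuffle_sign {t} (insert b A)) = - const_form (shuffle_sign {t} A)"
      proof -
        have "const_form (- c) = - const_form c" for c
          by (rule dform_eqI) (simp add: const_form.rep_eq uminus_dform.rep_eq)
        then show ?thesis
          using shuffle_sign_insert_right[OF insert(1) bA, of t] 3 by (simp add: shuffle_sign_singletons)
      qed
      ultimately show ?thesis
        using eq insert(3) False 3 by (simp add: insert_commute)
    qed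
  qed
qed

text \<open>Products of arbitrary one-forms multiply by the same rule as the monomials dx_S; this
  makes the substitution multiplicative.\<close>

lemma ordered_prod_times:
  assumes "finite T" "finite U"
  shows "ordered_prod v T * ordered_prod v U =
    (if T \<inter> U = {} then const_form (shuffle_sign T U) * ordered_prod v (T \<union> U) else 0)"
  using assms(1)
proof (induction T rule: finite_linorder_min_induct)
  case (insert b A)
  have bA: "b \<notin> A" using insert by auto
  have "ordered_prod v (insert b A) * ordered_prod v U = v b * (ordered_prod v A * ordered_prod v U)"
    using insert by (simp add: ordered_prod_insert_min mult.assoc)
  also have "\<dots> = (if A \<inter> U = {} then const_form (shuffle_sign A U) * (v b * ordered_prod v (A \<union> U)) else 0)"
    using insert by (simp, metis const_form_commute mult.assoc)
  also have "\<dots> = (if insert b A \<inter> U = {} then const_form (shuffle_sign (insert b A) U)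
      * ordered_prod v (insert b A \<union> U) else 0)"
  proof (cases "A \<inter> U = {} \<and> b \<notin> U")
    case True
    have "shuffle_sign {b} (A \<union> U) = shuffle_sign {b} A * shuffle_sign {b} U"
      using True insert(1) assms(2) by (intro shuffle_sign_Un_right) auto
    moreover have "shuffle_sign {b} A = 1" using insert(2) by (intro shuffle_sign_less) auto
    ultimately have "shuffle_sign (insert b A) U = shuffle_sign A U * shuffle_sign {b} (A \<union> U)"
      using shuffle_sign_insert_left[OF insert(1) assms(2) bA] by simp
    then show ?thesis
      using True bA times_ordered_prod[of "A \<union> U" b] insert(1) assms(2)
      by (simp add: const_form_mult mult.assoc)
  next
    case False
    then show ?thesis using times_ordered_prod[of "A \<union> U" b] insert(1) assms(2) by auto
  qed
  finally show ?case .
qed simp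

end

text \<open>The substitution of \<open>v s\<close> for dx_s when s < m, with all other generators
  sent to 0. It is given on monomials, so that multiplicativity becomes a statement about
  \<open>ordered_prod\<close>.\<close>

definition pullback :: "nat \<Rightarrow> (nat \<Rightarrow> dform) \<Rightarrow> dform \<Rightarrow> dform" where
  "pullback m v \<alpha> = (\<Sum>S\<in>Pow {..<m}. const_form (coeff \<alpha> S) * ordered_prod v S)"

lemma pullback_add: "pullback m v (\<alpha> + \<beta>) = pullback m v \<alpha> + pullback m v \<beta>"
  by (simp add: pullback_def plus_dform.rep_eq const_form_add distrib_right sum.distrib)

lemma pullback_const_form [simp]: "pullback m v (const_form c) = const_form c"
proof -
  have "pullback m v (const_form c) = (\<Sum>S\<in>Pow {..<m}. if S = {} then const_form c else 0)"
    unfolding pullback_def by (rule sum.cong) (auto simp: const_form.rep_eq)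
  then show ?thesis by simp
qed

lemma pullback_dx:
  assumes "s < m"
  shows "pullback m v (dx s) = v s"
proof -
  have "pullback m v (dx s) = (\<Sum>S\<in>Pow {..<m}. if S = {s} then v s else 0)"
    unfolding pullback_def by (rule sum.cong) (auto simp: dx.rep_eq ordered_prod_def)
  then show ?thesis using assms by simp
qed

context
  fixes v :: "nat \<Rightarrow> dform" and m :: nat
  assumes v: "\<And>s. homogeneous 1 (v s)"
begin

lemma pullback_times: "pullback m v (\<alpha> * \<beta>) = pullback m v \<alpha> * pullback m v \<beta>"
proof -
  let ?M = "{..<m}" and ?w = "ordered_prod v"
  let ?t = "\<lambda>(T, U). const_form (shuffle_sign T U * coeff \<alpha> T * coeff \<beta> U) * ?w (T \<union> U)"
  have fin: "finite T" if "T \<in> Pow ?M" for T using that by (auto intro: finite_subset)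
  have "pullback m v (\<alpha> * \<beta>) = (\<Sum>S\<in>Pow ?M. \<Sum>T\<in>Pow S. ?t (T, S - T))"
    unfolding pullback_def times_dform.rep_eq const_form_sum sum_distrib_right
    by (intro sum.cong refl) (auto simp: Un_absorb1)
  also have "\<dots> = (\<Sum>(S, T)\<in>Sigma (Pow ?M) Pow. ?t (T, S - T))"
    by (rule sum.Sigma) (auto intro: finite_subset)
  \<comment> \<open>A pair T \<subseteq> S becomes the disjoint pair (T, S - T).\<close>
  also have "\<dots> = sum ?t (SIGMA T:Pow ?M. Pow (?M - T))"
    by (rule sum.reindex_bij_witness[of _ "\<lambda>(T, U). (T \<union> U, T)" "\<lambda>(S, T). (T, S - T)"]) auto
  also have "\<dots> = (\<Sum>T\<in>Pow ?M. \<Sum>U\<in>Pow (?M - T). ?t (T, U))"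
    by (subst sum.Sigma) auto
  also have "\<dots> = (\<Sum>T\<in>Pow ?M. \<Sum>U\<in>Pow ?M. (const_form (coeff \<alpha> T) * ?w T) * (const_form (coeff \<beta> U) * ?w U))"
  proof (rule sum.cong[OF refl])
    fix T assume T: "T \<in> Pow ?M"
    have swap: "(const_form a * x) * (const_form b * y) = const_form (a * b) * (x * y)" for a b x y
    proof -
      have "(const_form a * x) * (const_form b * y) = const_form a * (x * const_form b) * y"
        by (simp only: mult.assoc)
      also have "\<dots> = const_form (a * b) * (x * y)"
        by (simp only: const_form_commute[of x b] const_form_mult mult.assoc)
      finally show ?thesis .
    qed
    have merge: "const_form (a * b) * (const_form s * x) = const_form (s * a * b) * x" for a b s x
      by (subst mult.assoc[of s], subst mult.commute[of s]) (simp only: const_form_mult mult.assoc)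
    \<comment> \<open>Intersecting pairs may be added to the sum, since a repeated one-form makes
      their product 0.\<close>
    have "(const_form (coeff \<alpha> T) * ?w T) * (const_form (coeff \<beta> U) * ?w U) =
        (if T \<inter> U = {} then ?t (T, U) else 0)" if "U \<in> Pow ?M" for U
      unfolding swap ordered_prod_times[OF v fin[OF T] fin[OF that]]
      by (simp add: merge)
    then have "(\<Sum>U\<in>Pow ?M. (const_form (coeff \<alpha> T) * ?w T) * (const_form (coeff \<beta> U) * ?w U)) =
        (\<Sum>U\<in>Pow ?M. if T \<inter> U = {} then ?t (T, U) else 0)"
      by (rule sum.cong[OF refl])
    also have "\<dots> = (\<Sum>U\<in>Pow (?M - T). ?t (T, U))"
      by (rule sum.mono_neutral_cong_right) auto
    finally show "(\<Sum>U\<in>Pow (?M - T). ?t (T, U)) =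
        (\<Sum>U\<in>Pow ?M. (const_form (coeff \<alpha> T) * ?w T) * (const_form (coeff \<beta> U) * ?w U))" by simp
  qed
  also have "\<dots> = pullback m v \<alpha> * pullback m v \<beta>"
    by (simp only: pullback_def sum_product)
  finally show ?thesis .
qed

lemma pullback_hom: "ring_hom (pullback m v)"
proof
  show "pullback m v 1 = 1" using pullback_const_form[of m v 1] by simp
  show "pullback m v 0 = 0" using pullback_const_form[of m v 0] by simp
qed (simp_all only: pullback_add pullback_times)

lemma degree_part_sum: "degree_part k (sum f I) = (\<Sum>i\<in>I. degree_part k (f i))"
proof (induction I rule: infinite_finite_induct)
  case (insert x F)
  then show ?case by (simp add: degree_part_add)
qed (simp_all add: homogeneous_degree_part[of 0 0])

lemma degree_part_pullback: "degree_part k (pullback m v \<alpha>) = pullback m v (degree_part k \<alpha>)"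
  unfolding pullback_def degree_part_sum
proof (rule sum.cong[OF refl])
  fix S assume "S \<in> Pow {..<m}"
  then have "finite S" by (auto intro: finite_subset)
  then have "homogeneous (card S) (const_form (coeff \<alpha> S) * ordered_prod v S)"
    using homogeneous_times[OF homogeneous_const_form homogeneous_ordered_prod[OF v]] by simp
  then show "degree_part k (const_form (coeff \<alpha> S) * ordered_prod v S) =
      const_form (coeff (degree_part k \<alpha>) S) * ordered_prod v S"
    by (auto simp: homogeneous_degree_part degree_part.rep_eq)
qed

text \<open>All other monomials are sent to forms of degree below m. The factor is the determinant
  of the m by m coefficient matrix of v, hence the same for every \<alpha>.\<close>

lemma coeff_top_pullback:
  "coeff (pullback m v \<alpha>) {..<m} = coeff \<alpha> {..<m} * coeff (ordered_prod v {..<m}) {..<m}"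
proof -
  have "coeff (ordered_prod v S) {..<m} = 0" if "S \<in> Pow {..<m}" "S \<noteq> {..<m}" for S
  proof -
    have "card S < m" using that psubset_card_mono[of "{..<m}" S] by auto
    moreover have "finite S" using that by (auto intro: finite_subset)
    ultimately show ?thesis
      using homogeneous_ordered_prod[of v S, OF v] by (auto simp: homogeneous_def)
  qed
  then have "coeff (pullback m v \<alpha>) {..<m} =
      (\<Sum>S\<in>Pow {..<m}. if S = {..<m} then coeff \<alpha> S * coeff (ordered_prod v S) {..<m} else 0)"
    unfolding pullback_def dform_coeff_sum coeff_const_form_times by (intro sum.cong) auto
  then show ?thesis by simp
qed

end

lemma form_det_hom:
  fixes h :: "dform \<Rightarrow> dform"
  assumes h: "ring_hom h" and A: "A \<in> carrier_mat n n"
  shows "form_det (map_mat h A) = h (form_det A)"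
proof -
  interpret h: ring_hom h by (rule h)
  have dim: "dim_row A = n" "dim_row (map_mat h A) = n" using A by auto
  have hp: "h (prod_list xs) = prod_list (map h xs)" for xs
    by (induction xs) (simp_all add: h.hom_mult)
  have "of_int (sign p) * prod_list (map (\<lambda>i. map_mat h A $$ (i, p i)) [0..<n]) =
      h (of_int (sign p) * prod_list (map (\<lambda>i. A $$ (i, p i)) [0..<n]))"
    if p: "p permutes {0..<n}" for p
  proof -
    have "map (\<lambda>i. map_mat h A $$ (i, p i)) [0..<n] = map h (map (\<lambda>i. A $$ (i, p i)) [0..<n])"
      using A permutes_in_image[OF p] by auto
    then show ?thesis by (simp only: h.hom_mult h.hom_of_int hp)
  qed
  then show ?thesis
    unfolding form_det_def dim h.hom_sum by (intro sum.cong) auto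
qed

section \<open>Multinomial sums and Jacobi-Trudi determinants\<close>

lemma weak_compositions_0: "weak_compositions 0 m = (if m = 0 then {[]} else {})"
  by (auto simp: weak_compositions_def)

lemma weak_compositions_Suc:
  "weak_compositions (Suc h) m = (\<Union>k\<in>{..m}. (#) k ` weak_compositions h (m - k))"
  by (auto simp: weak_compositions_def length_Suc_conv image_iff)

lemma finite_weak_compositions [simp]: "finite (weak_compositions h m)"
  by (induction h arbitrary: m) (auto simp: weak_compositions_0 weak_compositions_Suc)

text \<open>Shows that the natural-number division in \<open>multinomial\<close> is exact.\<close>

lemma prod_fact_mult_multinomial:
  "prod_list (map fact mu) * multinomial (sum_list mu) mu = fact (sum_list mu)"
proof -
  have "prod_list (map fact mu) dvd (fact (sum_list mu) :: nat)"
  proof (induction mu)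
    case (Cons k mu)
    have "fact k * prod_list (map fact mu) dvd (fact k * fact (sum_list mu) :: nat)"
      using Cons by (simp add: mult_dvd_mono)
    also have "\<dots> dvd fact (k + sum_list mu)" by (rule fact_fact_dvd_fact)
    finally show ?case by simp
  qed simp
  then show ?thesis by (simp add: multinomial_def)
qed

lemma multinomial_Cons:
  assumes "k \<le> m" "sum_list mu = m - k"
  shows "multinomial m (k # mu) = (m choose k) * multinomial (m - k) mu"
proof -
  let ?P = "prod_list (map fact mu) :: nat"
  have pos: "fact k * ?P \<noteq> 0" by (auto simp: prod_list_zero_iff)
  have "(fact k * ?P) * multinomial m (k # mu) = fact m"
    using prod_fact_mult_multinomial[of "k # mu"] assms by simp
  also have "\<dots> = fact k * fact (m - k) * (m choose k)"
    using binomial_fact_lemma[OF assms(1)] by simp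
  also have "fact (m - k) = ?P * multinomial (m - k) mu"
    using prod_fact_mult_multinomial[of mu] assms by simp
  finally have "(fact k * ?P) * multinomial m (k # mu) = (fact k * ?P) * ((m choose k) * multinomial (m - k) mu)"
    by (simp add: mult_ac)
  then show ?thesis using pos by (metis mult_left_cancel)
qed

text \<open>F stands for the value of the monomial with exponents mu, so this is the expansion of
  the m-th power of a sum of h commuting quantities, with the monomials left abstract.\<close>

definition multinomial_sum :: "nat \<Rightarrow> nat \<Rightarrow> (nat list \<Rightarrow> 'a) \<Rightarrow> 'a :: comm_ring_1" where
  "multinomial_sum h m F = (\<Sum>mu\<in>weak_compositions h m. of_nat (multinomial m mu) * F mu)"

lemma multinomial_sum_0_left: "multinomial_sum 0 m F = (if m = 0 then F [] else 0)"
  by (simp add: multinomial_sum_def weak_compositions_0 multinomial_def)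

lemma multinomial_sum_Suc:
  "multinomial_sum (Suc h) m F =
    (\<Sum>k\<le>m. of_nat (m choose k) * multinomial_sum h (m - k) (\<lambda>mu. F (k # mu)))"
proof -
  have "multinomial_sum (Suc h) m F =
      (\<Sum>k\<le>m. \<Sum>mu\<in>(#) k ` weak_compositions h (m - k). of_nat (multinomial m mu) * F mu)"
    unfolding multinomial_sum_def weak_compositions_Suc by (rule sum.UNION_disjoint) auto
  also have "\<dots> = (\<Sum>k\<le>m. of_nat (m choose k) * multinomial_sum h (m - k) (\<lambda>mu. F (k # mu)))"
  proof (rule sum.cong[OF refl])
    fix k assume "k \<in> {..m}"
    then have "of_nat (multinomial m (k # mu)) = (of_nat (m choose k) * of_nat (multinomial (m - k) mu) :: 'a)"
      if "mu \<in> weak_compositions h (m - k)" for mu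
      using that multinomial_Cons[of k m mu] by (simp add: weak_compositions_def)
    then show "(\<Sum>mu\<in>(#) k ` weak_compositions h (m - k). of_nat (multinomial m mu) * F mu) =
        of_nat (m choose k) * multinomial_sum h (m - k) (\<lambda>mu. F (k # mu))"
      by (simp add: multinomial_sum_def sum.reindex sum_distrib_left mult.assoc)
  qed
  finally show ?thesis .
qed

lemma multinomial_sum_0_right: "multinomial_sum h 0 F = F (replicate h 0)"
  by (induction h arbitrary: F) (simp_all add: multinomial_sum_0_left multinomial_sum_Suc)

text \<open>One more factor of y_1 + ... + y_h: choosing y_l raises the l-th exponent. Splitting off
  the first exponent reduces this to Pascal's rule for binomials.\<close>

lemma multinomial_sum_pascal:
  "multinomial_sum h (Suc m) F = (\<Sum>l<h. multinomial_sum h m (\<lambda>mu. F (mu[l := Suc (mu ! l)])))"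
proof (induction h arbitrary: m F)
  case 0
  then show ?case by (simp add: multinomial_sum_0_left)
next
  case (Suc h)
  define W where "W j k = multinomial_sum h j (\<lambda>mu. F (k # mu))" for j k
  have "multinomial_sum (Suc h) (Suc m) F = W (Suc m) 0 + (\<Sum>k\<le>m. of_nat (Suc m choose Suc k) * W (m - k) (Suc k))"
    by (simp add: multinomial_sum_Suc W_def sum.atMost_Suc_shift del: binomial_Suc_Suc sum.atMost_Suc)
  also have "\<dots> = (\<Sum>k\<le>m. of_nat (m choose k) * W (m - k) (Suc k)) +
      (W (Suc m) 0 + (\<Sum>k\<le>m. of_nat (m choose Suc k) * W (m - k) (Suc k)))"
    by (simp add: distrib_right sum.distrib add_ac)
  also have "W (Suc m) 0 + (\<Sum>k\<le>m. of_nat (m choose Suc k) * W (m - k) (Suc k)) =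
      (\<Sum>k\<le>Suc m. of_nat (m choose k) * W (Suc m - k) k)"
    by (simp add: sum.atMost_Suc_shift del: sum.atMost_Suc)
  also have "\<dots> = (\<Sum>k\<le>m. of_nat (m choose k) * W (Suc (m - k)) k)"
    by (simp add: Suc_diff_le binomial_eq_0)
  also have "\<dots> = (\<Sum>l<h. \<Sum>k\<le>m. of_nat (m choose k) * multinomial_sum h (m - k) (\<lambda>mu. F (k # mu[l := Suc (mu ! l)])))"
    by (subst sum.swap) (simp add: W_def Suc sum_distrib_left)
  also have "(\<Sum>k\<le>m. of_nat (m choose k) * W (m - k) (Suc k)) +
      (\<Sum>l<h. \<Sum>k\<le>m. of_nat (m choose k) * multinomial_sum h (m - k) (\<lambda>mu. F (k # mu[l := Suc (mu ! l)]))) =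
      (\<Sum>l<Suc h. multinomial_sum (Suc h) m (\<lambda>mu. F (mu[l := Suc (mu ! l)])))"
    by (simp add: sum.lessThan_Suc_shift multinomial_sum_Suc W_def del: sum.lessThan_Suc)
  finally show ?case .
qed

text \<open>The multinomial theorem for an element x that acts on the family G as a sum of h
  commuting index shifts.\<close>

lemma power_times_eq_multinomial_sum:
  assumes "\<And>mu. length mu = h \<Longrightarrow> x * G mu = (\<Sum>l<h. G (mu[l := Suc (mu ! l)]))"
  shows "x ^ m * G (replicate h 0) = multinomial_sum h m G"
proof (induction m)
  case (Suc m)
  have "x ^ Suc m * G (replicate h 0) = x * multinomial_sum h m G"
    by (simp add: Suc[symmetric] mult.assoc)
  also have "\<dots> = (\<Sum>mu\<in>weak_compositions h m. of_nat (multinomial m mu) * (\<Sum>l<h. G (mu[l := Suc (mu ! l)])))"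
    unfolding multinomial_sum_def sum_distrib_left[of x]
  proof (rule sum.cong[OF refl])
    fix mu assume "mu \<in> weak_compositions h m"
    then show "x * (of_nat (multinomial m mu) * G mu) =
        of_nat (multinomial m mu) * (\<Sum>l<h. G (mu[l := Suc (mu ! l)]))"
      using assms[of mu] by (simp add: weak_compositions_def mult.left_commute[of x])
  qed
  also have "\<dots> = multinomial_sum h (Suc m) G"
    unfolding multinomial_sum_pascal unfolding multinomial_sum_def sum_distrib_left by (rule sum.swap)
  finally show ?case .
qed (simp add: multinomial_sum_0_right)

text \<open>The determinant of the matrix h(i_s - r), expanded along its first row, for indices in
  any order. Written out in this way, shift identities become polynomial identities in the
  entries.\<close>

definition jacobi_trudi :: "(int \<Rightarrow> 'a :: comm_ring_1) \<Rightarrow> nat \<Rightarrow> nat \<Rightarrow> nat \<Rightarrow> 'a" where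
  "jacobi_trudi h i j k =
     h (int i - 1) * (h (int j - 2) * h (int k - 3) - h (int j - 3) * h (int k - 2))
   - h (int i - 2) * (h (int j - 1) * h (int k - 3) - h (int j - 3) * h (int k - 1))
   + h (int i - 3) * (h (int j - 1) * h (int k - 2) - h (int j - 2) * h (int k - 1))"

section \<open>Symmetric functions acting by shifts of the indices\<close>

context
  fixes h :: "int \<Rightarrow> 'a :: comm_ring_1" and e1 e2 e3 :: 'a
  assumes h0: "h 0 = 1" and hneg: "\<And>k. k < 0 \<Longrightarrow> h k = 0"
    and rec: "\<And>k. 0 < k \<Longrightarrow> h k = e1 * h (k - 1) - e2 * h (k - 2) + e3 * h (k - 3)"
begin

text \<open>
  The recurrence fails for h 0 = 1, whence the restriction to positive indices below.
\<close>

lemma h_shift: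
  assumes "1 \<le> i"
  shows "h (int (Suc i) - 1) = e1 * h (int i - 1) - e2 * h (int i - 2) + e3 * h (int i - 3)"
    "h (int (Suc i) - 2) = h (int i - 1)" "h (int (Suc i) - 3) = h (int i - 2)"
  using rec[of "int i"] assms by simp_all

text \<open>Raising an index multiplies its row (h(i-1), h(i-2), h(i-3)) by a companion matrix with
  characteristic polynomial x^3 - e1 x^2 + e2 x - e3. Raising one row in all possible ways and
  adding up multiplies the determinant by the trace e1; raising two or three rows gives the other
  coefficients e2 and e3.\<close>

lemma jacobi_trudi_e1:
  assumes "1 \<le> i" "1 \<le> j" "1 \<le> k"
  shows "e1 * jacobi_trudi h i j k =
    jacobi_trudi h (Suc i) j k + jacobi_trudi h i (Suc j) k + jacobi_trudi h i j (Suc k)"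
  unfolding jacobi_trudi_def h_shift[OF assms(1)] h_shift[OF assms(2)] h_shift[OF assms(3)]
  by (simp only: algebra_simps)

lemma jacobi_trudi_e2:
  assumes "1 \<le> i" "1 \<le> j" "1 \<le> k"
  shows "e2 * jacobi_trudi h i j k =
    jacobi_trudi h i (Suc j) (Suc k) + jacobi_trudi h (Suc i) j (Suc k) + jacobi_trudi h (Suc i) (Suc j) k"
  unfolding jacobi_trudi_def h_shift[OF assms(1)] h_shift[OF assms(2)] h_shift[OF assms(3)]
  by (simp only: algebra_simps)

lemma jacobi_trudi_e3:
  assumes "1 \<le> i" "1 \<le> j" "1 \<le> k"
  shows "e3 * jacobi_trudi h i j k = jacobi_trudi h (Suc i) (Suc j) (Suc k)"
  unfolding jacobi_trudi_def h_shift[OF assms(1)] h_shift[OF assms(2)] h_shift[OF assms(3)]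
  by (simp only: algebra_simps)

lemma h_small: "h 1 = e1" "h 2 = e1 * e1 - e2"
  using rec[of 1] rec[of 2] h0 hneg[of "- 1"] hneg[of "- 2"] by simp_all

text \<open>From h 2 = e1^2 - e2. The second factor e1 is left unexpanded where the first one raises
  i. Expanding it in the other two terms gives six determinants; subtracting e2 cancels the two that
  raise i and one of the two copies that raise j and k.\<close>

lemma jacobi_trudi_h2:
  assumes "1 \<le> i" "1 \<le> j" "1 \<le> k"
  shows "h 2 * jacobi_trudi h i j k = h 1 * jacobi_trudi h (Suc i) j k
    + jacobi_trudi h i (Suc j) (Suc k) + jacobi_trudi h i j (Suc (Suc k)) + jacobi_trudi h i (Suc (Suc j)) k"
proof -
  let ?J = "jacobi_trudi h"
  have "h 2 * ?J i j k = e1 * (e1 * ?J i j k) - e2 * ?J i j k"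
    by (simp add: h_small algebra_simps)
  also have "\<dots> = e1 * ?J (Suc i) j k + e1 * ?J i (Suc j) k + e1 * ?J i j (Suc k) - e2 * ?J i j k"
    unfolding jacobi_trudi_e1[OF assms] by (simp add: algebra_simps)
  also have "e1 * ?J i (Suc j) k = ?J (Suc i) (Suc j) k + ?J i (Suc (Suc j)) k + ?J i (Suc j) (Suc k)"
    by (rule jacobi_trudi_e1) (use assms in auto)
  also have "e1 * ?J i j (Suc k) = ?J (Suc i) j (Suc k) + ?J i (Suc j) (Suc k) + ?J i j (Suc (Suc k))"
    by (rule jacobi_trudi_e1) (use assms in auto)
  finally show ?thesis unfolding jacobi_trudi_e2[OF assms] by (simp add: h_small algebra_simps)
qed

text \<open>The triples (1,2,3), (1,3,4) and (1,3,5) belong to the empty partition, (1,1) and (2,1),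
  whose Schur polynomials are 1, e_2 and e_1 e_2 - e_3.\<close>

lemma jacobi_trudi_special:
  "jacobi_trudi h 1 2 3 = 1" "jacobi_trudi h 1 3 4 = e2" "jacobi_trudi h 1 3 5 = e1 * e2 - e3"
  using h0 hneg[of "- 1"] hneg[of "- 2"] h_small rec[of 3] rec[of 4]
  by (simp_all add: jacobi_trudi_def algebra_simps)

lemma e3_power:
  assumes "1 \<le> i" "1 \<le> j" "1 \<le> k"
  shows "e3 ^ t * jacobi_trudi h i j k = jacobi_trudi h (i + t) (j + t) (k + t)"
  by (induction t) (use assms jacobi_trudi_e3 in \<open>simp_all add: mult.assoc\<close>)

text \<open>The entries 0, 1, 2 of \<gamma> count how often the summand of e2 that leaves i, j or k
  unchanged, respectively, is chosen.\<close>

lemma e2_power: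
  assumes "1 \<le> i" "1 \<le> j" "1 \<le> k"
  shows "e2 ^ m * jacobi_trudi h i j k = multinomial_sum 3 m
    (\<lambda>\<gamma>. jacobi_trudi h (i + \<gamma> ! 1 + \<gamma> ! 2) (j + \<gamma> ! 0 + \<gamma> ! 2) (k + \<gamma> ! 0 + \<gamma> ! 1))"
    (is "_ = multinomial_sum 3 m ?G")
proof -
  have "e2 * ?G mu = (\<Sum>l<3. ?G (mu[l := Suc (mu ! l)]))" if "length mu = 3" for mu
    using jacobi_trudi_e2[of "i + mu ! 1 + mu ! 2" "j + mu ! 0 + mu ! 2" "k + mu ! 0 + mu ! 1"] assms that
    by (simp add: eval_nat_numeral)
  from power_times_eq_multinomial_sum[of 3 e2 ?G m, OF this] show ?thesis
    by (simp add: eval_nat_numeral)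
qed

text \<open>The entries of \<beta> count the choices among x_1 h_1, x_2 x_3, x_3^2 and x_2^2, in
  this order. Each choice of x_1 h_1 leaves a factor \<open>h 1\<close> in front.\<close>

lemma h2_power:
  assumes "1 \<le> i" "1 \<le> j" "1 \<le> k"
  shows "h 2 ^ m * jacobi_trudi h i j k = multinomial_sum 4 m
    (\<lambda>\<beta>. h 1 ^ (\<beta> ! 0) * jacobi_trudi h (i + \<beta> ! 0) (j + \<beta> ! 1 + 2 * \<beta> ! 3) (k + \<beta> ! 1 + 2 * \<beta> ! 2))"
    (is "_ = multinomial_sum 4 m ?G")
proof -
  have "h 2 * ?G mu = (\<Sum>l<4. ?G (mu[l := Suc (mu ! l)]))" if "length mu = 4" for mu
  proof -
    have "h 2 * ?G mu = h 1 ^ (mu ! 0) * (h 2 * jacobi_trudi h (i + mu ! 0) (j + mu ! 1 + 2 * mu ! 3) (k + mu ! 1 + 2 * mu ! 2))"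
      by (simp only: mult.left_commute)
    also have "\<dots> = (\<Sum>l<4. ?G (mu[l := Suc (mu ! l)]))"
      using jacobi_trudi_h2[of "i + mu ! 0" "j + mu ! 1 + 2 * mu ! 3" "k + mu ! 1 + 2 * mu ! 2"] assms that
      by (simp add: eval_nat_numeral algebra_simps)
    finally show ?thesis .
  qed
  from power_times_eq_multinomial_sum[of 4 "h 2" ?G m, OF this] show ?thesis
    by (simp add: eval_nat_numeral)
qed

text \<open>The binomial expansion of (e1 e2 - e3)^d, where d' counts the factors e1 e2: their e1
  joins the powers of \<open>h 1\<close>, their e2 joins e2^c, and the remaining powers of e3 raise
  all three indices by d - d'. Everything acts on the determinant for (1,2,3), which is 1.\<close>

lemma jacobi_trudi_expansion:
  "h 1 ^ a * h 2 ^ b * jacobi_trudi h 1 3 4 ^ c * jacobi_trudi h 1 3 5 ^ d =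
    (\<Sum>d'\<in>{0..d}. \<Sum>\<beta>\<in>weak_compositions 4 b. \<Sum>\<gamma>\<in>weak_compositions 3 (c + d').
       (- 1) ^ (d - d') * of_nat (d choose d') * of_nat (multinomial b \<beta>)
         * of_nat (multinomial (c + d') \<gamma>)
         * (h 1 ^ (a + d' + \<beta> ! 0) * jacobi_trudi h
             (1 + (d - d') + \<gamma> ! 1 + \<gamma> ! 2 + \<beta> ! 0)
             (2 + (d - d') + \<gamma> ! 0 + \<gamma> ! 2 + \<beta> ! 1 + 2 * \<beta> ! 3)
             (3 + (d - d') + \<gamma> ! 0 + \<gamma> ! 1 + 2 * \<beta> ! 2 + \<beta> ! 1)))"
proof -
  let ?J = "jacobi_trudi h"
  have expand: "h 2 ^ b * (e2 ^ m * (e3 ^ t * ?J 1 2 3)) =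
      (\<Sum>\<beta>\<in>weak_compositions 4 b. \<Sum>\<gamma>\<in>weak_compositions 3 m.
        of_nat (multinomial b \<beta>) * of_nat (multinomial m \<gamma>) * (h 1 ^ (\<beta> ! 0) * ?J
             (1 + t + \<gamma> ! 1 + \<gamma> ! 2 + \<beta> ! 0)
             (2 + t + \<gamma> ! 0 + \<gamma> ! 2 + \<beta> ! 1 + 2 * \<beta> ! 3)
             (3 + t + \<gamma> ! 0 + \<gamma> ! 1 + 2 * \<beta> ! 2 + \<beta> ! 1)))" for m t
  proof -
    have "h 2 ^ b * (e2 ^ m * (e3 ^ t * ?J 1 2 3)) = e2 ^ m * (h 2 ^ b * ?J (1 + t) (2 + t) (3 + t))"
      by (subst e3_power) (simp_all add: mult.left_commute)
    also have "h 2 ^ b * ?J (1 + t) (2 + t) (3 + t) = multinomial_sum 4 b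
        (\<lambda>\<beta>. h 1 ^ (\<beta> ! 0) * ?J (1 + t + \<beta> ! 0) (2 + t + \<beta> ! 1 + 2 * \<beta> ! 3) (3 + t + \<beta> ! 1 + 2 * \<beta> ! 2))"
      by (rule h2_power) auto
    also have "e2 ^ m * \<dots> = (\<Sum>\<beta>\<in>weak_compositions 4 b. of_nat (multinomial b \<beta>) * (h 1 ^ (\<beta> ! 0) *
        (e2 ^ m * ?J (1 + t + \<beta> ! 0) (2 + t + \<beta> ! 1 + 2 * \<beta> ! 3) (3 + t + \<beta> ! 1 + 2 * \<beta> ! 2))))"
      by (simp add: multinomial_sum_def sum_distrib_left mult.left_commute)
    also have "\<dots> = (\<Sum>\<beta>\<in>weak_compositions 4 b. of_nat (multinomial b \<beta>) * (h 1 ^ (\<beta> ! 0) *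
        multinomial_sum 3 m (\<lambda>\<gamma>. ?J (1 + t + \<beta> ! 0 + \<gamma> ! 1 + \<gamma> ! 2)
          (2 + t + \<beta> ! 1 + 2 * \<beta> ! 3 + \<gamma> ! 0 + \<gamma> ! 2) (3 + t + \<beta> ! 1 + 2 * \<beta> ! 2 + \<gamma> ! 0 + \<gamma> ! 1))))"
      by (subst e2_power) auto
    finally show ?thesis
      by (simp add: multinomial_sum_def sum_distrib_left ac_simps)
  qed
  have "h 1 ^ a * h 2 ^ b * ?J 1 3 4 ^ c * ?J 1 3 5 ^ d =
      h 1 ^ a * h 2 ^ b * e2 ^ c * (e1 * e2 + - e3) ^ d * ?J 1 2 3"
    unfolding jacobi_trudi_special by simp
  also have "\<dots> = (\<Sum>d'\<in>{0..d}. (- 1) ^ (d - d') * of_nat (d choose d') *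
      (h 1 ^ (a + d') * (h 2 ^ b * (e2 ^ (c + d') * (e3 ^ (d - d') * ?J 1 2 3)))))"
    unfolding binomial_ring sum_distrib_left sum_distrib_right atMost_atLeast0
  proof (rule sum.cong[OF refl])
    fix k
    have "(- e3) ^ (d - k) = (- 1) ^ (d - k) * e3 ^ (d - k)" by (rule power_minus)
    then show "h 1 ^ a * h 2 ^ b * e2 ^ c * (of_nat (d choose k) * (e1 * e2) ^ k * (- e3) ^ (d - k)) * ?J 1 2 3 =
        (- 1) ^ (d - k) * of_nat (d choose k) *
      (h 1 ^ (a + k) * (h 2 ^ b * (e2 ^ (c + k) * (e3 ^ (d - k) * ?J 1 2 3))))"
      by (simp only: power_add power_mult_distrib h_small(1) mult_ac)
  qed
  also have "\<dots> = (\<Sum>d'\<in>{0..d}. \<Sum>\<beta>\<in>weak_compositions 4 b. \<Sum>\<gamma>\<in>weak_compositions 3 (c + d').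
       (- 1) ^ (d - d') * of_nat (d choose d') * of_nat (multinomial b \<beta>)
         * of_nat (multinomial (c + d') \<gamma>)
         * (h 1 ^ (a + d' + \<beta> ! 0) * ?J
             (1 + (d - d') + \<gamma> ! 1 + \<gamma> ! 2 + \<beta> ! 0)
             (2 + (d - d') + \<gamma> ! 0 + \<gamma> ! 2 + \<beta> ! 1 + 2 * \<beta> ! 3)
             (3 + (d - d') + \<gamma> ! 0 + \<gamma> ! 1 + 2 * \<beta> ! 2 + \<beta> ! 1)))"
    unfolding expand sum_distrib_left by (intro sum.cong refl) (simp only: power_add mult_ac)
  finally show ?thesis .
qed

end

section \<open>The recurrence for Chern forms\<close>

lemma det_2x2:
  fixes A :: "'a :: comm_ring_1 mat"
  assumes A: "A \<in> carrier_mat 2 2"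
  shows "det A = A $$ (0, 0) * A $$ (1, 1) - A $$ (0, 1) * A $$ (1, 0)"
proof -
  have "mat_delete A 0 j \<in> carrier_mat 1 1" for j using A by (auto simp: mat_delete_def)
  from det_single[OF this] show ?thesis
    using laplace_expansion_row[OF A, of 0] A
    by (simp add: numeral_2_eq_2 cofactor_def mat_delete_def)
qed

lemma det_3x3:
  fixes A :: "'a :: comm_ring_1 mat"
  assumes A: "A \<in> carrier_mat 3 3"
  shows "det A =
     A $$ (0, 0) * (A $$ (1, 1) * A $$ (2, 2) - A $$ (1, 2) * A $$ (2, 1))
   - A $$ (0, 1) * (A $$ (1, 0) * A $$ (2, 2) - A $$ (1, 2) * A $$ (2, 0))
   + A $$ (0, 2) * (A $$ (1, 0) * A $$ (2, 1) - A $$ (1, 1) * A $$ (2, 0))"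
proof -
  have "mat_delete A 0 j \<in> carrier_mat 2 2" for j using A by (auto simp: mat_delete_def)
  note d2 = det_2x2[OF this]
  have "det A = (\<Sum>j<3. A $$ (0, j) * cofactor A 0 j)" by (rule laplace_expansion_row[OF A]) simp
  also have "\<dots> = A $$ (0, 0) * cofactor A 0 0 + A $$ (0, 1) * cofactor A 0 1 + A $$ (0, 2) * cofactor A 0 2"
    by (simp add: eval_nat_numeral)
  finally show ?thesis
    unfolding cofactor_def d2 using A by (simp add: mat_delete_def numeral_2_eq_2 right_diff_distrib)
qed

definition vanishes_above :: "nat \<Rightarrow> 'a :: comm_ring_1 fps \<Rightarrow> bool" where
  "vanishes_above d f \<longleftrightarrow> (\<forall>k>d. fps_nth f k = 0)"

lemma vanishes_above_mult:
  assumes "vanishes_above d f" "vanishes_above e g"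
  shows "vanishes_above (d + e) (f * g)"
  unfolding vanishes_above_def
proof (intro allI impI)
  fix k assume "k > d + e"
  then have "i > d \<or> k - i > e" if "i \<le> k" for i using that by auto
  then show "fps_nth (f * g) k = 0"
    using assms unfolding fps_mult_nth vanishes_above_def
    by (intro sum.neutral) (metis atLeastAtMost_iff mult_zero_left mult_zero_right)
qed

lemma vanishes_above_prod:
  assumes "finite I" "\<And>i. i \<in> I \<Longrightarrow> vanishes_above 1 (f i)"
  shows "vanishes_above (card I) (\<Prod>i\<in>I. f i)"
  using assms
proof (induction I rule: finite_induct)
  case empty
  then show ?case by (simp add: vanishes_above_def)
next
  case (insert x F)
  then show ?case using vanishes_above_mult[of 1 "f x" "card F"] by simp
qed

text \<open>Every Leibniz term is a product of n entries of degree at most 1 in t.\<close>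

lemma vanishes_above_det_one_plus_X:
  fixes A :: "'a :: comm_ring_1 mat"
  assumes A: "A \<in> carrier_mat n n"
  shows "vanishes_above n (det (one_plus_X A))"
proof -
  have entry: "vanishes_above 1 (one_plus_X A $$ (i, j))" if "i < n" "j < n" for i j
    using that A by (auto simp: one_plus_X_def vanishes_above_def)
  have perm: "vanishes_above n (\<Prod>i = 0..<n. one_plus_X A $$ (i, p i))" if "p permutes {0..<n}" for p
    using vanishes_above_prod[of "{0..<n}" "\<lambda>i. one_plus_X A $$ (i, p i)"] entry permutes_in_image[OF that]
    by simp
  have dim: "dim_row (one_plus_X A) = n" "dim_col (one_plus_X A) = n"
    using one_plus_X_carrier[OF A] by auto
  have sgn: "of_int (sign p) * g = g \<or> of_int (sign p) * g = - g" for p :: "nat \<Rightarrow> nat" and g :: "'a fps"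
    by (simp add: sign_def)
  have "fps_nth (of_int (sign p) * (\<Prod>i = 0..<n. one_plus_X A $$ (i, p i))) k = 0"
    if "k > n" "p permutes {0..<n}" for k p
    using sgn[of p "\<Prod>i = 0..<n. one_plus_X A $$ (i, p i)"] perm[OF that(2)] that(1)
    by (auto simp: vanishes_above_def)
  then show ?thesis
    unfolding vanishes_above_def det_def dim if_P[OF refl] fps_sum_nth by (auto intro: sum.neutral)
qed

text \<open>Serves both products: for the 3 by 3 matrix YX the degree bound limits the recurrence to
  order 3, and for XY it makes the truncation of \<open>sigma\<close> above n consistent with that
  recurrence.\<close>

lemma form_det_one_plus:
  assumes M: "M \<in> carrier_mat n n"
    and hom: "\<And>i j. i < n \<Longrightarrow> j < n \<Longrightarrow> homogeneous 2 (M $$ (i, j))"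
  obtains U where "form U = form_det (1\<^sub>m n + M)" "half_degree_part 0 U = 1"
    "\<And>k. k > n \<Longrightarrow> half_degree_part k U = 0"
proof -
  define A where "A = map_mat Abs_eform M"
  have A: "A \<in> carrier_mat n n" using M by (simp add: A_def)
  have fA: "form (A $$ (i, j)) = M $$ (i, j)" if "i < n" "j < n" for i j
    using that M homogeneous_parity[OF hom[OF that]] by (simp add: A_def Abs_eform_inverse)
  have g: "grading (det (1\<^sub>m n + A)) = det (one_plus_X A)"
    by (rule det_map_grading[OF A]) (simp only: fA hom)
  have coeff: "half_degree_part k (det (1\<^sub>m n + A)) = fps_nth (det (one_plus_X A)) k" for k
    unfolding g[symmetric] by (simp add: grading_def)
  have "map_mat form (1\<^sub>m n + A) = 1\<^sub>m n + M"
    using A M fA by (intro eq_matI) auto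
  then have "form (det (1\<^sub>m n + A)) = form_det (1\<^sub>m n + M)"
    using form_det_map_form[of "1\<^sub>m n + A" n] A by simp
  moreover have "half_degree_part 0 (det (1\<^sub>m n + A)) = 1"
    unfolding coeff by (rule fps_nth_0_det_one_plus_X[OF A])
  moreover have "half_degree_part k (det (1\<^sub>m n + A)) = 0" if "k > n" for k
    using vanishes_above_det_one_plus_X[OF A] that unfolding coeff vanishes_above_def by blast
  ultimately show thesis using that by blast
qed

text \<open>det (1 + YX) is inverse to det (1 + XY) and has no part of half-degree above 3.
  Comparing parts of positive degree in their product gives the recurrence, also for k > n, where
  \<open>h k\<close> vanishes.\<close>

lemma chern_recurrence:
  assumes X: "X \<in> carrier_mat n 3" and Y: "Y \<in> carrier_mat 3 n"
    and X1: "\<And>i j. i < n \<Longrightarrow> j < 3 \<Longrightarrow> homogeneous 1 (X $$ (i, j))"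
    and Y1: "\<And>i j. i < 3 \<Longrightarrow> j < n \<Longrightarrow> homogeneous 1 (Y $$ (i, j))"
  obtains h :: "int \<Rightarrow> eform" and e1 e2 e3 where
    "\<And>k. form (h k) = (if 0 \<le> k \<and> k \<le> int n then degree_part (2 * nat k) (form_det (1\<^sub>m n + X * Y)) else 0)"
    "\<And>k. k > int n \<Longrightarrow> h k = 0"
    "h 0 = 1" "\<And>k. k < 0 \<Longrightarrow> h k = 0"
    "\<And>k. 0 < k \<Longrightarrow> h k = e1 * h (k - 1) - e2 * h (k - 2) + e3 * h (k - 3)"
proof -
  have XY1: "homogeneous 2 ((X * Y) $$ (i, j))" if "i < n" "j < n" for i j
    by (rule homogeneous_mat_mult_entry[OF X Y X1 Y1 that])
  have YX1: "homogeneous 2 ((Y * X) $$ (i, j))" if "i < 3" "j < 3" for i j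
    by (rule homogeneous_mat_mult_entry[OF Y X Y1 X1 that])
  obtain U where U: "form U = form_det (1\<^sub>m n + X * Y)" "half_degree_part 0 U = 1"
    "\<And>k. k > n \<Longrightarrow> half_degree_part k U = 0"
    using form_det_one_plus[OF mult_carrier_mat[OF X Y] XY1] by blast
  obtain V where V: "form V = form_det (1\<^sub>m 3 + Y * X)" "half_degree_part 0 V = 1"
    "\<And>k. k > 3 \<Longrightarrow> half_degree_part k V = 0"
    using form_det_one_plus[OF mult_carrier_mat[OF Y X] YX1] by blast
  have "form (V * U) = form 1"
    using form_det_odd_swap[OF Y X Y1 X1] by (simp add: U V form.hom_one)
  then have VU: "V * U = 1" by (simp only: form_inject)
  define h where "h k = (if 0 \<le> k then half_degree_part (nat k) U else 0)" for k :: int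
  define w where "w i = half_degree_part i V" for i
  have rec: "(\<Sum>i\<le>3. w i * h (k - int i)) = 0" if "0 < k" for k
  proof -
    let ?t = "\<lambda>i. w i * h (k - int i)"
    \<comment> \<open>The range is first extended and then cut off: \<open>w\<close> vanishes above
      3, and \<open>h\<close> vanishes at negative arguments.\<close>
    have "sum ?t {..3} = sum ?t {..3 + nat k}"
      by (rule sum.mono_neutral_left) (auto simp: w_def V)
    also have "\<dots> = sum ?t {..nat k}"
      by (rule sum.mono_neutral_right) (auto simp: h_def)
    also have "\<dots> = (\<Sum>i\<le>nat k. half_degree_part i V * half_degree_part (nat k - i) U)"
      using that by (intro sum.cong) (auto simp: w_def h_def nat_diff_distrib le_nat_iff)
    also have "\<dots> = half_degree_part (nat k) (V * U)" by (rule half_degree_part_times[symmetric])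
    also have "\<dots> = 0" unfolding VU using that by (simp add: half_degree_part_1)
    finally show ?thesis .
  qed
  show thesis
  \<comment> \<open>In terms of Chern roots, det (1 + YX) is the product of the factors 1 - x_i, so
    its parts of odd half-degree carry a minus sign.\<close>
  proof (rule that[of h "- w 1" "w 2" "- w 3"])
    fix k
    show "form (h k) = (if 0 \<le> k \<and> k \<le> int n then degree_part (2 * nat k) (form_det (1\<^sub>m n + X * Y)) else 0)"
      using U(3)[of "nat k"] by (auto simp: h_def form.hom_zero half_degree_part.rep_eq U(1)[symmetric]
          simp flip: half_degree_part.rep_eq)
  next
    fix k assume "0 < (k :: int)"
    from rec[OF this] have "w 0 * h k + w 1 * h (k - 1) + w 2 * h (k - 2) + w 3 * h (k - 3) = 0"
      by (simp add: eval_nat_numeral)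
    then show "h k = - w 1 * h (k - 1) - w 2 * h (k - 2) + - w 3 * h (k - 3)"
      using V(2) by (simp add: w_def algebra_simps add_eq_0_iff2)
  qed (use U in \<open>auto simp: h_def\<close>)
qed

text \<open>The entries come from even forms, so \<open>form_det\<close> becomes an ordinary
  determinant there. The homomorphism \<phi> is later the substitution at a point of the
  cell.\<close>

lemma form_det_jacobi_trudi:
  assumes phi: "ring_hom \<phi>" and s: "\<And>k. s k = \<phi> (form (h k))"
  shows "form_det (mat 3 3 (\<lambda>(a, r). s (int ([i, j, k] ! a) - int (r + 1)))) = \<phi> (form (jacobi_trudi h i j k))"
proof -
  let ?M = "mat 3 3 (\<lambda>(a, r). h (int ([i, j, k] ! a) - int (r + 1)))"
  have "mat 3 3 (\<lambda>(a, r). s (int ([i, j, k] ! a) - int (r + 1))) = map_mat \<phi> (map_mat form ?M)"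
    by (intro eq_matI) (auto simp: s)
  then have "form_det (mat 3 3 (\<lambda>(a, r). s (int ([i, j, k] ! a) - int (r + 1)))) = \<phi> (form (det ?M))"
    using form_det_hom[OF phi, of "map_mat form ?M" 3] form_det_map_form[of ?M 3] by simp
  also have "det ?M = jacobi_trudi h i j k"
    by (subst det_3x3) (simp_all add: jacobi_trudi_def numeral_2_eq_2 numeral_3_eq_3)
  finally show ?thesis .
qed

section \<open>Differentials of matrix products\<close>

text \<open>Differentiability along each coordinate line separately, which is the notion that
  \<open>partial_deriv\<close> refers to.\<close>

definition coord_differentiable :: "(nat \<Rightarrow> real) \<Rightarrow> ((nat \<Rightarrow> real) \<Rightarrow> complex) \<Rightarrow> bool" where
  "coord_differentiable x f \<longleftrightarrow> (\<forall>k. (\<lambda>t. f (x(k := t))) differentiable at (x k))"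

named_theorems coord_diff

lemma coord_diff_const [coord_diff]: "coord_differentiable x (\<lambda>y. c)"
  by (simp add: coord_differentiable_def)

lemma coord_diff_add [coord_diff]:
  "coord_differentiable x f \<Longrightarrow> coord_differentiable x g \<Longrightarrow> coord_differentiable x (\<lambda>y. f y + g y)"
  by (simp add: coord_differentiable_def)

lemma coord_diff_mult [coord_diff]:
  "coord_differentiable x f \<Longrightarrow> coord_differentiable x g \<Longrightarrow> coord_differentiable x (\<lambda>y. f y * g y)"
  by (simp add: coord_differentiable_def differentiable_mult)

lemma coord_diff_sum [coord_diff]:
  "(\<And>i. i \<in> I \<Longrightarrow> coord_differentiable x (f i)) \<Longrightarrow> coord_differentiable x (\<lambda>y. \<Sum>i\<in>I. f i y)"
  by (induction I rule: infinite_finite_induct) (auto intro: coord_diff)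

lemma coord_diff_prod [coord_diff]:
  "(\<And>i. i \<in> I \<Longrightarrow> coord_differentiable x (f i)) \<Longrightarrow> coord_differentiable x (\<lambda>y. \<Prod>i\<in>I. f i y)"
  by (induction I rule: infinite_finite_induct) (auto intro: coord_diff)

lemma coord_diff_inverse [coord_diff]:
  assumes "coord_differentiable x f" "f x \<noteq> 0"
  shows "coord_differentiable x (\<lambda>y. inverse (f y))"
  using assms unfolding coord_differentiable_def
  by (auto intro!: differentiable_inverse)

lemma coord_diff_det:
  assumes "\<And>y. A y \<in> carrier_mat n n"
    and "\<And>i j. i < n \<Longrightarrow> j < n \<Longrightarrow> coord_differentiable x (\<lambda>y. A y $$ (i, j))"
  shows "coord_differentiable x (\<lambda>y. det (A y))"
proof -
  have "det (A y) = (\<Sum>p | p permutes {0..<n}. of_int (sign p) * (\<Prod>i = 0..<n. A y $$ (i, p i)))" for y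
    using assms(1)[of y] by (simp add: det_def)
  moreover have "p i < n" if "p permutes {0..<n}" "i < n" for p i
    using permutes_in_image[OF that(1), of i] that(2) by simp
  ultimately show ?thesis using assms(2) by (auto intro!: coord_diff)
qed

lemma coord_diff_adj_mat:
  assumes A: "\<And>y. A y \<in> carrier_mat n n"
    and d: "\<And>i j. i < n \<Longrightarrow> j < n \<Longrightarrow> coord_differentiable x (\<lambda>y. A y $$ (i, j))"
    and ij: "i < n" "j < n"
  shows "coord_differentiable x (\<lambda>y. adj_mat (A y) $$ (i, j))"
proof -
  have "adj_mat (A y) $$ (i, j) = (- 1) ^ (j + i) * det (mat_delete (A y) j i)" for y
    using A[of y] ij by (simp add: adj_mat_def cofactor_def)
  moreover have "coord_differentiable x (\<lambda>y. det (mat_delete (A y) j i))"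
  proof (rule coord_diff_det)
    show "mat_delete (A y) j i \<in> carrier_mat (n - 1) (n - 1)" for y
      using A[of y] by (auto simp: mat_delete_def)
    show "coord_differentiable x (\<lambda>y. mat_delete (A y) j i $$ (r, s))" if "r < n - 1" "s < n - 1" for r s
    proof -
      have "mat_delete (A y) j i $$ (r, s) = A y $$ (if r < j then r else Suc r, if s < i then s else Suc s)" for y
        using A[of y] that by (simp add: mat_delete_def)
      then show ?thesis using d that by simp
    qed
  qed
  ultimately show ?thesis by (auto intro!: coord_diff)
qed

lemma partial_deriv_mult:
  "coord_differentiable x f \<Longrightarrow> coord_differentiable x g \<Longrightarrow>
    partial_deriv k (\<lambda>y. f y * g y) x = f x * partial_deriv k g x + partial_deriv k f x * g x"
  by (simp add: partial_deriv_def coord_differentiable_def)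

lemma partial_deriv_add:
  "coord_differentiable x f \<Longrightarrow> coord_differentiable x g \<Longrightarrow>
    partial_deriv k (\<lambda>y. f y + g y) x = partial_deriv k f x + partial_deriv k g x"
  by (simp add: partial_deriv_def coord_differentiable_def)

lemma differential_const: "differential m (\<lambda>y. c) x = 0"
  by (simp add: differential_def partial_deriv_def)

lemma differential_add:
  "coord_differentiable x f \<Longrightarrow> coord_differentiable x g \<Longrightarrow>
    differential m (\<lambda>y. f y + g y) x = differential m f x + differential m g x"
  by (simp add: differential_def partial_deriv_add const_form_add distrib_right sum.distrib)

lemma differential_mult:
  "coord_differentiable x f \<Longrightarrow> coord_differentiable x g \<Longrightarrow>
    differential m (\<lambda>y. f y * g y) x =
      differential m f x * const_form (g x) + const_form (f x) * differential m g x"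
  by (simp add: differential_def partial_deriv_mult const_form_add const_form_mult distrib_right
      sum.distrib const_form_commute[of _ "g x"] sum_distrib_left mult.assoc add.commute
      mult.left_commute[of "f x"])

lemma differential_sum:
  "(\<And>i. i \<in> I \<Longrightarrow> coord_differentiable x (f i)) \<Longrightarrow>
    differential m (\<lambda>y. \<Sum>i\<in>I. f i y) x = (\<Sum>i\<in>I. differential m (f i) x)"
  by (induction I rule: infinite_finite_induct)
    (simp_all add: differential_const differential_add coord_diff_sum)

lemma homogeneous_differential: "homogeneous 1 (differential m f x)"
  unfolding differential_def
  using homogeneous_times[OF homogeneous_const_form homogeneous_dx] by (auto intro!: homogeneous_sum)

lemma matrix_differential_carrier:
  "F x \<in> carrier_mat a b \<Longrightarrow> matrix_differential m F x \<in> carrier_mat a b"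
  by (auto simp: matrix_differential_def)

lemma matrix_differential_mult:
  assumes F: "\<And>y. F y \<in> carrier_mat a b" and H: "\<And>y. H y \<in> carrier_mat b c"
    and dF: "\<And>i j. i < a \<Longrightarrow> j < b \<Longrightarrow> coord_differentiable x (\<lambda>y. F y $$ (i, j))"
    and dH: "\<And>i j. i < b \<Longrightarrow> j < c \<Longrightarrow> coord_differentiable x (\<lambda>y. H y $$ (i, j))"
  shows "matrix_differential m (\<lambda>y. F y * H y) x =
    matrix_differential m F x * map_mat const_form (H x) + map_mat const_form (F x) * matrix_differential m H x"
    (is "?L = ?R")
proof (rule eq_matI)
  note cF = carrier_matD[OF F] and cH = carrier_matD[OF H]
  fix i j assume "i < dim_row ?R" "j < dim_col ?R"
  then have ij: "i < a" "j < c" using cF[of x] cH[of x] by (auto simp: matrix_differential_def)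
  have "(F y * H y) $$ (i, j) = (\<Sum>l<b. F y $$ (i, l) * H y $$ (l, j))" for y
    using ij cF[of y] cH[of y] by (simp add: scalar_prod_def atLeast0LessThan)
  then have "?L $$ (i, j) = differential m (\<lambda>y. \<Sum>l<b. F y $$ (i, l) * H y $$ (l, j)) x"
    using ij cF[of x] cH[of x] by (simp add: matrix_differential_def)
  also have "\<dots> = (\<Sum>l<b. differential m (\<lambda>y. F y $$ (i, l)) x * const_form (H x $$ (l, j))
      + const_form (F x $$ (i, l)) * differential m (\<lambda>y. H y $$ (l, j)) x)"
  proof -
    have "differential m (\<lambda>y. \<Sum>l<b. F y $$ (i, l) * H y $$ (l, j)) x =
        (\<Sum>l<b. differential m (\<lambda>y. F y $$ (i, l) * H y $$ (l, j)) x)"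
      by (rule differential_sum) (use ij dF dH in \<open>auto intro: coord_diff_mult\<close>)
    also have "\<dots> = (\<Sum>l<b. differential m (\<lambda>y. F y $$ (i, l)) x * const_form (H x $$ (l, j))
        + const_form (F x $$ (i, l)) * differential m (\<lambda>y. H y $$ (l, j)) x)"
      by (intro sum.cong refl differential_mult) (use ij dF dH in auto)
    finally show ?thesis .
  qed
  also have "\<dots> = ?R $$ (i, j)"
    using ij cF[of x] cH[of x]
    by (simp add: scalar_prod_def atLeast0LessThan matrix_differential_def sum.distrib)
  finally show "?L $$ (i, j) = ?R $$ (i, j)" .
qed (use carrier_matD[OF F[of x]] carrier_matD[OF H[of x]] in \<open>auto simp: matrix_differential_def\<close>)

lemma matrix_differential_const_minus:
  assumes C: "C \<in> carrier_mat a b" and F: "\<And>y. F y \<in> carrier_mat a b"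
    and dF: "\<And>i j. i < a \<Longrightarrow> j < b \<Longrightarrow> coord_differentiable x (\<lambda>y. F y $$ (i, j))"
  shows "matrix_differential m (\<lambda>y. C - F y) x = - matrix_differential m F x"
proof (rule eq_matI)
  note cF = carrier_matD[OF F]
  fix i j assume "i < dim_row (- matrix_differential m F x)" "j < dim_col (- matrix_differential m F x)"
  then have ij: "i < a" "j < b" using cF[of x] by (auto simp: matrix_differential_def)
  have "(C - F y) $$ (i, j) = C $$ (i, j) + (- 1) * F y $$ (i, j)" for y
    using ij C cF[of y] by simp
  moreover have "differential m (\<lambda>y. C $$ (i, j) + (- 1) * F y $$ (i, j)) x =
      const_form (- 1) * differential m (\<lambda>y. F y $$ (i, j)) x"
    unfolding differential_add[OF coord_diff_const coord_diff_mult[OF coord_diff_const dF[OF ij]]]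
      differential_mult[OF coord_diff_const dF[OF ij]] differential_const by simp
  moreover have "const_form (- 1) * \<beta> = - \<beta>" for \<beta>
    by (rule dform_eqI) (simp add: coeff_const_form_times uminus_dform.rep_eq)
  ultimately show "matrix_differential m (\<lambda>y. C - F y) x $$ (i, j) = (- matrix_differential m F x) $$ (i, j)"
    using ij C cF[of x] by (simp add: matrix_differential_def)
qed (use C carrier_matD[OF F[of x]] in \<open>auto simp: matrix_differential_def\<close>)

section \<open>The projection onto the quotient bundle over the big cell\<close>

text \<open>Since P G = 0 and S P = 0, the derivative of B drops out: P dP = - P dG B S and dP P = -
  G B dS P. In their product the signs cancel and B S G = 1 removes the middle. The matrices
  \<open>DG\<close>, \<open>DS\<close>, \<open>DB\<close>, \<open>DP\<close> stand for
  differentials, which enter through the Leibniz rule.\<close>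

lemma curvature_factorization:
  fixes P :: "'a :: ring_1 mat"
  assumes P: "P \<in> carrier_mat N N" and G: "G \<in> carrier_mat N k" and S: "S \<in> carrier_mat k N"
    and B: "B \<in> carrier_mat k k" and DG: "DG \<in> carrier_mat N k" and DS: "DS \<in> carrier_mat k N"
    and DB: "DB \<in> carrier_mat k k"
    and PG: "P * G = 0\<^sub>m N k" and SP: "S * P = 0\<^sub>m k N" and BSG: "B * (S * G) = 1\<^sub>m k"
    and DP: "DP = - (DG * (B * S) + G * (DB * S + B * DS))"
  shows "P * DP * DP * P = P * DG * B * (DS * P)"
proof -
  note c = P G S B DG DS DB
  have DPc: "DP \<in> carrier_mat N N" unfolding DP using c by auto
  define Q where "Q = DB * S + B * DS"
  have Q: "Q \<in> carrier_mat k N" using c by (auto simp: Q_def)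
  have BS: "B * S \<in> carrier_mat k N" using c by auto
  have BDSP: "B * (DS * P) \<in> carrier_mat k N" using c by auto
  have PDG: "P * DG \<in> carrier_mat N k" using c by auto
  have "P * DP = - (P * (DG * (B * S)) + P * (G * Q))"
    using c Q BS by (simp add: DP Q_def[symmetric] mult_add_distrib_mat[of _ N N _ N])
  also have "P * (G * Q) = 0\<^sub>m N N"
    using assoc_mult_mat[OF P G Q] PG Q by simp
  also have "P * (DG * (B * S)) + 0\<^sub>m N N = P * DG * (B * S)"
    using assoc_mult_mat[OF P DG BS] mult_carrier_mat[OF PDG BS] by simp
  finally have 1: "P * DP = - (P * DG * (B * S))" .
  have "B * S * P = 0\<^sub>m k N" using assoc_mult_mat[OF B S P] SP B by simp
  then have "DG * (B * S) * P = 0\<^sub>m N N" using assoc_mult_mat[OF DG BS P] DG by simp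
  moreover have "Q * P = B * (DS * P)"
  proof -
    have "Q * P = DB * S * P + B * DS * P"
      unfolding Q_def using c by (intro add_mult_distrib_mat) auto
    also have "DB * S * P = 0\<^sub>m k N" using assoc_mult_mat[OF DB S P] SP DB by simp
    also have "B * DS * P = B * (DS * P)" by (rule assoc_mult_mat[OF B DS P])
    finally show ?thesis using BDSP by simp
  qed
  moreover have "(DG * (B * S) + G * Q) * P = DG * (B * S) * P + G * Q * P"
    using c BS Q by (intro add_mult_distrib_mat) auto
  moreover have "G * Q * P = G * (Q * P)" by (rule assoc_mult_mat[OF G Q P])
  ultimately have "(DG * (B * S) + G * Q) * P = G * (B * (DS * P))"
    using mult_carrier_mat[OF G BDSP] by simp
  then have 2: "DP * P = - (G * (B * (DS * P)))"
    using c Q by (simp add: DP Q_def[symmetric])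
  have "P * DP * DP * P = (P * DP) * (DP * P)"
    using P DPc by (intro assoc_mult_mat) auto
  also have "\<dots> = P * DG * (B * S) * (G * (B * (DS * P)))"
    unfolding 1 2 using c PDG BS BDSP by simp
  also have "\<dots> = P * DG * (B * S * (G * (B * (DS * P))))"
    by (rule assoc_mult_mat[OF PDG BS mult_carrier_mat[OF G BDSP]])
  also have "B * S * (G * (B * (DS * P))) = B * S * G * (B * (DS * P))"
    by (rule assoc_mult_mat[OF BS G BDSP, symmetric])
  also have "B * S * G = 1\<^sub>m k" using assoc_mult_mat[OF B S G] BSG by simp
  also have "1\<^sub>m k * (B * (DS * P)) = B * (DS * P)" by (rule left_mult_one_mat[OF BDSP])
  also have "P * DG * (B * (DS * P)) = P * DG * B * (DS * P)"
    using c by (intro assoc_mult_mat[OF PDG B, symmetric]) auto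
  finally show ?thesis .
qed

lemma mat_kernel_graph_matrix: "mat_kernel (graph_matrix n y) = {0\<^sub>v 3}"
proof (intro equalityI subsetI)
  fix u assume "u \<in> mat_kernel (graph_matrix n y)"
  from mat_kernelD[OF graph_matrix_carrier this]
  have u: "u \<in> carrier_vec 3" and 0: "graph_matrix n y *\<^sub>v u = 0\<^sub>v (n + 3)" by auto
  have "u = 0\<^sub>v 3"
    using u 0 graph_matrix_mult_index[OF u, of _ n y] by (intro eq_vecI) auto
  then show "u \<in> {0\<^sub>v 3}" by simp
qed (use graph_matrix_carrier[of n y] in \<open>auto intro!: mat_kernelI[OF graph_matrix_carrier] eq_vecI\<close>)

section \<open>The Gram matrix of the graph and its inverse\<close>

definition gram :: "nat \<Rightarrow> (nat \<Rightarrow> real) \<Rightarrow> complex mat" where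
  "gram n y = mat_adjoint (graph_matrix n y) * graph_matrix n y"

text \<open>Cramer's form of the inverse, so that differentiability of its entries reduces to that
  of determinants and of the reciprocal of a nonzero determinant.\<close>

definition gram_inverse :: "nat \<Rightarrow> (nat \<Rightarrow> real) \<Rightarrow> complex mat" where
  "gram_inverse n y = inverse (det (gram n y)) \<cdot>\<^sub>m adj_mat (gram n y)"

lemmas adjoint_graph_matrix_carrier = mat_adjoint_carrier[OF graph_matrix_carrier]

lemma gram_carrier: "gram n y \<in> carrier_mat 3 3"
  using mult_carrier_mat[OF adjoint_graph_matrix_carrier graph_matrix_carrier] by (simp add: gram_def)

lemma gram_inverse_carrier: "gram_inverse n y \<in> carrier_mat 3 3"
  using adj_mat(1)[OF gram_carrier] by (simp add: gram_inverse_def)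

lemma det_gram_nonzero: "det (gram n y) \<noteq> 0"
proof -
  have "mat_kernel (gram n y) = {0\<^sub>v 3}"
    unfolding gram_def mat_kernel_adjoint_mult[OF graph_matrix_carrier] by (rule mat_kernel_graph_matrix)
  from inverse_if_kernel_trivial[OF gram_carrier this] obtain B
    where B: "B \<in> carrier_mat 3 3" "B * gram n y = 1\<^sub>m 3" by metis
  then show ?thesis using det_mult[OF B(1) gram_carrier, of n y] by auto
qed

lemma gram_inverse_left: "gram_inverse n y * gram n y = 1\<^sub>m 3"
  and gram_inverse_right: "gram n y * gram_inverse n y = 1\<^sub>m 3"
proof -
  have one: "inverse (det (gram n y)) \<cdot>\<^sub>m (det (gram n y) \<cdot>\<^sub>m 1\<^sub>m 3) = 1\<^sub>m 3"
    using det_gram_nonzero[of n y] by (intro eq_matI) auto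
  show "gram_inverse n y * gram n y = 1\<^sub>m 3"
    unfolding gram_inverse_def mult_smult_assoc_mat[OF adj_mat(1)[OF gram_carrier] gram_carrier]
      adj_mat(3)[OF gram_carrier] by (rule one)
  show "gram n y * gram_inverse n y = 1\<^sub>m 3"
    unfolding gram_inverse_def mult_smult_distrib[OF gram_carrier adj_mat(1)[OF gram_carrier]]
      adj_mat(2)[OF gram_carrier] by (rule one)
qed

lemma quotient_projection_graph_space:
  "quotient_projection (n + 3) (graph_space n y) =
    1\<^sub>m (n + 3) - graph_matrix n y * (gram_inverse n y * mat_adjoint (graph_matrix n y))"
  unfolding graph_space_def
  by (rule quotient_projection_eq[OF graph_matrix_carrier gram_inverse_carrier])
    (use gram_inverse_left in \<open>simp add: gram_def\<close>)

lemma coord_diff_coordinate: "coord_differentiable x (\<lambda>y. complex_of_real (y a))"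
  unfolding coord_differentiable_def
proof
  fix k
  show "(\<lambda>t. complex_of_real ((x(k := t)) a)) differentiable at (x k)"
  proof (cases "a = k")
    case True
    have "(complex_of_real has_vector_derivative 1) (at (x k))"
      using has_vector_derivative_of_real[OF DERIV_ident] by simp
    then show ?thesis using True by (auto intro: differentiableI_vector)
  qed simp
qed

lemma coord_diff_graph_matrix:
  assumes "i < n + 3" "j < 3"
  shows "coord_differentiable x (\<lambda>y. graph_matrix n y $$ (i, j))"
    "coord_differentiable x (\<lambda>y. mat_adjoint (graph_matrix n y) $$ (j, i))"
proof -
  have entry: "graph_matrix n y $$ (i, j) = (if i < 3 then (if i = j then 1 else 0)
     else complex_of_real (y (2 * (3 * (i - 3) + j))) + \<i> * complex_of_real (y (2 * (3 * (i - 3) + j) + 1)))" for y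
    using assms by (simp add: graph_matrix_def Complex_eq)
  have adj: "mat_adjoint (graph_matrix n y) $$ (j, i) = (if i < 3 then (if i = j then 1 else 0)
     else complex_of_real (y (2 * (3 * (i - 3) + j))) + (- \<i>) * complex_of_real (y (2 * (3 * (i - 3) + j) + 1)))" for y
    using assms carrier_matD[OF graph_matrix_carrier[of n y]] by (simp add: mat_adjoint_index entry)
  show "coord_differentiable x (\<lambda>y. graph_matrix n y $$ (i, j))"
    "coord_differentiable x (\<lambda>y. mat_adjoint (graph_matrix n y) $$ (j, i))"
    unfolding entry adj by (cases "i < 3"; simp only: if_True if_False; intro coord_diff coord_diff_coordinate)+
qed

text \<open>The top block of the graph matrix is the constant identity. This removes three of the n
  + 3 columns of dS.\<close>

lemma differential_adjoint_graph_matrix_left: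
  assumes "i < 3" "j < 3"
  shows "differential m (\<lambda>y. mat_adjoint (graph_matrix n y) $$ (j, i)) x = 0"
proof -
  have "mat_adjoint (graph_matrix n y) $$ (j, i) = (if i = j then 1 else 0)" for y
    using assms carrier_matD[OF graph_matrix_carrier[of n y]]
    by (simp add: mat_adjoint_index) (simp add: graph_matrix_def)
  then show ?thesis by (simp add: differential_const)
qed

lemma coord_diff_gram_inverse:
  assumes "i < 3" "j < 3"
  shows "coord_differentiable x (\<lambda>y. gram_inverse n y $$ (i, j))"
proof -
  have gram: "coord_differentiable x (\<lambda>y. gram n y $$ (r, s))" if "r < 3" "s < 3" for r s
  proof -
    have "gram n y $$ (r, s) = (\<Sum>l<n + 3. mat_adjoint (graph_matrix n y) $$ (r, l) * graph_matrix n y $$ (l, s))" for y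
      using that carrier_matD[OF graph_matrix_carrier[of n y]] carrier_matD[OF adjoint_graph_matrix_carrier[of n y]]
      by (simp add: gram_def scalar_prod_def atLeast0LessThan)
    then show ?thesis
      using that by (auto intro!: coord_diff coord_diff_graph_matrix)
  qed
  have "gram_inverse n y $$ (i, j) = inverse (det (gram n y)) * adj_mat (gram n y) $$ (i, j)" for y
    using assms adj_mat(1)[OF gram_carrier[of n y]] by (simp add: gram_inverse_def)
  moreover have "coord_differentiable x (\<lambda>y. inverse (det (gram n y)) * adj_mat (gram n y) $$ (i, j))"
    by (intro coord_diff_mult coord_diff_inverse coord_diff_det coord_diff_adj_mat gram det_gram_nonzero)
      (use assms in \<open>simp_all add: gram_carrier\<close>)
  ultimately show ?thesis by simp
qed

section \<open>Chern forms as pullbacks of universal forms\<close>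

text \<open>
  The generators with even and odd index stand for independent one-forms dz_ij and d(conj z_ij); they
  are substituted by the entries of X = (i / 2 pi) P dG B and of dS, so no reality condition relates them.
\<close>

definition universal_X :: "nat \<Rightarrow> dform mat" where
  "universal_X n = mat n 3 (\<lambda>(i, j). dx (2 * (3 * i + j)))"

definition universal_Y :: "nat \<Rightarrow> dform mat" where
  "universal_Y n = mat 3 n (\<lambda>(j, i). dx (2 * (3 * i + j) + 1))"

lemma universal_carrier: "universal_X n \<in> carrier_mat n 3" "universal_Y n \<in> carrier_mat 3 n"
  by (simp_all add: universal_X_def universal_Y_def)

lemma homogeneous_universal:
  "i < n \<Longrightarrow> j < 3 \<Longrightarrow> homogeneous 1 (universal_X n $$ (i, j))"
  "j < 3 \<Longrightarrow> i < n \<Longrightarrow> homogeneous 1 (universal_Y n $$ (j, i))"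
  using homogeneous_dx by (simp_all add: universal_X_def universal_Y_def)

lemma homogeneous_const_form_times: "homogeneous k \<beta> \<Longrightarrow> homogeneous k (const_form c * \<beta>)"
  using homogeneous_times[OF homogeneous_const_form, of k \<beta> c] by simp

lemma homogeneous_times_const_form: "homogeneous k \<beta> \<Longrightarrow> homogeneous k (\<beta> * const_form c)"
  using homogeneous_const_form_times by (simp only: const_form_commute[of \<beta>])

lemma projection_graph_products:
  fixes G S B :: "complex mat"
  assumes G: "G \<in> carrier_mat N k" and S: "S \<in> carrier_mat k N" and B: "B \<in> carrier_mat k k"
    and BSG: "B * (S * G) = 1\<^sub>m k" and SGB: "S * G * B = 1\<^sub>m k"
  shows "(1\<^sub>m N - G * (B * S)) * G = 0\<^sub>m N k" "S * (1\<^sub>m N - G * (B * S)) = 0\<^sub>m k N"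
proof -
  have BS: "B * S \<in> carrier_mat k N" using B S by simp
  have GBS: "G * (B * S) \<in> carrier_mat N N" using G BS by simp
  have "G * (B * S) * G = G * (B * (S * G))"
    using assoc_mult_mat[OF G BS G] assoc_mult_mat[OF B S G] by simp
  also have "\<dots> = G" using BSG G by simp
  finally have 1: "G * (B * S) * G = G" .
  have "(1\<^sub>m N - G * (B * S)) * G = 1\<^sub>m N * G - G * (B * S) * G"
    by (rule minus_mult_distrib_mat[OF one_carrier_mat GBS G])
  then show "(1\<^sub>m N - G * (B * S)) * G = 0\<^sub>m N k" using 1 G by simp
  have SG: "S * G \<in> carrier_mat k k" using S G by simp
  have "S * (G * (B * S)) = S * G * B * S"
    using assoc_mult_mat[OF S G BS] assoc_mult_mat[OF SG B S] by simp
  also have "\<dots> = S" using SGB S by simp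
  finally have 2: "S * (G * (B * S)) = S" .
  have "S * (1\<^sub>m N - G * (B * S)) = S * 1\<^sub>m N - S * (G * (B * S))"
    by (rule mult_minus_distrib_mat[OF S one_carrier_mat GBS])
  then show "S * (1\<^sub>m N - G * (B * S)) = 0\<^sub>m k N" using 2 S by simp
qed

lemma mult_smult_const_form:
  assumes "A \<in> carrier_mat l m" "B \<in> carrier_mat m n"
  shows "A * (const_form c \<cdot>\<^sub>m B) = const_form c \<cdot>\<^sub>m (A * B)"
    "(const_form c \<cdot>\<^sub>m A) * B = const_form c \<cdot>\<^sub>m (A * B)"
proof -
  have "\<beta> * (const_form c * \<gamma>) = const_form c * (\<beta> * \<gamma>)" for \<beta> \<gamma>
    by (metis const_form_commute mult.assoc)
  then show "A * (const_form c \<cdot>\<^sub>m B) = const_form c \<cdot>\<^sub>m (A * B)"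
    "(const_form c \<cdot>\<^sub>m A) * B = const_form c \<cdot>\<^sub>m (A * B)"
    using assms by (auto simp: scalar_prod_def sum_distrib_left mult.assoc intro!: eq_matI sum.cong)
qed

text \<open>The identities between P, G, S and B over the complex numbers are carried to constant
  forms by \<open>const_form\<close>, where the algebraic factorization applies. Idempotence is
  recorded because P is later absorbed into X.\<close>

lemma curvature_quotient_projection:
  fixes m n :: nat and x :: "nat \<Rightarrow> real"
  defines "Pf \<equiv> \<lambda>y. quotient_projection (n + 3) (graph_space n y)"
  defines "cP \<equiv> map_mat const_form (Pf x)"
  defines "DG \<equiv> matrix_differential m (graph_matrix n) x"
  defines "DS \<equiv> matrix_differential m (\<lambda>y. mat_adjoint (graph_matrix n y)) x"
  defines "cB \<equiv> map_mat const_form (gram_inverse n x)"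
  shows "cP \<in> carrier_mat (n + 3) (n + 3)" "cP * cP = cP"
    "curvature m Pf x = cP * DG * cB * (DS * cP)"
proof -
  interpret cf: semiring_hom const_form by (rule const_form_hom)
  let ?N = "n + 3"
  let ?G = "graph_matrix n" and ?S = "\<lambda>y. mat_adjoint (graph_matrix n y)" and ?B = "gram_inverse n"
  note G = graph_matrix_carrier[of n] and S = adjoint_graph_matrix_carrier[of n] and B = gram_inverse_carrier[of n]
  have Pf: "Pf = (\<lambda>y. 1\<^sub>m ?N - ?G y * (?B y * ?S y))"
    by (simp add: Pf_def quotient_projection_graph_space)
  have BSG: "?B y * (?S y * ?G y) = 1\<^sub>m 3" for y
    using gram_inverse_left[of n y] by (simp add: gram_def)
  have SGB: "?S y * ?G y * ?B y = 1\<^sub>m 3" for y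
    using gram_inverse_right[of n y] by (simp add: gram_def)
  have P: "Pf x \<in> carrier_mat ?N ?N" and PP: "Pf x * Pf x = Pf x"
    using orthogonal_projection(1,2)[OF G[of x] B[of x] BSG[of x]] by (simp_all add: Pf)
  have PG: "Pf x * ?G x = 0\<^sub>m ?N 3" and SP: "?S x * Pf x = 0\<^sub>m 3 ?N"
    using projection_graph_products[OF G[of x] S[of x] B[of x] BSG[of x] SGB[of x]] by (simp_all add: Pf)
  show cP: "cP \<in> carrier_mat ?N ?N" using P by (simp add: cP_def)
  show "cP * cP = cP" unfolding cP_def cf.mat_hom_mult[OF P P, symmetric] PP ..
  define DB where "DB = matrix_differential m ?B x"
  define DP where "DP = matrix_differential m Pf x"
  define cG where "cG = map_mat const_form (?G x)"
  define cS where "cS = map_mat const_form (?S x)"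
  have BS: "?B y * ?S y \<in> carrier_mat 3 ?N" for y using B S by (rule mult_carrier_mat)
  have zero: "map_mat const_form (0\<^sub>m a b) = 0\<^sub>m a b" for a b by (intro eq_matI) auto
  have dG: "coord_differentiable x (\<lambda>y. ?G y $$ (i, j))" if "i < ?N" "j < 3" for i j
    by (rule coord_diff_graph_matrix(1)[OF that])
  have dS: "coord_differentiable x (\<lambda>y. ?S y $$ (i, j))" if "i < 3" "j < ?N" for i j
    by (rule coord_diff_graph_matrix(2)[OF that(2,1)])
  have dB: "coord_differentiable x (\<lambda>y. ?B y $$ (i, j))" if "i < 3" "j < 3" for i j
    by (rule coord_diff_gram_inverse[OF that])
  have dBS: "coord_differentiable x (\<lambda>y. (?B y * ?S y) $$ (i, j))" if "i < 3" "j < ?N" for i j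
  proof -
    have "(?B y * ?S y) $$ (i, j) = (\<Sum>l<3. ?B y $$ (i, l) * ?S y $$ (l, j))" for y
      using that carrier_matD[OF B[of y]] carrier_matD[OF S[of y]] by (simp add: scalar_prod_def atLeast0LessThan)
    moreover have "coord_differentiable x (\<lambda>y. \<Sum>l<3. ?B y $$ (i, l) * ?S y $$ (l, j))"
      by (intro coord_diff_sum coord_diff_mult dB dS that) auto
    ultimately show ?thesis by simp
  qed
  have dGBS: "coord_differentiable x (\<lambda>y. (?G y * (?B y * ?S y)) $$ (i, j))" if "i < ?N" "j < ?N" for i j
  proof -
    have "(?G y * (?B y * ?S y)) $$ (i, j) = (\<Sum>l<3. ?G y $$ (i, l) * (?B y * ?S y) $$ (l, j))" for y
      using that carrier_matD[OF G[of y]] carrier_matD[OF BS[of y]]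
      by (simp add: scalar_prod_def atLeast0LessThan del: index_mult_mat(1)) (simp add: scalar_prod_def atLeast0LessThan)
    moreover have "coord_differentiable x (\<lambda>y. \<Sum>l<3. ?G y $$ (i, l) * (?B y * ?S y) $$ (l, j))"
      by (intro coord_diff_sum coord_diff_mult dG dBS that) auto
    ultimately show ?thesis by simp
  qed
  have "DP = - matrix_differential m (\<lambda>y. ?G y * (?B y * ?S y)) x"
    unfolding DP_def Pf
    by (rule matrix_differential_const_minus[OF one_carrier_mat mult_carrier_mat[OF G BS] dGBS])
  also have "matrix_differential m (\<lambda>y. ?G y * (?B y * ?S y)) x =
      DG * map_mat const_form (?B x * ?S x) + cG * matrix_differential m (\<lambda>y. ?B y * ?S y) x"
    unfolding DG_def cG_def by (rule matrix_differential_mult[OF G BS dG dBS])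
  also have "matrix_differential m (\<lambda>y. ?B y * ?S y) x = DB * cS + cB * DS"
    unfolding DB_def cS_def cB_def DS_def by (rule matrix_differential_mult[OF B S dB dS])
  also have "map_mat const_form (?B x * ?S x) = cB * cS"
    unfolding cB_def cS_def by (rule cf.mat_hom_mult[OF B S])
  finally have DP: "DP = - (DG * (cB * cS) + cG * (DB * cS + cB * DS))" .
  have "cP * DP * DP * cP = cP * DG * cB * (DS * cP)"
  proof (rule curvature_factorization[OF cP _ _ _ _ _ _ _ _ _ DP])
    show "cG \<in> carrier_mat ?N 3" "cS \<in> carrier_mat 3 ?N" "cB \<in> carrier_mat 3 3"
      using G S B by (simp_all add: cG_def cS_def cB_def)
    show "DG \<in> carrier_mat ?N 3" "DS \<in> carrier_mat 3 ?N" "DB \<in> carrier_mat 3 3"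
      unfolding DG_def DS_def DB_def by (intro matrix_differential_carrier G S B)+
    show "cP * cG = 0\<^sub>m ?N 3"
      unfolding cP_def cG_def cf.mat_hom_mult[OF P G, symmetric] PG by (rule zero)
    show "cS * cP = 0\<^sub>m 3 ?N"
      unfolding cP_def cS_def cf.mat_hom_mult[OF S P, symmetric] SP by (rule zero)
    show "cB * (cS * cG) = 1\<^sub>m 3"
      unfolding cB_def cS_def cG_def cf.mat_hom_mult[OF S G, symmetric]
        cf.mat_hom_mult[OF B mult_carrier_mat[OF S G], symmetric] BSG by (rule cf.mat_hom_one)
  qed
  then show "curvature m Pf x = cP * DG * cB * (DS * cP)"
    by (simp only: curvature_def cP_def DP_def)
qed

text \<open>The (n + 3) by (n + 3) matrix XY is not itself the image of the universal n by n matrix.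
  The two determinants are compared through their inverses, the 3 by 3 determinants of 1 + YX, whose
  entries do correspond under the substitution.\<close>

lemma sigma_eq_pullback:
  obtains v where "\<And>s. homogeneous 1 (v s)"
    "\<And>i. sigma n i x = pullback (6 * n) v (if 0 \<le> i \<and> i \<le> int n
       then degree_part (2 * nat i) (form_det (1\<^sub>m n + universal_X n * universal_Y n)) else 0)"
proof -
  define m where "m = 6 * n"
  let ?N = "n + 3"
  define c where "c = (\<i> / (2 * of_real pi) :: complex)"
  define Pf where "Pf = (\<lambda>y. quotient_projection ?N (graph_space n y))"
  define cP where "cP = map_mat const_form (Pf x)"
  define DG where "DG = matrix_differential m (graph_matrix n) x"
  define DS where "DS = matrix_differential m (\<lambda>y. mat_adjoint (graph_matrix n y)) x"
  define cB where "cB = map_mat const_form (gram_inverse n x)"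
  have curv: "cP \<in> carrier_mat ?N ?N" "cP * cP = cP" "curvature m Pf x = cP * DG * cB * (DS * cP)"
    unfolding cP_def DG_def DS_def cB_def Pf_def by (rule curvature_quotient_projection)+
  have Pf: "Pf x \<in> carrier_mat ?N ?N" using curv(1) by (simp add: cP_def)
  have DG: "DG \<in> carrier_mat ?N 3" unfolding DG_def by (intro matrix_differential_carrier graph_matrix_carrier)
  have DS: "DS \<in> carrier_mat 3 ?N" unfolding DS_def by (intro matrix_differential_carrier adjoint_graph_matrix_carrier)
  have cB: "cB \<in> carrier_mat 3 3" unfolding cB_def using gram_inverse_carrier by simp
  have PDG: "cP * DG \<in> carrier_mat ?N 3" using curv(1) DG by (rule mult_carrier_mat)
  have PDGB: "cP * DG * cB \<in> carrier_mat ?N 3" using PDG cB by (rule mult_carrier_mat)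
  \<comment> \<open>The Chern-Weil factor i / (2 pi) is put into X, so that the total Chern form is
    det (1 + XY).\<close>
  define X where "X = const_form c \<cdot>\<^sub>m (cP * DG * cB)"
  define Y where "Y = DS * cP"
  have X: "X \<in> carrier_mat ?N 3" using PDGB by (simp add: X_def)
  have Y: "Y \<in> carrier_mat 3 ?N" unfolding Y_def using DS curv(1) by (rule mult_carrier_mat)
  have DG1: "homogeneous 1 (DG $$ (i, j))" if "i < ?N" "j < 3" for i j
    using that carrier_matD[OF graph_matrix_carrier[of n x]] homogeneous_differential by (simp add: DG_def matrix_differential_def)
  have DS1: "homogeneous 1 (DS $$ (i, j))" if "i < 3" "j < ?N" for i j
    using that carrier_matD[OF adjoint_graph_matrix_carrier[of n x]] homogeneous_differential by (simp add: DS_def matrix_differential_def)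
  have PDG1: "homogeneous 1 ((cP * DG) $$ (i, j))" if "i < ?N" "j < 3" for i j
  proof -
    have "(cP * DG) $$ (i, j) = (\<Sum>l<?N. const_form (Pf x $$ (i, l)) * DG $$ (l, j))"
      using that Pf DG by (simp add: cP_def scalar_prod_def atLeast0LessThan)
    then show ?thesis by (simp only:) (intro homogeneous_sum homogeneous_const_form_times DG1, use that in auto)
  qed
  have X1: "homogeneous 1 (X $$ (i, j))" if "i < ?N" "j < 3" for i j
  proof -
    have "X $$ (i, j) = const_form c * (\<Sum>l<3. (cP * DG) $$ (i, l) * const_form (gram_inverse n x $$ (l, j)))"
      using that carrier_matD[OF PDG] carrier_matD[OF cB] unfolding X_def
      by (simp add: cB_def scalar_prod_def atLeast0LessThan del: index_mult_mat(1)) (simp add: scalar_prod_def atLeast0LessThan)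
    then show ?thesis
      by (simp only:) (intro homogeneous_const_form_times homogeneous_sum homogeneous_times_const_form PDG1, use that in auto)
  qed
  have Y1: "homogeneous 1 (Y $$ (i, j))" if "i < 3" "j < ?N" for i j
  proof -
    have "Y $$ (i, j) = (\<Sum>l<?N. DS $$ (i, l) * const_form (Pf x $$ (l, j)))"
      using that Pf DS by (simp add: Y_def cP_def scalar_prod_def atLeast0LessThan)
    then show ?thesis by (simp only:) (intro homogeneous_sum homogeneous_times_const_form DS1, use that in auto)
  qed
  \<comment> \<open>Decodes s as 2 (3 i + j) or 2 (3 i + j) + 1. Row i + 3 of X and column i + 3 of
    dS skip the identity block of the graph matrix.\<close>
  define v where "v s = (if s < m then (let i = s div 2 div 3; j = s div 2 mod 3
      in if even s then X $$ (i + 3, j) else DS $$ (j, i + 3)) else 0)" for s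
  have v1: "homogeneous 1 (v s)" for s
    using X1[unfolded One_nat_def] DS1[unfolded One_nat_def] by (auto simp: v_def Let_def m_def)
  have vX: "v (2 * (3 * i + j)) = X $$ (i + 3, j)" and vY: "v (2 * (3 * i + j) + 1) = DS $$ (j, i + 3)"
    and lt: "2 * (3 * i + j) + 1 < m" if "i < n" "j < 3" for i j
  proof -
    show "2 * (3 * i + j) + 1 < m" using that by (simp add: m_def)
    then show "v (2 * (3 * i + j)) = X $$ (i + 3, j)" "v (2 * (3 * i + j) + 1) = DS $$ (j, i + 3)"
      using that by (auto simp: v_def Let_def)
  qed
  let ?h = "pullback m v" and ?UX = "universal_X n" and ?UY = "universal_Y n"
  interpret h: ring_hom ?h by (rule pullback_hom[OF v1])
  note UX = universal_carrier(1)[of n] and UY = universal_carrier(2)[of n]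
  have map_UYX: "map_mat ?h (1\<^sub>m 3 + ?UY * ?UX) = 1\<^sub>m 3 + Y * X"
  proof (rule eq_matI)
    fix j l assume "j < dim_row (1\<^sub>m 3 + Y * X)" "l < dim_col (1\<^sub>m 3 + Y * X)"
    then have jl: "j < 3" "l < 3" using X Y by auto
    \<comment> \<open>The projection in Y is absorbed by P X = X. What remains is dS, whose first
      three columns vanish.\<close>
    have "Y * X = DS * X"
    proof -
      have "cP * X = X"
      proof -
        have "cP * X = const_form c \<cdot>\<^sub>m (cP * (cP * DG * cB))"
          unfolding X_def by (rule mult_smult_const_form(1)[OF curv(1) PDGB])
        also have "cP * (cP * DG * cB) = cP * DG * cB"
          using assoc_mult_mat[OF curv(1) PDG cB] assoc_mult_mat[OF curv(1) curv(1) DG] curv(2) by simp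
        finally show ?thesis by (simp add: X_def)
      qed
      then show ?thesis unfolding Y_def using assoc_mult_mat[OF DS curv(1) X] by simp
    qed
    then have "(Y * X) $$ (j, l) = (\<Sum>i<?N. DS $$ (j, i) * X $$ (i, l))"
      using jl X DS by (simp add: scalar_prod_def atLeast0LessThan)
    also have "\<dots> = (\<Sum>i\<in>{3..<n + 3}. DS $$ (j, i) * X $$ (i, l))"
    proof (rule sum.mono_neutral_right)
      show "\<forall>i\<in>{..<?N} - {3..<n + 3}. DS $$ (j, i) * X $$ (i, l) = 0"
      proof
        fix i assume "i \<in> {..<?N} - {3..<n + 3}"
        then have "i < 3" by auto
        then have "DS $$ (j, i) = 0"
          using jl differential_adjoint_graph_matrix_left[of i j] carrier_matD[OF adjoint_graph_matrix_carrier[of n x]]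
          by (simp add: DS_def matrix_differential_def)
        then show "DS $$ (j, i) * X $$ (i, l) = 0" by simp
      qed
    qed auto
    also have "\<dots> = (\<Sum>i<n. DS $$ (j, i + 3) * X $$ (i + 3, l))"
      using sum.shift_bounds_nat_ivl[of "\<lambda>i. DS $$ (j, i) * X $$ (i, l)" 0 3 n]
      by (simp add: atLeast0LessThan)
    also have "\<dots> = (\<Sum>i<n. ?h (?UY $$ (j, i)) * ?h (?UX $$ (i, l)))"
    proof (rule sum.cong[OF refl])
      fix i assume "i \<in> {..<n}"
      then have i: "i < n" by simp
      show "DS $$ (j, i + 3) * X $$ (i + 3, l) = ?h (?UY $$ (j, i)) * ?h (?UX $$ (i, l))"
        using i jl lt[OF i jl(1)] lt[OF i jl(2)] vX[OF i jl(2)] vY[OF i jl(1)]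
        by (simp add: universal_X_def universal_Y_def pullback_dx)
    qed
    also have "\<dots> = ?h ((?UY * ?UX) $$ (j, l))"
      using jl UX UY by (simp add: scalar_prod_def atLeast0LessThan h.hom_sum h.hom_mult)
    finally have "(Y * X) $$ (j, l) = ?h ((?UY * ?UX) $$ (j, l))" .
    then show "map_mat ?h (1\<^sub>m 3 + ?UY * ?UX) $$ (j, l) = (1\<^sub>m 3 + Y * X) $$ (j, l)"
      using jl X Y UX UY carrier_matD[OF mult_carrier_mat[OF UY UX]] carrier_matD[OF mult_carrier_mat[OF Y X]]
      by (simp add: h.hom_add h.hom_one h.hom_zero del: index_mult_mat(1))
  qed (use X Y UX UY in auto)
  have total: "total_chern_form m Pf x = form_det (1\<^sub>m ?N + X * Y)"
  proof -
    have "const_form c \<cdot>\<^sub>m curvature m Pf x = X * Y"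
      unfolding curv(3) X_def Y_def[symmetric]
      by (rule mult_smult_const_form(2)[OF PDGB Y, symmetric])
    moreover have "dim_row (Pf x) = ?N" using Pf by simp
    ultimately show ?thesis by (simp add: total_chern_form_def c_def)
  qed
  have "form_det (1\<^sub>m ?N + X * Y) = ?h (form_det (1\<^sub>m n + ?UX * ?UY))"
  proof -
    let ?U = "form_det (1\<^sub>m n + ?UX * ?UY)" and ?V = "form_det (1\<^sub>m 3 + ?UY * ?UX)"
    have 1: "form_det (1\<^sub>m 3 + Y * X) = ?h ?V"
      unfolding map_UYX[symmetric] by (rule form_det_hom[OF pullback_hom[OF v1]]) (use UX UY in auto)
    have 2: "?V * ?U = 1" by (rule form_det_odd_swap[OF UY UX homogeneous_universal(2) homogeneous_universal(1)])
    have 3: "form_det (1\<^sub>m ?N + X * Y) * ?h ?V = 1"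
      using form_det_odd_swap[OF X Y X1 Y1] 1 by simp
    \<comment> \<open>Both determinants are inverse to the same element \<open>?h ?V\<close>, hence
      equal.\<close>
    have "form_det (1\<^sub>m ?N + X * Y) = form_det (1\<^sub>m ?N + X * Y) * ?h (?V * ?U)"
      by (simp add: 2 h.hom_one)
    also have "\<dots> = form_det (1\<^sub>m ?N + X * Y) * ?h ?V * ?h ?U" by (simp add: h.hom_mult mult.assoc)
    finally show ?thesis using 3 by simp
  qed
  then have "sigma n i x = pullback (6 * n) v (if 0 \<le> i \<and> i \<le> int n
       then degree_part (2 * nat i) (form_det (1\<^sub>m n + ?UX * ?UY)) else 0)" for i
    using total degree_part_pullback[OF v1]
    by (simp add: sigma_def chern_form_def h.hom_zero flip: Pf_def m_def)
  then show thesis by (rule that[OF v1])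
qed

section \<open>The intersection numbers\<close>

lemma jacobi_trudi_swap:
  "jacobi_trudi h j i k = - jacobi_trudi h i j k" "jacobi_trudi h i k j = - jacobi_trudi h i j k"
  by (simp_all add: jacobi_trudi_def algebra_simps)

lemma jacobi_trudi_eq_0:
  "i = j \<or> i = k \<or> j = k \<Longrightarrow> jacobi_trudi h i j k = 0"
  by (auto simp: jacobi_trudi_def algebra_simps)

section \<open>Universal top coefficients and the common integral\<close>

definition top_coeff :: "nat \<Rightarrow> eform \<Rightarrow> complex" where
  "top_coeff m F = coeff (form F) {..<m}"

lemma top_coeff_sum: "top_coeff m (sum F I) = (\<Sum>i\<in>I. top_coeff m (F i))"
  by (induction I rule: infinite_finite_induct)
    (simp_all add: top_coeff_def form.hom_zero zero_dform.rep_eq plus_dform.rep_eq)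

lemma top_coeff_uminus: "top_coeff m (- F) = - top_coeff m F"
  by (simp add: top_coeff_def uminus_dform.rep_eq)

lemma top_coeff_0: "top_coeff m 0 = 0"
  by (simp add: top_coeff_def form.hom_zero zero_dform.rep_eq)

lemma top_coeff_of_nat: "top_coeff m (of_nat k * F) = of_nat k * top_coeff m F"
  by (simp add: top_coeff_def form_of_nat coeff_const_form_times)

lemma top_coeff_minus_one_power: "top_coeff m ((- 1) ^ k * F) = (- 1) ^ k * top_coeff m F"
  by (cases "even k") (simp_all add: top_coeff_uminus)

text \<open>One constant \<open>I0\<close> serves all exponents and all triples: at each point the
  integrand is a universal top coefficient times the determinant of the substitution there. The
  shape with two arbitrary triples covers the curve numbers and, for special exponents, the Schubert
  degrees.\<close>

lemma schubert_classes_universal: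
  obtains h :: "int \<Rightarrow> eform" and e1 e2 e3 and I0 :: complex where
    "h 0 = 1" "\<And>k. k < 0 \<Longrightarrow> h k = 0" "\<And>k. k > int n \<Longrightarrow> h k = 0"
    "\<And>k. 0 < k \<Longrightarrow> h k = e1 * h (k - 1) - e2 * h (k - 2) + e3 * h (k - 3)"
    "\<And>a b c d I J. length I = 3 \<Longrightarrow> length J = 3 \<Longrightarrow> grassmannian_integral n
        (\<lambda>x. sigma n 1 x ^ a * sigma n 2 x ^ b * schubert_sigma n I x ^ c * schubert_sigma n J x ^ d) =
      top_coeff (6 * n) (h 1 ^ a * h 2 ^ b * jacobi_trudi h (I ! 0) (I ! 1) (I ! 2) ^ c
        * jacobi_trudi h (J ! 0) (J ! 1) (J ! 2) ^ d) * I0"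
proof -
  obtain h :: "int \<Rightarrow> eform" and e1 e2 e3 where
    form_h: "\<And>k. form (h k) = (if 0 \<le> k \<and> k \<le> int n
      then degree_part (2 * nat k) (form_det (1\<^sub>m n + universal_X n * universal_Y n)) else 0)" and
    h: "\<And>k. k > int n \<Longrightarrow> h k = 0" "h 0 = 1" "\<And>k. k < 0 \<Longrightarrow> h k = 0"
    "\<And>k. 0 < k \<Longrightarrow> h k = e1 * h (k - 1) - e2 * h (k - 2) + e3 * h (k - 3)"
    using chern_recurrence[OF universal_carrier homogeneous_universal] by blast
  \<comment> \<open>The substitution is chosen separately at each point, while the universal forms
    \<open>h i\<close> are the same for all points.\<close>
  have "\<exists>v. (\<forall>s. homogeneous 1 (v s)) \<and> (\<forall>i. sigma n i x = pullback (6 * n) v (form (h i)))" for x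
    using sigma_eq_pullback[of n x] unfolding form_h by metis
  then obtain v where v1: "\<And>x s. homogeneous 1 (v x s)"
    and sigma: "\<And>x i. sigma n i x = pullback (6 * n) (v x) (form (h i))"
    by metis
  have schubert: "schubert_sigma n I x = pullback (6 * n) (v x) (form (jacobi_trudi h (I ! 0) (I ! 1) (I ! 2)))"
    if "length I = 3" for I x
  proof -
    have "I = [I ! 0, I ! 1, I ! 2]"
      using that by (auto simp: numeral_3_eq_3 length_Suc_conv)
    then show ?thesis
      using form_det_jacobi_trudi[where s = "\<lambda>k. sigma n k x" and i = "I ! 0" and j = "I ! 1" and k = "I ! 2",
          OF pullback_hom[OF v1] sigma]
      unfolding schubert_sigma_def by metis
  qed
  define I0 where "I0 = (\<integral>x. coeff (ordered_prod (v x) {..<6 * n}) {..<6 * n} \<partial>(Pi\<^sub>M {..<6 * n} (\<lambda>_. lborel)))"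
  have "grassmannian_integral n
        (\<lambda>x. sigma n 1 x ^ a * sigma n 2 x ^ b * schubert_sigma n I x ^ c * schubert_sigma n J x ^ d) =
      top_coeff (6 * n) (h 1 ^ a * h 2 ^ b * jacobi_trudi h (I ! 0) (I ! 1) (I ! 2) ^ c
        * jacobi_trudi h (J ! 0) (J ! 1) (J ! 2) ^ d) * I0" (is "_ = top_coeff _ ?F * I0")
    if "length I = 3" "length J = 3" for a b c d I J
  proof -
    have "sigma n 1 x ^ a * sigma n 2 x ^ b * schubert_sigma n I x ^ c * schubert_sigma n J x ^ d =
        pullback (6 * n) (v x) (form ?F)" for x
    proof -
      interpret p: ring_hom "pullback (6 * n) (v x)" by (rule pullback_hom[OF v1])
      show ?thesis
        by (simp only: sigma schubert that form.hom_mult form.hom_power p.hom_mult p.hom_power)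
    qed
    \<comment> \<open>A constant factor passes through a Bochner integral unconditionally.\<close>
    then show ?thesis
      by (simp add: grassmannian_integral_def coeff_top_pullback[OF v1] top_coeff_def I0_def)
  qed
  then show thesis using that h by blast
qed

theorem theorem5p8:
  fixes n a b c d :: nat
  assumes "a + 2 * b + 2 * c + 3 * d = 3 * n"
  shows "curve_number n a b c d =
    (\<Sum>d'\<in>{0..d}. \<Sum>\<beta>\<in>weak_compositions 4 b. \<Sum>\<gamma>\<in>weak_compositions 3 (c + d').
       (- 1) ^ (d - d') * of_nat (d choose d') * of_nat (multinomial b \<beta>)
         * of_nat (multinomial (c + d') \<gamma>)
         * omega n
             (1 + (d - d') + \<gamma>!1 + \<gamma>!2 + \<beta>!0)
             (2 + (d - d') + \<gamma>!0 + \<gamma>!2 + \<beta>!1 + 2 * \<beta>!3)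
             (3 + (d - d') + \<gamma>!0 + \<gamma>!1 + 2 * \<beta>!2 + \<beta>!1))"
proof -
  obtain h :: "int \<Rightarrow> eform" and e1 e2 e3 and I0 :: complex where h0: "h 0 = 1"
    and hneg: "\<And>k. k < 0 \<Longrightarrow> h k = 0" and hlarge: "\<And>k. k > int n \<Longrightarrow> h k = 0"
    and rec: "\<And>k. 0 < k \<Longrightarrow> h k = e1 * h (k - 1) - e2 * h (k - 2) + e3 * h (k - 3)"
    and integral: "\<And>a b c d I J. length I = 3 \<Longrightarrow> length J = 3 \<Longrightarrow> grassmannian_integral n
        (\<lambda>x. sigma n 1 x ^ a * sigma n 2 x ^ b * schubert_sigma n I x ^ c * schubert_sigma n J x ^ d) =
      top_coeff (6 * n) (h 1 ^ a * h 2 ^ b * jacobi_trudi h (I ! 0) (I ! 1) (I ! 2) ^ c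
        * jacobi_trudi h (J ! 0) (J ! 1) (J ! 2) ^ d) * I0"
    using schubert_classes_universal[of n] by blast
  let ?J = "jacobi_trudi h" and ?K = "\<lambda>F. top_coeff (6 * n) F * I0"
  \<comment> \<open>Here e is the dimension 3n - w of the Schubert variety, since w = i + j + k -
    6.\<close>
  have degree: "schubert_degree n [i, j, k] = ?K (h 1 ^ e * ?J i j k)"
    if "1 \<le> i" "i < j" "j < k" "e + (i + j + k) = 3 * n + 6" for i j k e
  proof -
    have "3 * n - (\<Sum>s<3. [i, j, k] ! s - (s + 1)) = e"
      using that by (simp add: eval_nat_numeral)
    \<comment> \<open>The second triple carries exponent 0, so any list of length 3 may stand
      there.\<close>
    then show ?thesis
      using integral[of "[i, j, k]" "[i, j, k]" e 0 1 0] by (simp add: schubert_degree_def)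
  qed
  have omega: "omega n i j k = ?K (h 1 ^ e * ?J i j k)"
    if ijk: "1 \<le> i" "1 \<le> j" "1 \<le> k" and e: "e + (i + j + k) = 3 * n + 6" for i j k e
  proof (cases "{i, j, k} \<subseteq> {1..n + 3}")
    case False
    then have "i > n + 3 \<or> j > n + 3 \<or> k > n + 3" using ijk by auto
    \<comment> \<open>An index above n + 3 gives a zero row, since the arguments of its three
      entries all exceed n. This matches the convention that \<open>omega\<close> is 0
      there.\<close>
    then have "?J i j k = 0" by (auto simp: jacobi_trudi_def hlarge)
    then show ?thesis unfolding omega_def if_not_P[OF False] by (simp add: top_coeff_0)
  next
    case True
    \<comment> \<open>For distinct indices the sign of the product of differences is the sign of the
      sorting permutation, and the row swaps of the determinant reproduce it in each of the six
      orders.\<close>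
    consider "i = j \<or> i = k \<or> j = k" | "i < j" "j < k" | "i < k" "k < j" | "j < i" "i < k"
      | "j < k" "k < i" | "k < i" "i < j" | "k < j" "j < i" by linarith
    then show ?thesis
    proof cases
      case 1
      then show ?thesis using jacobi_trudi_eq_0[OF 1, of h] by (auto simp: omega_def top_coeff_0)
    next
      case 2
      then have "sgn ((int j - int i) * (int k - int i) * (int k - int j)) = 1"
        by (simp add: sgn_mult)
      then show ?thesis using 2 True degree[OF ijk(1) 2 e] by (simp add: omega_def)
    next
      case 3
      then have "sgn ((int j - int i) * (int k - int i) * (int k - int j)) = - 1"
        by (simp add: sgn_mult)
      then show ?thesis using 3 True degree[OF ijk(1) 3, of e] e jacobi_trudi_swap(2)[of h i k j]
        by (simp add: omega_def top_coeff_uminus add_ac)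
    next
      case 4
      then have "sgn ((int j - int i) * (int k - int i) * (int k - int j)) = - 1"
        by (simp add: sgn_mult)
      then show ?thesis using 4 True degree[OF ijk(2) 4, of e] e jacobi_trudi_swap(1)[of h j i k]
        by (simp add: omega_def top_coeff_uminus add_ac)
    next
      case 5
      then have "sgn ((int j - int i) * (int k - int i) * (int k - int j)) = 1"
        by (simp add: sgn_mult)
      then show ?thesis using 5 True degree[OF ijk(2) 5, of e] e
          jacobi_trudi_swap(2)[of h j k i] jacobi_trudi_swap(1)[of h j i k]
        by (simp add: omega_def top_coeff_uminus add_ac)
    next
      case 6
      then have "sgn ((int j - int i) * (int k - int i) * (int k - int j)) = 1"
        by (simp add: sgn_mult)
      then show ?thesis using 6 True degree[OF ijk(3) 6, of e] e
          jacobi_trudi_swap(1)[of h k i j] jacobi_trudi_swap(2)[of h i k j]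
        by (simp add: omega_def top_coeff_uminus add_ac)
    next
      case 7
      then have "sgn ((int j - int i) * (int k - int i) * (int k - int j)) = - 1"
        by (simp add: sgn_mult)
      then show ?thesis using 7 True degree[OF ijk(3) 7, of e] e
          jacobi_trudi_swap(1)[of h k j i] jacobi_trudi_swap(2)[of h j k i] jacobi_trudi_swap(1)[of h j i k]
        by (simp add: omega_def top_coeff_uminus add_ac)
    qed
  qed
  have "curve_number n a b c d = ?K (h 1 ^ a * h 2 ^ b * ?J 1 3 4 ^ c * ?J 1 3 5 ^ d)"
    using integral[of "[1, 3, 4]" "[1, 3, 5]" a b c d] by (simp add: curve_number_def)
  also have "\<dots> = (\<Sum>d'\<in>{0..d}. \<Sum>\<beta>\<in>weak_compositions 4 b. \<Sum>\<gamma>\<in>weak_compositions 3 (c + d').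
       (- 1) ^ (d - d') * of_nat (d choose d') * of_nat (multinomial b \<beta>)
         * of_nat (multinomial (c + d') \<gamma>)
         * ?K (h 1 ^ (a + d' + \<beta> ! 0) * ?J
             (1 + (d - d') + \<gamma>!1 + \<gamma>!2 + \<beta>!0)
             (2 + (d - d') + \<gamma>!0 + \<gamma>!2 + \<beta>!1 + 2 * \<beta>!3)
             (3 + (d - d') + \<gamma>!0 + \<gamma>!1 + 2 * \<beta>!2 + \<beta>!1)))"
    by (subst jacobi_trudi_expansion[OF h0 hneg rec], assumption, assumption)
      (simp only: top_coeff_sum sum_distrib_right mult.assoc top_coeff_of_nat top_coeff_minus_one_power)
  also have "\<dots> = (\<Sum>d'\<in>{0..d}. \<Sum>\<beta>\<in>weak_compositions 4 b. \<Sum>\<gamma>\<in>weak_compositions 3 (c + d').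
       (- 1) ^ (d - d') * of_nat (d choose d') * of_nat (multinomial b \<beta>)
         * of_nat (multinomial (c + d') \<gamma>)
         * omega n
             (1 + (d - d') + \<gamma>!1 + \<gamma>!2 + \<beta>!0)
             (2 + (d - d') + \<gamma>!0 + \<gamma>!2 + \<beta>!1 + 2 * \<beta>!3)
             (3 + (d - d') + \<gamma>!0 + \<gamma>!1 + 2 * \<beta>!2 + \<beta>!1))"
  proof (intro sum.cong refl arg_cong2[where f = "(*)"])
    fix d' \<beta> \<gamma>
    assume d': "d' \<in> {0..d}" and \<beta>: "\<beta> \<in> weak_compositions 4 b" and \<gamma>: "\<gamma> \<in> weak_compositions 3 (c + d')"
    have "\<beta>!0 + \<beta>!1 + \<beta>!2 + \<beta>!3 = b"
      using \<beta> by (auto simp: weak_compositions_def eval_nat_numeral length_Suc_conv)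
    moreover have "\<gamma>!0 + \<gamma>!1 + \<gamma>!2 = c + d'"
      using \<gamma> by (auto simp: weak_compositions_def eval_nat_numeral length_Suc_conv)
    \<comment> \<open>The exponent and the three indices add up to a + 2b + 2c + 3d + 6 = 3n + 6: a
      choice of x_1 h_1 raises the indices by one and the exponent by one, and each of the d'
      factors e1 e2 raises the indices by two and the exponent by one.\<close>
    ultimately show "?K (h 1 ^ (a + d' + \<beta> ! 0) * ?J
             (1 + (d - d') + \<gamma>!1 + \<gamma>!2 + \<beta>!0)
             (2 + (d - d') + \<gamma>!0 + \<gamma>!2 + \<beta>!1 + 2 * \<beta>!3)
             (3 + (d - d') + \<gamma>!0 + \<gamma>!1 + 2 * \<beta>!2 + \<beta>!1)) =
        omega n
             (1 + (d - d') + \<gamma>!1 + \<gamma>!2 + \<beta>!0)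
             (2 + (d - d') + \<gamma>!0 + \<gamma>!2 + \<beta>!1 + 2 * \<beta>!3)
             (3 + (d - d') + \<gamma>!0 + \<gamma>!1 + 2 * \<beta>!2 + \<beta>!1)"
      using assms d' by (intro omega[symmetric]) auto
  qed
  finally show ?thesis .
qed

end
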